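(* (i) Let $(E,\mathcal{B})$ be a Lusin measurable space and let $(P_t)_{t\ge0}$ be the transition function of a conservative right Markov process $X$ with state space $E$, where $P_t$ is a kernel on $(E,\mathcal{B})$ for all $t>0$. Assume that $(P_t)_{t\ge0}$ is a strong Feller semigroup on $E$ endowed with some given Lusin topology whose Borel $\sigma$-algebra is $\mathcal{B}$. Let $N\in\mathcal{B}$ be a $(P_t)$-negligible set, let $F:=E\setminus N$, and let $(Q_t)_{t\ge0}$ be the restriction of $(P_t)_{t\ge0}$ from $E$ to $F$. Then $(Q_t)_{t\ge0}$ is a strong Feller semigroup on the Lusin topological space $F$ with respect to the trace topology, and there exists no right Markov process with state space $F$ having $(Q_t)_{t\ge0}$ as transition function. (ii) Suppose, in addition to the assumptions of (i), that $E$ is a Polish space, that $N$ is a closed set, and that the function $[0,\infty)\times E\ni(t,x)\mapsto P_tf(x)$ is jointly continuous for each $f\in C_b(E)$. Then $(Q_t)_{t\ge0}$ is a strong Feller semigroup on the Polish topological space $F$, $(t,x)\mapsto Q_tf(x)$ is jointly continuous on $[0,\infty)\times F$ for each $f\in C_b(F)$, and there is no right Markov process with state space $F$ having $(Q_t)_{t\ge0}$ as transition function. (iii) Let $(P_t)_{t\ge0}$ be the one-dimensional Gaussian semigroup, i.e. the transition function of the real-valued Brownian motion, and let $(Q_t)_{t\ge0}$ be its restriction from $\mathbb{R}$ to $\mathbb{R}_\ast:=\mathbb{R}\setminus\{0\}$. Then $(Q_t)_{t\ge0}$ is a strong Feller semigroup on the Polish topological space $\mathbb{R}_\ast$, $(t,x)\mapsto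 Q_tf(x)$ is jointly continuous on $[0,\infty)\times\mathbb{R}_\ast$ for each $f\in C_b(\mathbb{R}_\ast)$, and there is no right Markov process with state space $\mathbb{R}_\ast$ having $(Q_t)_{t\ge0}$ as transition semigroup. In particular, there exists no right Markov process associated with $(Q_t)_{t\ge0}$, no matter what Lusin topology is chosen on $\mathbb{R}_\ast$ among those whose Borel $\sigma$-algebra is the one generated by intervals.
   Context: A Lusin topological space is a topological space homeomorphic to a Borel subset of a compact metric space; a Lusin measurable space is a measurable space whose $\sigma$-algebra is the Borel $\sigma$-algebra of some Lusin topology. A Polish space is a topological space homeomorphic to a complete separable metric space. $C_b$ and $\mathcal{B}_b$ denote bounded continuous, respectively bounded Borel, real functions. A semigroup of kernels $(P_t)_{t\ge0}$ (with $P_0=\mathrm{Id}$) on $E$ is strong Feller if $P_tf\in C_b(E)$ for all $f\in\mathcal{B}_b(E)$ and $t>0$. The resolvent associated with $(P_t)_{t\ge0}$ is $\mathcal{U}=(U_q)_{q>0}$, $U_qf=\int_0^\infty e^{-qt}P_tf\,dt$. For $\beta>0$, a Borel function $u:E\to[0,\infty]$ is $\mathcal{U}_\beta$-excessive if $qU_{\beta+q}u\le u$ for all $q>0$ and $\lim_{q\to\infty}qU_{\beta+q}u(x)=u(x)$ for all $x\in E$. Right Markov process: a right Markov process with state space $E$ (with $\sigma$-algebra $\mathcal{B}$) is a normal ($\mathbb{P}^x(X_0=x)=1$), temporally homogeneous Markov process $X=(\Omega,\mathcal{F},\mathcal{F}_t,X_t,\theta_t,\mathbb{P}^x)$, $x\in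 E$, with shift operators $\theta_t$ (possibly with a lifetime $\zeta$ after which it stays at a cemetery point, functions being extended by $0$ there; conservative means $\zeta=\infty$ a.s.) such that: (a) the filtration $(\mathcal{F}_t)$ is right-continuous and augmented, i.e. $\mathcal{F}_t=\bigcap_\mu\mathcal{F}_t^\mu$, where $\mu$ runs over all probability measures on $(E,\mathcal{B})$, $\mathbb{P}^\mu=\int\mathbb{P}^x\mu(dx)$, and $\mathcal{F}_t^\mu$ is the completion of $\mathcal{F}_t$ with respect to $\mathbb{P}^\mu$; (b) for one (hence all) $\beta>0$ and every $\mathcal{U}_\beta$-excessive $u$, where $\mathcal{U}$ is the resolvent of $X$, $t\mapsto u(X_t)$ is right-continuous $\mathbb{P}^x$-a.s. for all $x\in E$; (c) there exists a Lusin topology on $E$ with Borel $\sigma$-algebra exactly $\mathcal{B}$ with respect to which the paths of $X$ are right-continuous $\mathbb{P}^x$-a.s. for all $x\in E$. Non-existence of a right Markov process on $F$ thus means non-existence for any Lusin topology on $F$ with Borel $\sigma$-algebra $\mathcal{B}|_F$. The transition function of $X$ is $P_tf(x)=\mathbb{E}^xf(X_t)$. A set $N\in\mathcal{B}$ is $(P_t)$-negligible if $P_t(1_N)\equiv0$ for all $t>0$. For such $N$, the restriction $(Q_t)_{t\ge0}$ of $(P_t)_{t\ge 0}$ to $F=E\setminus N$ is $Q_t(x,A)=P_t(x,A)$ for $t\ge0$, $x\in F$, $A\in\mathcal{B}|_F$ ($P_t(x,\cdot)$ denoting the measure attached to $x$); it is a sub-Markovian semigroup of kernels on $(F,\ma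thcal{B}|_F)$.
   Formalization: In (i) and (ii) the non-existence of a right Markov process on F is claimed only when N is not polar for X (X hits N at a positive time with positive probability from some starting point); for polar N, e.g. N empty, the claim is false. *)

theory Defs
  imports "HOL-Analysis.Analysis" "HOL-Probability.Probability"
begin

section \<open>Lusin and Polish topologies\<close>

definition borel_of :: "'a topology \<Rightarrow> 'a measure" where
  "borel_of T = sigma (topspace T) {U. openin T U}"

text \<open>
  A compact metric space has at most the cardinality of the continuum, so, up to isometry, every
  compact metric space has a subset of \<^typ>\<open>real\<close> as its carrier, with a metric
  unrelated to the usual one.  The quantification over \<open>K\<close> and \<open>d\<close> is therefore a
  quantification over all compact metric spaces.
\<close>
definition lusin_topology :: "'a topology \<Rightarrow> bool" where
  "lusin_topology T \<longleftrightarrow>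
     (\<exists>(K :: real set) d B. Metric_space K d \<and> compact_space (Metric_space.mtopology K d) \<and>
        B \<in> sets (borel_of (Metric_space.mtopology K d)) \<and>
        T homeomorphic_space subtopology (Metric_space.mtopology K d) B)"

definition lusin_topology_of :: "'a measure \<Rightarrow> 'a topology \<Rightarrow> bool" where
  "lusin_topology_of M T \<longleftrightarrow>
     lusin_topology T \<and> topspace T = space M \<and> sets (borel_of T) = sets M"

definition lusin_measurable_space :: "'a measure \<Rightarrow> bool" where
  "lusin_measurable_space M \<longleftrightarrow> (\<exists>T. lusin_topology_of M T)"

definition polish_topology :: "'a topology \<Rightarrow> bool" where
  "polish_topology T \<longleftrightarrow> completely_metrizable_space T \<and> separable_space T"


section \<open>Semigroups of kernels\<close>

definition Cb :: "'a topology \<Rightarrow> ('a \<Rightarrow> real) set" where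
  "Cb T = {f. continuous_map T euclideanreal f \<and> bounded (f ` topspace T)}"

definition Bb :: "'a measure \<Rightarrow> ('a \<Rightarrow> real) set" where
  "Bb M = {f. f \<in> borel_measurable M \<and> bounded (f ` space M)}"

text \<open>In all that follows, time is real, and only the times \<open>t \<ge> 0\<close> matter.\<close>

definition kernel_semigroup :: "'a measure \<Rightarrow> (real \<Rightarrow> 'a \<Rightarrow> 'a measure) \<Rightarrow> bool" where
  "kernel_semigroup M P \<longleftrightarrow>
     (\<forall>t\<ge>0. P t \<in> M \<rightarrow>\<^sub>M subprob_algebra M) \<and>
     (\<forall>x\<in>space M. P 0 x = return M x) \<and>
     (\<forall>s\<ge>0. \<forall>t\<ge>0. \<forall>x\<in>space M. \<forall>A\<in>sets M.
        emeasure (P (s + t) x) A = (\<integral>\<^sup>+y. emeasure (P t y) A \<partial>P s x))"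

definition strong_feller :: "'a topology \<Rightarrow> (real \<Rightarrow> 'a \<Rightarrow> 'a measure) \<Rightarrow> bool" where
  "strong_feller T P \<longleftrightarrow>
     kernel_semigroup (borel_of T) P \<and>
     (\<forall>t>0. \<forall>f\<in>Bb (borel_of T). (\<lambda>x. \<integral>y. f y \<partial>P t x) \<in> Cb T)"

definition jointly_continuous :: "'a topology \<Rightarrow> (real \<Rightarrow> 'a \<Rightarrow> 'a measure) \<Rightarrow> bool" where
  "jointly_continuous T P \<longleftrightarrow>
     (\<forall>f\<in>Cb T. continuous_map (prod_topology (top_of_set {0..}) T) euclideanreal
        (\<lambda>(t, x). \<integral>y. f y \<partial>P t x))"

definition negligible_set ::
  "'a measure \<Rightarrow> (real \<Rightarrow> 'a \<Rightarrow> 'a measure) \<Rightarrow> 'a set \<Rightarrow> bool" where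
  "negligible_set M P N \<longleftrightarrow> N \<in> sets M \<and> (\<forall>t>0. \<forall>x\<in>space M. emeasure (P t x) N = 0)"

definition restrict_semigroup ::
  "(real \<Rightarrow> 'a \<Rightarrow> 'a measure) \<Rightarrow> 'a set \<Rightarrow> real \<Rightarrow> 'a \<Rightarrow> 'a measure" where
  "restrict_semigroup P F t x = restrict_space (P t x) F"

definition gaussian_semigroup :: "real \<Rightarrow> real \<Rightarrow> real measure" where
  "gaussian_semigroup t x =
     (if t = 0 then return borel x
      else density lborel (\<lambda>y. ennreal (normal_density x (sqrt t) y)))"


section \<open>Excessive functions\<close>

text \<open>Here a semigroup acts on \<open>[0, \<infinity>]\<close>-valued functions.\<close>

definition resolvent ::
  "(real \<Rightarrow> ('a \<Rightarrow> ennreal) \<Rightarrow> 'a \<Rightarrow> ennreal) \<Rightarrow> real \<Rightarrow> ('a \<Rightarrow> ennreal) \<Rightarrow> 'a \<Rightarrow> ennreal" where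
  "resolvent S q u x = (\<integral>\<^sup>+t\<in>{0..}. ennreal (exp (- (q * t))) * S t u x \<partial>lborel)"

definition excessive ::
  "'a measure \<Rightarrow> (real \<Rightarrow> ('a \<Rightarrow> ennreal) \<Rightarrow> 'a \<Rightarrow> ennreal) \<Rightarrow> real \<Rightarrow> ('a \<Rightarrow> ennreal) \<Rightarrow> bool" where
  "excessive M S \<beta> u \<longleftrightarrow>
     u \<in> borel_measurable M \<and>
     (\<forall>x\<in>space M.
        (\<forall>q>0. ennreal q * resolvent S (\<beta> + q) u x \<le> u x) \<and>
        ((\<lambda>q. ennreal q * resolvent S (\<beta> + q) u x) \<longlongrightarrow> u x) at_top)"


section \<open>Right Markov processes\<close>

text \<open>
  The tuple \<open>(\<Omega>, \<F>, \<F>\<^sub>t, X\<^sub>t, \<theta>\<^sub>t, \<P>\<^sup>x)\<close>.  Only the measurable space of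
  \<open>base\<close> is used, and of \<open>filt t\<close> likewise.  The paths take values in \<open>'a option\<close>, where
  \<^term>\<open>None\<close> is the cemetery.  A function \<open>f\<close> on the state space is extended by \<open>0\<close> to the
  cemetery as \<^term>\<open>case_option 0 f\<close>.
\<close>
record ('w, 'a) process =
  base :: "'w measure"
  filt :: "real \<Rightarrow> 'w measure"
  path :: "real \<Rightarrow> 'w \<Rightarrow> 'a option"
  shift :: "real \<Rightarrow> 'w \<Rightarrow> 'w"
  law :: "'a \<Rightarrow> 'w measure"

definition process_semigroup ::
  "('w, 'a) process \<Rightarrow> real \<Rightarrow> ('a \<Rightarrow> ennreal) \<Rightarrow> 'a \<Rightarrow> ennreal" where
  "process_semigroup X t u x = (\<integral>\<^sup>+\<omega>. case_option 0 u (path X t \<omega>) \<partial>law X x)"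

definition transition_function ::
  "'a measure \<Rightarrow> ('w, 'a) process \<Rightarrow> (real \<Rightarrow> 'a \<Rightarrow> 'a measure) \<Rightarrow> bool" where
  "transition_function M X P \<longleftrightarrow>
     (\<forall>t\<ge>0. \<forall>x\<in>space M. sets (P t x) = sets M \<and>
        (\<forall>u\<in>borel_measurable M. (\<integral>\<^sup>+y. u y \<partial>P t x) = process_semigroup X t u x))"

definition lifetime :: "('w, 'a) process \<Rightarrow> 'w \<Rightarrow> ereal" where
  "lifetime X \<omega> = Inf {ereal t | t. 0 \<le> t \<and> path X t \<omega> = None}"

definition conservative :: "'a measure \<Rightarrow> ('w, 'a) process \<Rightarrow> bool" where
  "conservative M X \<longleftrightarrow> (\<forall>x\<in>space M. AE \<omega> in law X x. lifetime X \<omega> = \<infinity>)"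

definition hitting_time :: "('w, 'a) process \<Rightarrow> 'a set \<Rightarrow> 'w \<Rightarrow> ereal" where
  "hitting_time X N \<omega> = Inf {ereal t | t. 0 < t \<and> path X t \<omega> \<in> Some ` N}"

definition polar :: "'a measure \<Rightarrow> ('w, 'a) process \<Rightarrow> 'a set \<Rightarrow> bool" where
  "polar M X N \<longleftrightarrow> (\<forall>x\<in>space M. AE \<omega> in law X x. hitting_time X N \<omega> = \<infinity>)"

text \<open>
  The measure \<open>\<P>\<^sup>\<mu> = \<integral> \<P>\<^sup>x \<mu>(dx)\<close>.  As \<open>x \<mapsto> \<P>\<^sup>x(\<Gamma>)\<close> is in general only universally
  measurable, it is integrated with respect to the completion of \<open>\<mu>\<close>.
\<close>
definition law_from :: "('w, 'a) process \<Rightarrow> 'a measure \<Rightarrow> 'w measure" where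
  "law_from X \<mu> = measure_of (space (base X)) (sets (base X))
     (\<lambda>\<Gamma>. \<integral>\<^sup>+x. emeasure (law X x) \<Gamma> \<partial>completion \<mu>)"

definition prob_measures :: "'a measure \<Rightarrow> 'a measure set" where
  "prob_measures M = {\<mu>. prob_space \<mu> \<and> sets \<mu> = sets M}"

locale markov_process =
  fixes M :: "'a measure" and X :: "('w, 'a) process"
  assumes subalgebra_filt: "\<And>t. 0 \<le> t \<Longrightarrow> subalgebra (base X) (filt X t)"
    and filt_mono: "\<And>s t. 0 \<le> s \<Longrightarrow> s \<le> t \<Longrightarrow> subalgebra (filt X t) (filt X s)"
    and prob_space_law: "\<And>x. x \<in> space M \<Longrightarrow> prob_space (law X x)"
    and sets_law: "\<And>x. x \<in> space M \<Longrightarrow> sets (law X x) = sets (base X)"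
    and universally_measurable_law: "\<And>\<Gamma> \<mu>. \<Gamma> \<in> sets (base X) \<Longrightarrow> \<mu> \<in> prob_measures M \<Longrightarrow>
      (\<lambda>x. emeasure (law X x) \<Gamma>) \<in> borel_measurable (completion \<mu>)"
    and path_in: "\<And>t \<omega>. 0 \<le> t \<Longrightarrow> \<omega> \<in> space (base X) \<Longrightarrow>
      path X t \<omega> \<in> insert None (Some ` space M)"
    and adapted: "\<And>t A. 0 \<le> t \<Longrightarrow> A \<in> sets M \<Longrightarrow>
      {\<omega> \<in> space (base X). path X t \<omega> \<in> Some ` A} \<in> sets (filt X t)"
    and absorbed: "\<And>s t \<omega>. 0 \<le> s \<Longrightarrow> s \<le> t \<Longrightarrow> \<omega> \<in> space (base X) \<Longrightarrow>
      path X s \<omega> = None \<Longrightarrow> path X t \<omega> = None"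
    and shift_in: "\<And>t \<omega>. 0 \<le> t \<Longrightarrow> \<omega> \<in> space (base X) \<Longrightarrow> shift X t \<omega> \<in> space (base X)"
    and path_shift: "\<And>s t \<omega>. 0 \<le> s \<Longrightarrow> 0 \<le> t \<Longrightarrow> \<omega> \<in> space (base X) \<Longrightarrow>
      path X s (shift X t \<omega>) = path X (s + t) \<omega>"
    and normal: "\<And>x. x \<in> space M \<Longrightarrow> AE \<omega> in law X x. path X 0 \<omega> = Some x"
    and markov: "\<And>x s t f. x \<in> space M \<Longrightarrow> 0 \<le> s \<Longrightarrow> 0 \<le> t \<Longrightarrow> f \<in> Bb M \<Longrightarrow>
      AE \<omega> in law X x.
        real_cond_exp (law X x) (filt X t) (\<lambda>\<omega>'. case_option 0 f (path X (t + s) \<omega>')) \<omega> =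
        case_option 0 (\<lambda>y. \<integral>\<omega>'. case_option 0 f (path X s \<omega>') \<partial>law X y) (path X t \<omega>)"

text \<open>The cemetery is adjoined to the state space as an isolated point.\<close>
definition cemetery_topology :: "'a topology \<Rightarrow> 'a option topology" where
  "cemetery_topology T =
     topology (\<lambda>U. openin T (Some -` U))"

lemma openin_cemetery_topology: "openin (cemetery_topology T) U \<longleftrightarrow> openin T (Some -` U)"
proof -
  have "istopology (\<lambda>U. openin T (Some -` U))"
    unfolding istopology_def by (auto simp: vimage_Union)
  then show ?thesis
    by (simp add: cemetery_topology_def topology_inverse')
qed

definition right_continuous_path :: "'a topology \<Rightarrow> (real \<Rightarrow> 'a option) \<Rightarrow> bool" where
  "right_continuous_path T w \<longleftrightarrow>
     (\<forall>t\<ge>0. limitin (cemetery_topology T) w (w t) (at_right t))"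

text \<open>
  The locale states everything but the existence of a Lusin topology with right-continuous
  paths.  In \<open>augmented\<close>, the right-hand side is \<open>\<Inter>\<^sub>\<mu> \<F>\<^sub>t\<^sup>\<mu>\<close>.
\<close>
locale right_markov_process_core = markov_process +
  assumes filt_right_continuous: "\<And>t. 0 \<le> t \<Longrightarrow> sets (filt X t) = (\<Inter>s\<in>{t<..}. sets (filt X s))"
    and augmented: "\<And>t. 0 \<le> t \<Longrightarrow>
      sets (filt X t) = {\<Gamma> \<in> Pow (space (base X)). \<forall>\<mu>\<in>prob_measures M.
        \<Gamma> \<in> sets (completion (restr_to_subalg (law_from X \<mu>) (filt X t)))}"
    and excessive_right_continuous:
      "\<exists>\<beta>>0. \<forall>u. excessive M (process_semigroup X) \<beta> u \<longrightarrow> (\<forall>x\<in>space M. AE \<omega> in law X x.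
        \<forall>t\<ge>0. ((\<lambda>s. case_option 0 u (path X s \<omega>)) \<longlongrightarrow> case_option 0 u (path X t \<omega>)) (at_right t))"

definition right_markov_process_wrt ::
  "'a topology \<Rightarrow> 'a measure \<Rightarrow> ('w, 'a) process \<Rightarrow> bool" where
  "right_markov_process_wrt T M X \<longleftrightarrow>
     right_markov_process_core M X \<and> lusin_topology_of M T \<and>
     (\<forall>x\<in>space M. AE \<omega> in law X x. right_continuous_path T (\<lambda>t. path X t \<omega>))"

definition right_markov_process :: "'a measure \<Rightarrow> ('w, 'a) process \<Rightarrow> bool" where
  "right_markov_process M X \<longleftrightarrow> (\<exists>T. right_markov_process_wrt T M X)"

end

theory Submission
  imports Defs "HOL-Real_Asymp.Real_Asymp"
begin

text \<open>
  The statements on topologies and kernels are routine: \<open>P\<^sub>t(x, \<cdot>)\<close> is carried by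
  \<open>F = E - N\<close> whenever \<open>x \<in> F\<close>, so that \<open>Q\<^sub>tf = P\<^sub>t(f 1\<^sub>F)\<close>.  For joint continuity the
  discontinuity of \<open>f 1\<^sub>F\<close> along the closed set \<open>N\<close> is removed by a cutoff function, at a cost
  that is small near any given point of \<open>[0, \<infinity>) \<times> F\<close>.

  The core is \<open>polar_of_right_process_on_complement\<close>: if a right process \<open>Y\<close> on \<open>F\<close> had the
  transition function \<open>Q\<close>, then \<open>X\<close> would almost surely never meet \<open>N\<close> at a positive time.
  Both processes have the same finite-dimensional distributions, but paths that agree at rational times
  are to be compared at all times, and the topologies in which the two processes are right-continuous
  have nothing to do with each other.  Excessive functions bridge this gap, because the
  resolvent of \<open>Y\<close> is the restriction of the resolvent of \<open>X\<close>.  For \<open>f\<close> continuous in a topology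
  in which \<open>X\<close> is right-continuous, the functions
  \<open>v\<^sub>\<epsilon> = \<integral>\<^sub>\<epsilon>\<^sup>\<infinity> e\<^sup>-\<^sup>\<alpha>\<^sup>t P\<^sub>tf dt\<close> are excessive for both processes
  (\<open>excessive_potential_tail\<close>), hence right-continuous along the paths of both; and
  \<open>(v\<^sub>0 - v\<^sub>\<epsilon>)/\<epsilon>\<close> tends to \<open>f\<close> (\<open>potential_tail_derivative\<close>).  A countable family \<open>g\<close> of such
  functions therefore generates the \<open>\<sigma>\<close>-algebra of \<open>E\<close>, and \<open>N\<close> is the preimage under \<open>g\<close> of a
  measurable set \<open>D\<close> of sequences.  In terms of the path at rational times, to meet \<open>N\<close> means
  that the right limit of \<open>g\<close> along the path lies in \<open>D\<close> at some time.

  The set of paths with this property is a projection of a measurable set along the time axis.  It need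
  not be measurable, and this is the only serious obstacle: without measurability, the fact
  that \<open>Y\<close> avoids the set says nothing about \<open>X\<close>.  By the measurable projection theorem
  (\<open>measurable_projection\<close>), which is proved here by Choquet's capacitability
  argument, it is measurable for the completion of every finite measure.  The law of \<open>X\<close>
  after a time \<open>s > 0\<close> is the mixture of the laws of \<open>Y\<close> over the distribution of \<open>X\<^sub>s\<close>, which is
  carried by \<open>F\<close> (\<open>path_law_eq\<close>), so the set is null for it.

  For the Gaussian semigroup no Brownian motion has to be constructed.  A right process \<open>Y\<close> on
  the punctured line with this semigroup would have paths that are right-continuous for the usual topology,
  because \<open>exp (c x)\<close> is excessive; its overshoot below \<open>0\<close> along dyadic grids would tend to \<open>0\<close>, by the
  fourth moment of the normal distribution; and then the infimum of the dyadic times at which it is not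
  positive would be a time at which it is \<open>0\<close> (\<open>right_continuous_crossing\<close>).
\<close>

section \<open>Measurable projection\<close>

text \<open>
  The usual schemes are indexed by finite sequences.  Here the sets are indexed by infinite
  sequences, on which they depend in a locally constant way.  This form is stable under the recodings of
  \<open>\<sigma>\<close> that show closure under countable unions and intersections.
\<close>
definition souslin_scheme :: "'a set set \<Rightarrow> (nat \<Rightarrow> (nat \<Rightarrow> nat) \<Rightarrow> 'a set) \<Rightarrow> bool" where
  "souslin_scheme \<P> R \<longleftrightarrow> (\<forall>n \<sigma>. R n \<sigma> \<in> \<P> \<and>
     (\<exists>J. finite J \<and> (\<forall>\<tau>. (\<forall>i\<in>J. \<sigma> i = \<tau> i) \<longrightarrow> R n \<tau> = R n \<sigma>)))"

text \<open>
  The result of the Souslin operation applied to sets of the paving \<open>\<P>\<close>.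
\<close>
definition souslin :: "'a set set \<Rightarrow> 'a set \<Rightarrow> bool" where
  "souslin \<P> A \<longleftrightarrow> (\<exists>R. souslin_scheme \<P> R \<and> A = {z. \<exists>\<sigma>. \<forall>n. z \<in> R n \<sigma>})"

lemma souslin_paving: "P \<in> \<P> \<Longrightarrow> souslin \<P> P"
  unfolding souslin_def souslin_scheme_def by (intro exI[of _ "\<lambda>_ _. P"]) auto

lemma souslin_subset: "souslin \<P> A \<Longrightarrow> A \<subseteq> \<Union>\<P>"
  unfolding souslin_def souslin_scheme_def by blast

text \<open>
  The first coordinate of \<open>\<sigma>\<close> chooses \<open>k\<close>, the others form a sequence for \<open>A k\<close>.
\<close>
lemma souslin_UN:
  fixes A :: "nat \<Rightarrow> 'a set"
  assumes "\<And>k. souslin \<P> (A k)"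
  shows "souslin \<P> (\<Union>k. A k)"
proof -
  obtain R where scheme: "\<And>k. souslin_scheme \<P> (R k)"
    and A: "\<And>k. A k = {z. \<exists>\<sigma>. \<forall>n. z \<in> R k n \<sigma>}"
    using assms unfolding souslin_def by metis
  have R: "R k n \<sigma> \<in> \<P>"
    and loc: "\<exists>J. finite J \<and> (\<forall>\<tau>. (\<forall>i\<in>J. \<sigma> i = \<tau> i) \<longrightarrow> R k n \<tau> = R k n \<sigma>)" for k n \<sigma>
    using scheme[of k] by (auto simp: souslin_scheme_def)
  let ?S = "\<lambda>n \<sigma>. R (\<sigma> 0) n (\<lambda>i. \<sigma> (Suc i))"
  have "\<exists>J. finite J \<and> (\<forall>\<tau>. (\<forall>i\<in>J. \<sigma> i = \<tau> i) \<longrightarrow> ?S n \<tau> = ?S n \<sigma>)" for n \<sigma>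
  proof -
    obtain J where J: "finite J"
      "\<And>\<tau>. (\<forall>i\<in>J. \<sigma> (Suc i) = \<tau> i) \<Longrightarrow> R (\<sigma> 0) n \<tau> = R (\<sigma> 0) n (\<lambda>i. \<sigma> (Suc i))"
      using loc[of "\<lambda>i. \<sigma> (Suc i)" "\<sigma> 0" n] by auto
    show ?thesis
    proof (intro exI conjI allI impI)
      fix \<tau> assume "\<forall>i\<in>insert 0 (Suc ` J). \<sigma> i = \<tau> i"
      then have "R (\<sigma> 0) n (\<lambda>i. \<tau> (Suc i)) = R (\<sigma> 0) n (\<lambda>i. \<sigma> (Suc i))" and "\<sigma> 0 = \<tau> 0"
        by (intro J(2), auto)
      then show "?S n \<tau> = ?S n \<sigma>" by simp
    qed (use J(1) in auto)
  qed
  moreover have "(\<Union>k. A k) = {z. \<exists>\<sigma>. \<forall>n. z \<in> ?S n \<sigma>}"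
  proof safe
    fix z k assume "z \<in> A k"
    then obtain \<sigma> where "\<forall>n. z \<in> R k n \<sigma>" using A by auto
    then show "\<exists>\<sigma>. \<forall>n. z \<in> ?S n \<sigma>"
      by (intro exI[of _ "case_nat k \<sigma>"]) auto
  qed (use A in auto)
  ultimately show ?thesis
    unfolding souslin_def souslin_scheme_def using R by (intro exI[of _ ?S]) auto
qed

lemma souslin_INT:
  fixes A :: "nat \<Rightarrow> 'a set"
  assumes "\<And>k. souslin \<P> (A k)"
  shows "souslin \<P> (\<Inter>k. A k)"
proof -
  obtain R where scheme: "\<And>k. souslin_scheme \<P> (R k)"
    and A: "\<And>k. A k = {z. \<exists>\<sigma>. \<forall>n. z \<in> R k n \<sigma>}"
    using assms unfolding souslin_def by metis
  have R: "R k n \<sigma> \<in> \<P>"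
    and loc: "\<exists>J. finite J \<and> (\<forall>\<tau>. (\<forall>i\<in>J. \<sigma> i = \<tau> i) \<longrightarrow> R k n \<tau> = R k n \<sigma>)" for k n \<sigma>
    using scheme[of k] by (auto simp: souslin_scheme_def)
  \<comment> \<open>One sequence codes a sequence of sequences through the pairing function.\<close>
  let ?c = "\<lambda>(\<sigma> :: nat \<Rightarrow> nat) k j. \<sigma> (prod_encode (k, j))"
  let ?S = "\<lambda>m \<sigma>. R (fst (prod_decode m)) (snd (prod_decode m)) (?c \<sigma> (fst (prod_decode m)))"
  have "\<exists>J. finite J \<and> (\<forall>\<tau>. (\<forall>i\<in>J. \<sigma> i = \<tau> i) \<longrightarrow> ?S m \<tau> = ?S m \<sigma>)" for m \<sigma>
  proof -
    let ?k = "fst (prod_decode m)"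
    obtain J where J: "finite J" "\<And>\<tau>. (\<forall>i\<in>J. ?c \<sigma> ?k i = \<tau> i) \<Longrightarrow>
        R ?k (snd (prod_decode m)) \<tau> = R ?k (snd (prod_decode m)) (?c \<sigma> ?k)"
      using loc[of "?c \<sigma> ?k" ?k "snd (prod_decode m)"] by auto
    show ?thesis
    proof (intro exI conjI allI impI)
      fix \<tau> assume "\<forall>i\<in>(\<lambda>j. prod_encode (?k, j)) ` J. \<sigma> i = \<tau> i"
      then show "?S m \<tau> = ?S m \<sigma>" by (intro J(2)) auto
    qed (use J(1) in auto)
  qed
  moreover have "(\<Inter>k. A k) = {z. \<exists>\<sigma>. \<forall>n. z \<in> ?S n \<sigma>}"
  proof safe
    fix z assume "z \<in> (\<Inter>k. A k)"
    then obtain s where s: "\<And>k n. z \<in> R k n (s k)" unfolding A by simp metis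
    show "\<exists>\<sigma>. \<forall>m. z \<in> ?S m \<sigma>"
      using s by (intro exI[of _ "\<lambda>m. s (fst (prod_decode m)) (snd (prod_decode m))"]) auto
  next
    fix z k \<sigma> assume *: "\<forall>m. z \<in> ?S m \<sigma>"
    have "z \<in> R k n (?c \<sigma> k)" for n
      using *[rule_format, of "prod_encode (k, n)"] by simp
    then show "z \<in> A k" unfolding A by blast
  qed
  ultimately show ?thesis
    unfolding souslin_def souslin_scheme_def using R by (intro exI[of _ ?S]) auto
qed

lemma souslin_Un:
  assumes "souslin \<P> A" "souslin \<P> B"
  shows "souslin \<P> (A \<union> B)"
proof -
  have "A \<union> B = (\<Union>k::nat. if k = 0 then A else B)"
    by (auto split: if_splits intro: exI[of _ 0] exI[of _ 1])
  also have "souslin \<P> \<dots>"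
    using assms by (intro souslin_UN) auto
  finally show ?thesis .
qed

text \<open>
  Compactness of the product of the finite sets \<open>{..\<tau> i}\<close>, with convergence spelled out.
\<close>
lemma bounded_sequences_subseq:
  fixes \<tau> :: "nat \<Rightarrow> nat" and s :: "nat \<Rightarrow> nat \<Rightarrow> nat"
  assumes "\<And>j i. s j i \<le> \<tau> i"
  shows "\<exists>r \<sigma>. strict_mono r \<and> (\<forall>i. \<sigma> i \<le> \<tau> i) \<and>
    (\<forall>J. finite J \<longrightarrow> (\<forall>\<^sub>F j in sequentially. \<forall>i\<in>J. s (r j) i = \<sigma> i))"
proof -
  have "compact (Pi\<^sub>E UNIV (\<lambda>i. {..\<tau> i}))"
    using compactin_PiE[of "\<lambda>_. euclidean" UNIV "\<lambda>i. {..\<tau> i}"] 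
    by (simp add: euclidean_product_topology finite_imp_compact)
  then have "seq_compact (Pi\<^sub>E UNIV (\<lambda>i. {..\<tau> i}))"
    by (rule compact_imp_seq_compact)
  moreover have "\<forall>j. s j \<in> Pi\<^sub>E UNIV (\<lambda>i. {..\<tau> i})"
    using assms by auto
  ultimately obtain \<sigma> r where \<sigma>: "\<sigma> \<in> Pi\<^sub>E UNIV (\<lambda>i. {..\<tau> i})" "strict_mono r"
      "(s \<circ> r) \<longlonglongrightarrow> \<sigma>"
    unfolding seq_compact_def by meson
  have "\<forall>\<^sub>F j in sequentially. s (r j) i = \<sigma> i" for i
  proof -
    have "(\<lambda>j. s (r j) i) \<longlonglongrightarrow> \<sigma> i"
      using \<sigma>(3) continuous_on_tendsto_compose[of UNIV "\<lambda>f. f i" "s \<circ> r" \<sigma> sequentially]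
      by (simp add: comp_def continuous_on_product_coordinates)
    then show ?thesis by (simp add: tendsto_discrete)
  qed
  then have "finite J \<Longrightarrow> \<forall>\<^sub>F j in sequentially. \<forall>i\<in>J. s (r j) i = \<sigma> i" for J
    by (simp add: eventually_ball_finite)
  then show ?thesis
    using \<sigma> by (intro exI[of _ r] exI[of _ \<sigma>]) auto
qed

text \<open>
  Compactness again.  Only one of the two sequences has to be bounded by \<open>\<tau>\<close>, so that a sequence
  of which finitely many terms are bounded can be compared with its truncation.
\<close>
lemma locally_constant_uniform:
  fixes R :: "(nat \<Rightarrow> nat) \<Rightarrow> 'b"
  assumes loc: "\<And>\<sigma>. \<exists>J. finite J \<and> (\<forall>\<tau>. (\<forall>i\<in>J. \<sigma> i = \<tau> i) \<longrightarrow> R \<tau> = R \<sigma>)"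
  obtains m where "\<And>\<sigma> \<sigma>'. (\<And>i. \<sigma> i \<le> \<tau> i) \<Longrightarrow> (\<And>i. i < m \<Longrightarrow> \<sigma>' i = \<sigma> i) \<Longrightarrow> R \<sigma>' = R \<sigma>"
proof (rule ccontr)
  assume "\<not> thesis"
  then have "\<forall>m. \<exists>\<sigma> \<sigma>'. (\<forall>i. \<sigma> i \<le> \<tau> i) \<and> (\<forall>i<m. \<sigma>' i = \<sigma> i) \<and> R \<sigma>' \<noteq> R \<sigma>"
    using that by blast
  then have "\<exists>s s'. \<forall>m. (\<forall>i. s m i \<le> \<tau> i) \<and> (\<forall>i<m. s' m i = s m i) \<and> R (s' m) \<noteq> R (s m)"
    unfolding choice_iff .
  then obtain s s' where s: "\<And>m i. s m i \<le> \<tau> i" "\<And>m i. i < m \<Longrightarrow> s' m i = s m i"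
      "\<And>m. R (s' m) \<noteq> R (s m)"
    by blast
  obtain r \<sigma> where r: "strict_mono r"
      "\<forall>J. finite J \<longrightarrow> (\<forall>\<^sub>F j in sequentially. \<forall>i\<in>J. s (r j) i = \<sigma> i)"
    using bounded_sequences_subseq[of s \<tau>, OF s(1)] by (elim exE conjE) simp
  obtain J where J: "finite J" "\<And>\<tau>. (\<forall>i\<in>J. \<sigma> i = \<tau> i) \<Longrightarrow> R \<tau> = R \<sigma>"
    using loc[of \<sigma>] by auto
  obtain b where b: "\<forall>i\<in>J. i < b"
    using J(1) by (auto simp: finite_nat_set_iff_bounded)
  have "\<forall>\<^sub>F j in sequentially. (\<forall>i\<in>J. s (r j) i = \<sigma> i) \<and> b \<le> j"
    using r(2)[rule_format, OF J(1)] eventually_ge_at_top[of b] by eventually_elim auto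
  then obtain j where j: "\<forall>i\<in>J. s (r j) i = \<sigma> i" "b \<le> j"
    by (auto dest: eventually_happens)
  have "i < r j" if "i \<in> J" for i
    using that b j(2) seq_suble[OF r(1), of j] by fastforce
  then have "R (s (r j)) = R \<sigma>" "R (s' (r j)) = R \<sigma>"
    using j s(2) by (auto intro!: J(2))
  then show False using s(3) by metis
qed

abbreviation compact_rectangles :: "'a measure \<Rightarrow> ('a \<times> real) set set" where
  "compact_rectangles M \<equiv> {B \<times> K |B K. B \<in> sets M \<and> compact K}"

text \<open>
  Choquet's capacitability argument.  The outer measure is continuous along increasing sequences of
  arbitrary sets, so the coordinates of \<open>\<sigma>\<close> can be bounded one after the other by some
  \<open>\<tau>\<close> without letting the outer measure of the projection drop to \<open>c\<close>.  When \<open>\<sigma>\<close> ranges over the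
  compact set of sequences below \<open>\<tau>\<close>, the first \<open>m\<close> conditions define a measurable
  projection, since only finitely many cases are left, and by compactness the projections decrease to a
  subset of the projection of \<open>A\<close>.
\<close>
lemma (in finite_measure) souslin_projection_inner:
  assumes A: "souslin (compact_rectangles M) A" and c: "c < outer_measure_of M (fst ` A)"
  obtains B where "B \<in> sets M" "B \<subseteq> fst ` A" "c \<le> emeasure M B"
proof -
  obtain R where scheme: "souslin_scheme (compact_rectangles M) R"
    and A: "A = {z. \<exists>\<sigma>. \<forall>n. z \<in> R n \<sigma>}"
    using A unfolding souslin_def by blast
  have R: "R n \<sigma> \<in> compact_rectangles M"
    and loc: "\<exists>J. finite J \<and> (\<forall>\<tau>. (\<forall>i\<in>J. \<sigma> i = \<tau> i) \<longrightarrow> R n \<tau> = R n \<sigma>)" for n \<sigma>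
    using scheme unfolding souslin_scheme_def by blast+
  have "\<forall>n \<sigma>. \<exists>B K. R n \<sigma> = B \<times> K \<and> B \<in> sets M \<and> compact K"
    using R by blast
  then have "\<exists>b k. \<forall>n \<sigma>. R n \<sigma> = b n \<sigma> \<times> k n \<sigma> \<and> b n \<sigma> \<in> sets M \<and> compact (k n \<sigma>)"
    unfolding choice_iff .
  then obtain b k where bk0: "\<forall>n \<sigma>. R n \<sigma> = b n \<sigma> \<times> k n \<sigma> \<and> b n \<sigma> \<in> sets M \<and> compact (k n \<sigma>)"
    by (elim exE)
  have bk: "R n \<sigma> = b n \<sigma> \<times> k n \<sigma>" "b n \<sigma> \<in> sets M" "compact (k n \<sigma>)" for n \<sigma>
    using bk0 by simp_all
  define H where "H T = {\<omega>. \<exists>t. \<exists>\<sigma>\<in>T. \<forall>n. (\<omega>, t) \<in> R n \<sigma>}" for T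
  have H_A: "H UNIV = fst ` A"
    unfolding H_def A by (auto simp: image_iff) blast+
  have H_space: "H T \<subseteq> space M" for T
  proof
    fix \<omega> assume "\<omega> \<in> H T"
    then obtain t \<sigma> where "(\<omega>, t) \<in> R 0 \<sigma>" unfolding H_def by blast
    then show "\<omega> \<in> space M" using sets.sets_into_space[OF bk(2)[of 0 \<sigma>]] by (auto simp: bk(1))
  qed
  have H_mono: "H T \<subseteq> H T'" if "T \<subseteq> T'" for T T'
    using that unfolding H_def by blast
  have step: "\<exists>j. c < outer_measure_of M (H (T \<inter> {\<sigma>. \<sigma> m \<le> j}))"
    if "c < outer_measure_of M (H T)" for T m
  proof -
    have "H T \<subseteq> (\<Union>j. H (T \<inter> {\<sigma>. \<sigma> m \<le> j}))"
    proof
      fix \<omega> assume "\<omega> \<in> H T"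
      then obtain t \<sigma> where "\<sigma> \<in> T" "\<forall>n. (\<omega>, t) \<in> R n \<sigma>" unfolding H_def by blast
      then have "\<omega> \<in> H (T \<inter> {\<sigma>'. \<sigma>' m \<le> \<sigma> m})" unfolding H_def by blast
      then show "\<omega> \<in> (\<Union>j. H (T \<inter> {\<sigma>. \<sigma> m \<le> j}))" by blast
    qed
    moreover have "H (T \<inter> {\<sigma>. \<sigma> m \<le> j}) \<subseteq> H T" for j by (rule H_mono) blast
    ultimately have "(\<Union>j. H (T \<inter> {\<sigma>. \<sigma> m \<le> j})) = H T" by blast
    moreover have "incseq (\<lambda>j. H (T \<inter> {\<sigma>. \<sigma> m \<le> j}))"
      unfolding incseq_def by (intro allI impI H_mono) auto
    ultimately have "(SUP j. outer_measure_of M (H (T \<inter> {\<sigma>. \<sigma> m \<le> j}))) = outer_measure_of M (H T)"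
      using SUP_outer_measure_of_incseq[of "\<lambda>j. H (T \<inter> {\<sigma>. \<sigma> m \<le> j})" M] H_space by auto
    then have "c < (SUP j. outer_measure_of M (H (T \<inter> {\<sigma>. \<sigma> m \<le> j})))"
      using that by simp
    then show ?thesis by (simp add: less_SUP_iff)
  qed
  \<comment> \<open>Bounds on the coordinates, chosen one after the other, keep the outer measure above \<open>c\<close>.\<close>
  have "\<exists>T. \<forall>m. (c < outer_measure_of M (H (T m)) \<and> (m = 0 \<longrightarrow> T m = UNIV)) \<and>
      (\<exists>j. T (Suc m) = T m \<inter> {\<sigma>. \<sigma> m \<le> j})"
  proof (rule dependent_nat_choice)
    show "\<exists>T. c < outer_measure_of M (H T) \<and> (0 = (0::nat) \<longrightarrow> T = UNIV)"
      using c H_A by auto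
  next
    fix T :: "(nat \<Rightarrow> nat) set" and m :: nat
    assume "c < outer_measure_of M (H T) \<and> (m = 0 \<longrightarrow> T = UNIV)"
    then obtain j where "c < outer_measure_of M (H (T \<inter> {\<sigma>. \<sigma> m \<le> j}))"
      using step by blast
    then show "\<exists>T'. (c < outer_measure_of M (H T') \<and> (Suc m = 0 \<longrightarrow> T' = UNIV)) \<and>
        (\<exists>j. T' = T \<inter> {\<sigma>. \<sigma> m \<le> j})" by blast
  qed
  then obtain T where T': "\<forall>m. (c < outer_measure_of M (H (T m)) \<and> (m = 0 \<longrightarrow> T m = UNIV)) \<and>
      (\<exists>j. T (Suc m) = T m \<inter> {\<sigma>. \<sigma> m \<le> j})"
    by (elim exE)
  then have "\<forall>m. \<exists>j. T (Suc m) = T m \<inter> {\<sigma>. \<sigma> m \<le> j}" by simp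
  then obtain \<tau> where "\<forall>m. T (Suc m) = T m \<inter> {\<sigma>. \<sigma> m \<le> \<tau> m}"
    unfolding choice_iff by (elim exE)
  with T' have T: "c < outer_measure_of M (H (T m))" "T 0 = UNIV"
      "T (Suc m) = T m \<inter> {\<sigma>. \<sigma> m \<le> \<tau> m}" for m
    by simp_all
  have T_eq: "T m = {\<sigma>. \<forall>i<m. \<sigma> i \<le> \<tau> i}" for m
    by (induction m) (auto simp: T less_Suc_eq)
  define C where "C = {\<sigma> :: nat \<Rightarrow> nat. \<forall>i. \<sigma> i \<le> \<tau> i}"
  define S where "S m \<sigma> = {\<omega>. \<exists>t. \<forall>n\<le>m. (\<omega>, t) \<in> R n \<sigma>}" for m \<sigma>
  define B where "B m = (\<Union>\<sigma>\<in>C. S m \<sigma>)" for m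
  have S_sets: "S m \<sigma> \<in> sets M" for m \<sigma>
  proof -
    have "S m \<sigma> = (if (\<Inter>n\<le>m. k n \<sigma>) = {} then {} else (\<Inter>n\<le>m. b n \<sigma>))"
      unfolding S_def by (auto simp: bk(1))
    also have "\<dots> \<in> sets M" using bk(2) by auto
    finally show ?thesis .
  qed
  have B_props: "B m \<in> sets M \<and> c < emeasure M (B m)" for m
  proof -
    have "\<exists>J. finite J \<and> (\<forall>\<tau>. (\<forall>i\<in>J. \<sigma> i = \<tau> i) \<longrightarrow>
        restrict (\<lambda>n. R n \<tau>) {..m} = restrict (\<lambda>n. R n \<sigma>) {..m})" for \<sigma>
    proof -
      have "\<exists>J. \<forall>n. finite (J n) \<and> (\<forall>\<tau>. (\<forall>i\<in>J n. \<sigma> i = \<tau> i) \<longrightarrow> R n \<tau> = R n \<sigma>)"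
        by (rule choice, rule allI, rule loc)
      then obtain J where "\<forall>n. finite (J n) \<and> (\<forall>\<tau>. (\<forall>i\<in>J n. \<sigma> i = \<tau> i) \<longrightarrow> R n \<tau> = R n \<sigma>)"
        by (elim exE)
      then have J: "finite (J n)" "(\<forall>i\<in>J n. \<sigma> i = \<tau> i) \<Longrightarrow> R n \<tau> = R n \<sigma>" for n \<tau>
        by blast+
      show ?thesis
        using J(1) by (intro exI[of _ "\<Union>n\<le>m. J n"]) (auto intro!: restrict_ext J(2))
    qed
    then obtain l where l': "\<And>\<sigma> \<sigma>'. (\<And>i. \<sigma> i \<le> \<tau> i) \<Longrightarrow> (\<And>i. i < l \<Longrightarrow> \<sigma>' i = \<sigma> i) \<Longrightarrow>
        restrict (\<lambda>n. R n \<sigma>') {..m} = restrict (\<lambda>n. R n \<sigma>) {..m}"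
      using locally_constant_uniform[of "\<lambda>\<sigma>. restrict (\<lambda>n. R n \<sigma>) {..m}" \<tau>] by blast
    have l: "R n \<sigma>' = R n \<sigma>" if "\<And>i. \<sigma> i \<le> \<tau> i" "\<And>i. i < l \<Longrightarrow> \<sigma>' i = \<sigma> i" "n \<le> m"
      for \<sigma> \<sigma>' n
      using fun_cong[OF l'[of \<sigma> \<sigma>'], of n] that by simp
    define e where "e \<sigma> = (\<lambda>i. if i < l then \<sigma> i else (0::nat))" for \<sigma> :: "nat \<Rightarrow> nat"
    have e: "R n \<sigma> = R n (e \<sigma>)" if "\<And>i. i < l \<Longrightarrow> \<sigma> i \<le> \<tau> i" "n \<le> m" for \<sigma> n
      using that by (intro l) (auto simp: e_def)
    then have eS: "S m \<sigma> = S m (e \<sigma>)" if "\<And>i. i < l \<Longrightarrow> \<sigma> i \<le> \<tau> i" for \<sigma>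
      using e[of \<sigma>] that unfolding S_def by simp
    have eC: "e \<sigma> \<in> C" if "\<And>i. i < l \<Longrightarrow> \<sigma> i \<le> \<tau> i" for \<sigma>
      using that by (auto simp: e_def C_def)
    have "e ` C \<subseteq> e ` (Pi\<^sub>E {..<l} (\<lambda>i. {..\<tau> i}))"
    proof safe
      fix \<sigma> assume "\<sigma> \<in> C"
      then have "e \<sigma> = e (restrict \<sigma> {..<l})" "restrict \<sigma> {..<l} \<in> Pi\<^sub>E {..<l} (\<lambda>i. {..\<tau> i})"
        by (auto simp: e_def C_def)
      then show "e \<sigma> \<in> e ` (Pi\<^sub>E {..<l} (\<lambda>i. {..\<tau> i}))" by blast
    qed
    then have "finite (e ` C)"
      by (rule finite_subset) (intro finite_imageI finite_PiE, auto)
    moreover have "B m = (\<Union>\<sigma>\<in>e ` C. S m \<sigma>)"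
      unfolding B_def using eS by (auto simp: C_def)
    ultimately have B: "B m \<in> sets M"
      by (metis sets.finite_UN S_sets)
    have "H (T l) \<subseteq> B m"
    proof
      fix \<omega> assume "\<omega> \<in> H (T l)"
      then obtain \<sigma> t where \<sigma>: "\<And>i. i < l \<Longrightarrow> \<sigma> i \<le> \<tau> i" "\<And>n. (\<omega>, t) \<in> R n \<sigma>"
        unfolding H_def T_eq by auto
      from \<sigma>(2) have "\<omega> \<in> S m \<sigma>" unfolding S_def by blast
      then have "e \<sigma> \<in> C" "\<omega> \<in> S m (e \<sigma>)"
        using eC[of \<sigma>] eS[of \<sigma>] \<sigma>(1) by simp_all
      then show "\<omega> \<in> B m" unfolding B_def by blast
    qed
    then have "outer_measure_of M (H (T l)) \<le> emeasure M (B m)"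
      using outer_measure_of_mono[of _ _ M] B by (metis outer_measure_of_eq)
    with T(1) B show ?thesis by (metis less_le_trans)
  qed
  have "(\<Inter>m. B m) \<subseteq> fst ` A"
  proof
    fix \<omega> assume "\<omega> \<in> (\<Inter>m. B m)"
    then have "\<forall>m. \<exists>\<sigma> t. (\<forall>i. \<sigma> i \<le> \<tau> i) \<and> (\<forall>n\<le>m. (\<omega>, t) \<in> R n \<sigma>)"
      unfolding B_def C_def S_def by blast
    then have "\<exists>s t. \<forall>m. (\<forall>i. s m i \<le> \<tau> i) \<and> (\<forall>n\<le>m. (\<omega>, t m) \<in> R n (s m))"
      unfolding choice_iff .
    then obtain s t where s: "\<And>m i. s m i \<le> \<tau> i" "\<And>m n. n \<le> m \<Longrightarrow> (\<omega>, t m) \<in> R n (s m)"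
      by blast
    obtain r \<sigma> where r: "strict_mono r"
        "\<forall>J. finite J \<longrightarrow> (\<forall>\<^sub>F j in sequentially. \<forall>i\<in>J. s (r j) i = \<sigma> i)"
      using bounded_sequences_subseq[of s \<tau>, OF s(1)] by (elim exE conjE) simp
    have ev: "\<forall>\<^sub>F j in sequentially. (\<omega>, t (r j)) \<in> R n \<sigma>" for n
    proof -
      obtain J where J: "finite J" "\<And>\<tau>. (\<forall>i\<in>J. \<sigma> i = \<tau> i) \<Longrightarrow> R n \<tau> = R n \<sigma>"
        using loc[of \<sigma> n] by auto
      show ?thesis
        using r(2)[rule_format, OF J(1)] eventually_ge_at_top[of n]
      proof eventually_elim
        case (elim j)
        then have "n \<le> r j" using seq_suble[OF r(1), of j] by linarith
        then have "(\<omega>, t (r j)) \<in> R n (s (r j))" by (rule s(2))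
        moreover have "R n (s (r j)) = R n \<sigma>" using elim by (intro J(2)) auto
        ultimately show ?case by simp
      qed
    qed
    obtain j0 where j0: "\<And>j. j \<ge> j0 \<Longrightarrow> (\<omega>, t (r j)) \<in> R 0 \<sigma>"
      using ev[of 0] by (auto simp: eventually_sequentially)
    have "\<forall>j. t (r (j + j0)) \<in> k 0 \<sigma>"
      using j0 bk(1)[of 0 \<sigma>] by simp
    then obtain x q where q: "strict_mono q" "((\<lambda>j. t (r (j + j0))) \<circ> q) \<longlonglongrightarrow> x"
      using bk(3)[of 0 \<sigma>] unfolding compact_def by meson
    have "(\<omega>, x) \<in> R n \<sigma>" for n
    proof -
      have "filterlim (\<lambda>j. q j + j0) sequentially sequentially"
        by (intro filterlim_subseq) (use q(1) in \<open>auto simp: strict_mono_def\<close>)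
      then have "\<forall>\<^sub>F j in sequentially. (\<omega>, t (r (q j + j0))) \<in> R n \<sigma>"
        using ev[of n] by (rule eventually_compose_filterlim[rotated])
      then have *: "\<forall>\<^sub>F j in sequentially. t (r (q j + j0)) \<in> k n \<sigma> \<and> \<omega> \<in> b n \<sigma>"
        by eventually_elim (simp add: bk(1))
      then have "x \<in> k n \<sigma>"
        using q(2) compact_imp_closed[OF bk(3)[of n \<sigma>]]
        by (intro Lim_in_closed_set[of "k n \<sigma>" "(\<lambda>j. t (r (j + j0))) \<circ> q" sequentially x])
           (auto elim: eventually_mono)
      moreover have "\<omega> \<in> b n \<sigma>" using * by (auto dest: eventually_happens)
      ultimately show ?thesis using bk(1)[of n \<sigma>] by blast
    qed
    then show "\<omega> \<in> fst ` A" unfolding A by force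
  qed
  moreover have "(\<Inter>m. B m) \<in> sets M" using B_props by auto
  moreover have "c \<le> emeasure M (\<Inter>m. B m)"
  proof -
    have "S n \<sigma> \<subseteq> S m \<sigma>" if "m \<le> n" for m n \<sigma>
      unfolding S_def by (rule Collect_mono) (use that in \<open>meson order_trans\<close>)
    then have "decseq B" unfolding B_def decseq_def by (intro allI impI UN_mono) auto
    then have "(INF m. emeasure M (B m)) = emeasure M (\<Inter>m. B m)"
      using B_props by (intro INF_emeasure_decseq) auto
    then show ?thesis
      using B_props by (metis INF_greatest less_imp_le)
  qed
  ultimately show ?thesis by (intro that) auto
qed

text \<open>The projection has a measurable subset with the same measure as a measurable cover.\<close>
lemma (in finite_measure) souslin_projection:
  assumes A: "souslin (compact_rectangles M) A"
  shows "fst ` A \<in> sets (completion M)"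
proof -
  let ?H = "fst ` A"
  have "?H \<subseteq> space M"
  proof
    fix \<omega> assume "\<omega> \<in> ?H"
    then obtain t where "(\<omega>, t) \<in> A" by auto
    then obtain B K where "B \<in> sets M" "(\<omega>, t) \<in> B \<times> K"
      using souslin_subset[OF A] by blast
    then show "\<omega> \<in> space M" using sets.sets_into_space by blast
  qed
  from outer_measure_of_attain[OF this]
  obtain E where E: "E \<in> sets M" "?H \<subseteq> E" "outer_measure_of M ?H = emeasure M E"
    by (elim bexE conjE)
  obtain B where B: "B \<in> sets M" "B \<subseteq> ?H" "emeasure M E \<le> emeasure M B"
  proof (cases "emeasure M E = 0")
    case True
    then show ?thesis by (intro that[of "{}"]) auto
  next
    case False
    then have "0 < emeasure M E" by (simp add: zero_less_iff_neq_zero)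
    then obtain u where u: "\<And>n::nat. u n < emeasure M E" "u \<longlonglongrightarrow> emeasure M E"
      using approx_from_below_dense_linorder by blast
    have "\<exists>B. B \<in> sets M \<and> B \<subseteq> ?H \<and> u n \<le> emeasure M B" for n
      using souslin_projection_inner[OF A, of "u n"] u(1) E(3) by metis
    then obtain B where B: "\<And>n. B n \<in> sets M" "\<And>n. B n \<subseteq> ?H" "\<And>n. u n \<le> emeasure M (B n)"
      by metis
    have "u n \<le> emeasure M (\<Union>n. B n)" for n
      using B(1) by (intro order_trans[OF B(3)] emeasure_mono) auto
    then have "emeasure M E \<le> emeasure M (\<Union>n. B n)"
      using u(2) by (intro LIMSEQ_le_const2) auto
    then show ?thesis using B by (intro that[of "\<Union>n. B n"]) auto
  qed
  have "emeasure M (E - B) = 0"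
    using B E by (subst emeasure_Diff) (auto simp: diff_eq_0_iff_ennreal less_top[symmetric])
  then have "?H - B \<in> sets (completion M)"
    using B E by (intro sets_completionI_sub[of "E - B"]) (auto simp: null_sets_def)
  then have "B \<union> (?H - B) \<in> sets (completion M)"
    using B by (intro sets.Un) auto
  then show ?thesis using B by (simp add: Un_absorb1)
qed

text \<open>
  The sets that are Souslin together with their complements form a \<open>\<sigma>\<close>-algebra, and this
  \<open>\<sigma>\<close>-algebra contains the measurable rectangles.
\<close>
theorem (in finite_measure) measurable_projection:
  assumes A: "A \<in> sets (M \<Otimes>\<^sub>M (borel :: real measure))"
  shows "fst ` A \<in> sets (completion M)"
proof -
  let ?\<Omega> = "space M \<times> (UNIV :: real set)"
  define \<G> where "\<G> = {A. A \<subseteq> ?\<Omega> \<and> souslin (compact_rectangles M) A \<and>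
      souslin (compact_rectangles M) (?\<Omega> - A)}"
  have pav: "souslin (compact_rectangles M) (a \<times> {x..y})" if "a \<in> sets M" for a and x y :: real
    using that by (intro souslin_paving) auto
  have empty: "{} \<in> \<G>" and UN: "(\<And>i::nat. F i \<in> \<G>) \<Longrightarrow> (\<Union>i. F i) \<in> \<G>"
    and compl: "A \<in> \<G> \<Longrightarrow> ?\<Omega> - A \<in> \<G>" for F A
  proof -
    have "\<exists>k. - real k \<le> t \<and> t \<le> real k" for t
    proof -
      obtain k where "\<bar>t\<bar> \<le> real k" using real_arch_simple by blast
      then show ?thesis by (intro exI[of _ k]) linarith
    qed
    then have "?\<Omega> = (\<Union>k::nat. space M \<times> {- real k..real k})"
      by auto
    also have "souslin (compact_rectangles M) \<dots>" by (intro souslin_UN pav) auto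
    finally show "{} \<in> \<G>" using pav[of "{}" 0 0] by (simp add: \<G>_def)
    show "(\<Union>i. F i) \<in> \<G>" if "\<And>i::nat. F i \<in> \<G>"
    proof -
      have "?\<Omega> - (\<Union>i. F i) = (\<Inter>i. ?\<Omega> - F i)" by auto
      then show ?thesis
        using that souslin_UN[of _ F] souslin_INT[of _ "\<lambda>i. ?\<Omega> - F i"] by (auto simp: \<G>_def)
    qed
    show "A \<in> \<G> \<Longrightarrow> ?\<Omega> - A \<in> \<G>" by (auto simp: \<G>_def double_diff)
  qed
  interpret G: sigma_algebra ?\<Omega> \<G>
  proof (unfold sigma_algebra_iff2, intro conjI ballI allI impI)
    show "\<G> \<subseteq> Pow ?\<Omega>" unfolding \<G>_def by blast
    show "(\<Union>i. F i) \<in> \<G>" if "range F \<subseteq> \<G>" for F :: "nat \<Rightarrow> _"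
      using that by (intro UN) blast
  qed (fact empty compl)+
  have half: "a \<times> {..x} \<in> \<G>" if a: "a \<in> sets M" for a x
  proof -
    have "\<exists>k. x - real k \<le> t" for t
      using real_arch_simple[of "x - t"] by (auto simp: algebra_simps)
    then have "a \<times> {..x} = (\<Union>k::nat. a \<times> {x - real k..x})" by auto
    also have "souslin (compact_rectangles M) \<dots>" using a by (intro souslin_UN pav)
    finally have 1: "souslin (compact_rectangles M) (a \<times> {..x})" .
    have "?\<Omega> - a \<times> {..x} = (\<Union>k::nat. (space M - a) \<times> {- real k..real k}) \<union>
        (\<Union>k::nat. a \<times> {x + 1 / Suc k..x + real k})" (is "?l = ?r")
    proof (intro equalityI subsetI)
      fix z assume z: "z \<in> ?l"
      obtain \<omega> t where [simp]: "z = (\<omega>, t)" by (cases z)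
      show "z \<in> ?r"
      proof (cases "\<omega> \<in> a")
        case False
        obtain k where "\<bar>t\<bar> \<le> real k" using real_arch_simple by blast
        then have "- real k \<le> t" "t \<le> real k" by linarith+
        with False z show ?thesis by auto
      next
        case True
        then have "x < t" using z by auto
        then obtain k1 where k1: "1 / real (Suc k1) < t - x"
          using reals_Archimedean[of "t - x"] by (auto simp: inverse_eq_divide)
        obtain k2 where k2: "t - x \<le> real k2" using real_arch_simple by blast
        have "1 / real (Suc (max k1 k2)) \<le> 1 / real (Suc k1)"
          by (intro divide_left_mono) auto
        with k1 k2 have "t \<in> {x + 1 / real (Suc (max k1 k2))..x + real (max k1 k2)}" by simp
        with True show ?thesis by auto
      qed
    next
      fix z assume z: "z \<in> ?r"
      have "x < t" if "x + 1 / real (Suc k) \<le> t" for k t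
      proof -
        have "x < x + 1 / real (Suc k)" by simp
        with that show ?thesis by linarith
      qed
      then have "t \<notin> {..x}" if "t \<in> {x + 1 / real (Suc k)..x + real k}" for k t
        using that by force
      then show "z \<in> ?l"
        using z sets.sets_into_space[OF a] by blast
    qed
    also have "souslin (compact_rectangles M) \<dots>"
      using a by (intro souslin_Un souslin_UN pav) auto
    finally show ?thesis using 1 sets.sets_into_space[OF a] by (auto simp: \<G>_def)
  qed
  have rect: "a \<times> b \<in> \<G>" if a: "a \<in> sets M" and b: "b \<in> sets borel" for a b
  proof -
    have "b \<in> sigma_sets UNIV (range (\<lambda>x::real. {..x}))"
      using b by (subst (asm) borel_eq_atMost) simp
    then show ?thesis
    proof induction
      case (Basic s)
      then show ?case using half[OF a] by auto
    next
      case (Compl s)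
      have "a \<times> UNIV = (\<Union>k::nat. a \<times> {..real k})"
        using real_arch_simple by auto
      also have "\<dots> \<in> \<G>" using half[OF a] by blast
      finally have "a \<times> UNIV - a \<times> s \<in> \<G>" using Compl by blast
      moreover have "a \<times> UNIV - a \<times> s = a \<times> (UNIV - s)" by auto
      ultimately show ?case by simp
    next
      case (Union F)
      have "a \<times> (\<Union>i. F i) = (\<Union>i. a \<times> F i)" by auto
      with Union show ?case by auto
    qed auto
  qed
  have "A \<in> sigma_sets ?\<Omega> {a \<times> b |a b. a \<in> sets M \<and> b \<in> sets borel}"
    using A by (simp add: sets_pair_measure)
  then have "A \<in> \<G>"
    using G.sigma_sets_subset[of "{a \<times> b |a b. a \<in> sets M \<and> b \<in> sets borel}"] rect by blast
  then show ?thesis by (intro souslin_projection) (simp add: \<G>_def)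
qed

section \<open>Restriction to the complement of a negligible set\<close>

lemma space_borel_of [simp]: "space (borel_of T) = topspace T"
  unfolding borel_of_def by (rule space_measure_of) (auto dest: openin_subset)

lemma sets_borel_of: "sets (borel_of T) = sigma_sets (topspace T) {U. openin T U}"
  unfolding borel_of_def by (rule sets_measure_of) (auto dest: openin_subset)

lemma openin_sets_borel_of: "openin T U \<Longrightarrow> U \<in> sets (borel_of T)"
  by (auto simp: sets_borel_of)

lemma closedin_sets_borel_of:
  assumes "closedin T C"
  shows "C \<in> sets (borel_of T)"
proof -
  have "C = space (borel_of T) - (topspace T - C)"
    using closedin_subset[OF assms] by auto
  also have "\<dots> \<in> sets (borel_of T)"
    using assms by (intro sets.compl_sets openin_sets_borel_of) (auto simp: closedin_def)
  finally show ?thesis .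
qed

lemma borel_of_euclidean: "borel_of euclidean = (borel :: 'a::topological_space measure)"
  by (simp add: borel_of_def borel_def)

lemma sets_borel_of_subtopology:
  "sets (borel_of (subtopology T F)) = sets (restrict_space (borel_of T) F)"
proof -
  let ?S = "topspace T \<inter> F"
  have "sets (restrict_space (borel_of T) F) =
      {(\<lambda>x. x) -` A \<inter> ?S |A. A \<in> sigma_sets (topspace T) {U. openin T U}}"
    using sigma_sets_into_sp[of "{U. openin T U}" "topspace T"]
    unfolding sets_restrict_space sets_borel_of by (auto simp: image_iff dest: openin_subset)
  also have "\<dots> = sigma_sets ?S {(\<lambda>x. x) -` U \<inter> ?S |U. U \<in> {U. openin T U}}"
    by (rule sigma_sets_vimage_commute) auto
  also have "{(\<lambda>x. x) -` U \<inter> ?S |U. U \<in> {U. openin T U}} = {U. openin (subtopology T F) U}"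
    unfolding openin_subtopology using openin_subset[of T] by auto
  finally show ?thesis by (simp add: sets_borel_of)
qed

lemma continuous_map_borel_of:
  assumes f: "continuous_map S T f"
  shows "f \<in> borel_of S \<rightarrow>\<^sub>M borel_of T"
proof (rule measurable_sigma_sets[OF sets_borel_of])
  fix U assume "U \<in> {U. openin T U}"
  then have "openin S {x \<in> topspace S. f x \<in> U}"
    using f by (simp add: openin_continuous_map_preimage)
  moreover have "f -` U \<inter> space (borel_of S) = {x \<in> topspace S. f x \<in> U}"
    by auto
  ultimately show "f -` U \<inter> space (borel_of S) \<in> sets (borel_of S)"
    by (simp add: openin_sets_borel_of)
qed (use f openin_subset[of T] in \<open>auto simp: continuous_map_def\<close>)

lemma Cb_borel_measurable: "f \<in> Cb T \<Longrightarrow> f \<in> borel_measurable (borel_of T)"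
  using continuous_map_borel_of[of T euclideanreal f] by (simp add: Cb_def borel_of_euclidean)

lemma Cb_subset_Bb: "Cb T \<subseteq> Bb (borel_of T)"
  using Cb_borel_measurable by (auto simp: Bb_def Cb_def)

text \<open>
  A homeomorphism maps \<open>F\<close> to a Borel subset of a Borel subset of the compact space.
\<close>
lemma lusin_topology_subtopology:
  assumes T: "lusin_topology T" and F: "F \<in> sets (borel_of T)"
  shows "lusin_topology (subtopology T F)"
proof -
  obtain K :: "real set" and d B where K: "Metric_space K d"
      "compact_space (Metric_space.mtopology K d)"
      and B: "B \<in> sets (borel_of (Metric_space.mtopology K d))"
      and hom: "T homeomorphic_space subtopology (Metric_space.mtopology K d) B"
    using T unfolding lusin_topology_def by blast
  let ?K = "Metric_space.mtopology K d"
  obtain f g where fg: "homeomorphic_maps T (subtopology ?K B) f g"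
    using hom unfolding homeomorphic_space_def by blast
  then have g: "continuous_map (subtopology ?K B) T g"
    and f: "f ` topspace T \<subseteq> topspace ?K \<inter> B"
    and gf: "\<And>x. x \<in> topspace T \<Longrightarrow> g (f x) = x"
    and fg': "\<And>y. y \<in> topspace ?K \<inter> B \<Longrightarrow> f (g y) = y"
    by (auto simp: homeomorphic_maps_def continuous_map_def)
  let ?B = "g -` F \<inter> (topspace ?K \<inter> B)"
  have "?B \<in> sets (borel_of (subtopology ?K B))"
    using measurable_sets[OF continuous_map_borel_of[OF g] F] by simp
  then have B': "?B \<in> sets (borel_of ?K)"
    using B unfolding sets_borel_of_subtopology by (auto simp: sets_restrict_space)
  have "f ` (topspace T \<inter> F) = topspace (subtopology ?K B) \<inter> ?B"
  proof (intro equalityI subsetI)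
    fix y assume y: "y \<in> topspace (subtopology ?K B) \<inter> ?B"
    then have "g y \<in> topspace T" using g by (auto simp: continuous_map_def)
    with y fg' show "y \<in> f ` (topspace T \<inter> F)" by (intro image_eqI[of _ _ "g y"]) auto
  qed (use f gf in auto)
  then have "homeomorphic_maps (subtopology T F) (subtopology (subtopology ?K B) ?B) f g"
    by (rule homeomorphic_maps_subtopologies[OF fg])
  moreover have "subtopology (subtopology ?K B) ?B = subtopology ?K ?B"
    by (simp add: subtopology_subtopology Int_absorb1 Int_commute) (metis inf.absorb_iff2 inf_le2 inf_assoc le_infI2)
  ultimately show ?thesis
    unfolding lusin_topology_def using K B' homeomorphic_space_def by metis
qed

lemma polish_topology_open_subtopology:
  "polish_topology T \<Longrightarrow> openin T F \<Longrightarrow> polish_topology (subtopology T F)"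
  unfolding polish_topology_def
  by (simp add: completely_metrizable_space_openin separable_space_open_subset)

lemma kernel_semigroup_cong:
  assumes sets: "sets M = sets M'"
  shows "kernel_semigroup M P \<longleftrightarrow> kernel_semigroup M' P"
  unfolding kernel_semigroup_def
  by (simp add: sets sets_eq_imp_space_eq[OF sets] return_sets_cong[OF sets]
      subprob_algebra_cong[OF sets] measurable_cong_sets[OF sets refl])

lemma Bb_cong:
  assumes "sets M = sets M'"
  shows "Bb M = Bb M'"
  using measurable_cong_sets[OF assms refl, of "borel :: real measure"] sets_eq_imp_space_eq[OF assms]
  by (simp add: Bb_def)

locale semigroup_of_kernels =
  fixes M :: "'a measure" and P :: "real \<Rightarrow> 'a \<Rightarrow> 'a measure"
  assumes semigroup: "kernel_semigroup M P"
begin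

lemma kernel [measurable]: "0 \<le> t \<Longrightarrow> P t \<in> M \<rightarrow>\<^sub>M subprob_algebra M"
  using semigroup by (simp add: kernel_semigroup_def)

lemma sets_kernel: "0 \<le> t \<Longrightarrow> x \<in> space M \<Longrightarrow> sets (P t x) = sets M"
  using kernel[THEN measurable_space] by (simp add: space_subprob_algebra)

lemma space_kernel: "0 \<le> t \<Longrightarrow> x \<in> space M \<Longrightarrow> space (P t x) = space M"
  by (intro sets_eq_imp_space_eq sets_kernel)

lemma subprob_kernel: "0 \<le> t \<Longrightarrow> x \<in> space M \<Longrightarrow> subprob_space (P t x)"
  using kernel[THEN measurable_space] by (simp add: space_subprob_algebra)

lemma measurable_kernel: "0 \<le> t \<Longrightarrow> x \<in> space M \<Longrightarrow> f \<in> M \<rightarrow>\<^sub>M K \<Longrightarrow> f \<in> P t x \<rightarrow>\<^sub>M K"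
  by (simp add: measurable_cong_sets[OF sets_kernel refl])

end

locale negligible_restriction = semigroup_of_kernels M P
  for M :: "'a measure" and P :: "real \<Rightarrow> 'a \<Rightarrow> 'a measure" +
  fixes N F :: "'a set"
  assumes negligible: "negligible_set M P N"
    and F: "F = space M - N"
begin

abbreviation "Q \<equiv> restrict_semigroup P F"

lemma F_sets [measurable]: "F \<in> sets M"
  using negligible by (auto simp: F negligible_set_def)

lemma F_subset: "F \<subseteq> space M"
  by (auto simp: F)

lemma AE_kernel_F_pos:
  assumes "0 < t" "x \<in> space M"
  shows "AE y in P t x. y \<in> F"
proof -
  have "N \<in> null_sets (P t x)"
    using assms negligible sets_kernel[of t x] by (auto simp: negligible_set_def null_sets_def)
  then have "AE y in P t x. y \<notin> N" by (rule AE_not_in)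
  then show ?thesis
    using AE_space by eventually_elim (use assms space_kernel[of t x] in \<open>auto simp: F\<close>)
qed

text \<open>
  At time \<open>0\<close> it matters that the process starts in \<open>F\<close>, at positive times that \<open>N\<close> is negligible.
\<close>
lemma AE_kernel_F:
  assumes "0 \<le> t" "x \<in> F"
  shows "AE y in P t x. y \<in> F"
proof (cases "t = 0")
  have x: "x \<in> space M" using assms F_subset by auto
  case True
  then have eq: "P t x = return M x"
    using assms F_subset semigroup by (auto simp: kernel_semigroup_def)
  show ?thesis
    unfolding eq using assms F_sets x by (subst AE_return) auto
next
  case False
  then show ?thesis using assms F_subset by (intro AE_kernel_F_pos) auto
qed

lemma emeasure_restrict_semigroup:
  assumes "0 \<le> t" "x \<in> F" "A \<subseteq> F"
  shows "emeasure (Q t x) A = emeasure (P t x) A"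
  using assms F_subset F_sets sets_kernel[of t x] space_kernel[of t x] unfolding restrict_semigroup_def
  by (intro emeasure_restrict_space) (auto simp: Int_absorb2)

lemma nn_integral_restrict_semigroup:
  assumes t: "0 \<le> t" "x \<in> F" and fg: "\<And>y. y \<in> F \<Longrightarrow> f y = g y"
  shows "(\<integral>\<^sup>+y. f y \<partial>Q t x) = (\<integral>\<^sup>+y. g y \<partial>P t x)"
proof -
  have "(\<integral>\<^sup>+y. f y \<partial>Q t x) = (\<integral>\<^sup>+y. f y * indicator F y \<partial>P t x)"
    using t F_subset F_sets sets_kernel[of t x] space_kernel[of t x] unfolding restrict_semigroup_def
    by (intro nn_integral_restrict_space) (auto simp: Int_absorb2)
  also have "\<dots> = (\<integral>\<^sup>+y. g y \<partial>P t x)"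
    using AE_kernel_F[OF t] by (intro nn_integral_cong_AE) (auto simp: fg)
  finally show ?thesis .
qed

lemma integral_restrict_kernel:
  fixes f g :: "'a \<Rightarrow> real"
  assumes t: "0 \<le> t" and x: "x \<in> space M" and AE: "AE y in P t x. y \<in> F"
    and fg: "\<And>y. y \<in> F \<Longrightarrow> f y = g y" and g: "g \<in> borel_measurable M"
  shows "(\<integral>y. f y \<partial>Q t x) = (\<integral>y. g y \<partial>P t x)"
proof -
  have [measurable]: "g \<in> borel_measurable (P t x)" "F \<in> sets (P t x)"
    using measurable_kernel[OF t x g] sets_kernel[OF t x] by simp_all
  have "(\<integral>y. f y \<partial>Q t x) = (\<integral>y. indicator F y *\<^sub>R f y \<partial>P t x)"
    unfolding restrict_semigroup_def by (intro integral_restrict_space) simp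
  also have "\<dots> = (\<integral>y. indicator F y *\<^sub>R g y \<partial>P t x)"
    by (intro Bochner_Integration.integral_cong) (auto simp: fg split: split_indicator)
  also have "\<dots> = (\<integral>y. g y \<partial>P t x)"
    using AE by (intro integral_cong_AE) auto
  finally show ?thesis .
qed

lemma integral_restrict_semigroup:
  fixes f g :: "'a \<Rightarrow> real"
  assumes t: "0 \<le> t" "x \<in> F" and fg: "\<And>y. y \<in> F \<Longrightarrow> f y = g y" and g: "g \<in> borel_measurable M"
  shows "(\<integral>y. f y \<partial>Q t x) = (\<integral>y. g y \<partial>P t x)"
  using t F_subset by (intro integral_restrict_kernel AE_kernel_F fg g) auto

lemma kernel_semigroup_restrict: "kernel_semigroup (restrict_space M F) Q"
  unfolding kernel_semigroup_def
proof (intro conjI allI ballI impI)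
  fix t :: real assume t: "0 \<le> t"
  show "Q t \<in> restrict_space M F \<rightarrow>\<^sub>M subprob_algebra (restrict_space M F)"
  proof (rule measurable_subprob_algebra)
    fix x assume "x \<in> space (restrict_space M F)"
    then have x: "x \<in> F" "x \<in> space M" using F_subset by auto
    show "subprob_space (Q t x)"
      unfolding restrict_semigroup_def using x F_subset sets_kernel[OF t x(2)] space_kernel[OF t x(2)] F_sets
      by (intro subprob_space_restrict_space subprob_kernel t) (auto simp: Int_absorb2)
    show "sets (Q t x) = sets (restrict_space M F)"
      unfolding restrict_semigroup_def by (intro sets_restrict_space_cong sets_kernel t x)
  next
    fix A assume "A \<in> sets (restrict_space M F)"
    then have A: "A \<in> sets M" "A \<subseteq> F" by (auto simp: sets_restrict_space_iff)
    have "(\<lambda>x. emeasure (P t x) A) \<in> borel_measurable (restrict_space M F)"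
      using A t by (intro measurable_restrict_space1) measurable
    then show "(\<lambda>x. emeasure (Q t x) A) \<in> borel_measurable (restrict_space M F)"
      using A t by (subst measurable_cong[where g = "\<lambda>x. emeasure (P t x) A"])
        (auto simp: emeasure_restrict_semigroup)
  qed
next
  fix x assume "x \<in> space (restrict_space M F)"
  then show "Q 0 x = return (restrict_space M F) x"
    using semigroup F_subset by (auto simp: restrict_semigroup_def kernel_semigroup_def return_restrict_space)
next
  fix s t x A assume s: "0 \<le> (s::real)" and t: "0 \<le> (t::real)"
    and "x \<in> space (restrict_space M F)" and "A \<in> sets (restrict_space M F)"
  then have x: "x \<in> F" "x \<in> space M" and A: "A \<in> sets M" "A \<subseteq> F"
    using F_subset by (auto simp: sets_restrict_space_iff)
  have "emeasure (Q (s + t) x) A = (\<integral>\<^sup>+y. emeasure (P t y) A \<partial>P s x)"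
    using s t x A semigroup by (simp add: emeasure_restrict_semigroup kernel_semigroup_def)
  also have "\<dots> = (\<integral>\<^sup>+y. emeasure (Q t y) A \<partial>Q s x)"
    using s t x A by (intro nn_integral_restrict_semigroup[symmetric]) (auto simp: emeasure_restrict_semigroup)
  finally show "emeasure (Q (s + t) x) A = (\<integral>\<^sup>+y. emeasure (Q t y) A \<partial>Q s x)" .
qed

end

lemma borel_measurable_zero_extension:
  fixes f :: "'a \<Rightarrow> real"
  assumes F: "F \<in> sets (borel_of T)" and f: "f \<in> borel_measurable (borel_of (subtopology T F))"
  shows "(\<lambda>x. if x \<in> F then f x else 0) \<in> borel_measurable (borel_of T)"
proof -
  have "F \<inter> space (borel_of T) \<in> sets (borel_of T)" using F by (intro sets.Int sets.top)
  moreover have "f \<in> borel_measurable (restrict_space (borel_of T) F)"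
    using f measurable_cong_sets[OF sets_borel_of_subtopology refl] by blast
  ultimately show ?thesis
    using measurable_restrict_space_iff[of F "borel_of T" 0 borel f] by simp
qed

text \<open>The extension of a bounded Borel function by zero is again a bounded Borel function.\<close>
lemma strong_feller_restrict:
  assumes P: "strong_feller T P" and N: "negligible_set (borel_of T) P N"
    and F: "F = topspace T - N"
  shows "strong_feller (subtopology T F) (restrict_semigroup P F)"
proof -
  interpret negligible_restriction "borel_of T" P N F
    using P N F by unfold_locales (auto simp: strong_feller_def)
  let ?S = "subtopology T F"
  have "(\<lambda>x. \<integral>y. f y \<partial>Q t x) \<in> Cb ?S" if t: "0 < t" and f: "f \<in> Bb (borel_of ?S)" for t f
  proof -
    let ?g = "\<lambda>y. if y \<in> F then f y else 0"
    have g: "?g \<in> borel_measurable (borel_of T)"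
      using f by (intro borel_measurable_zero_extension F_sets) (simp add: Bb_def)
    moreover have "bounded (?g ` topspace T)"
    proof -
      have "bounded (insert 0 (f ` F))" using f F by (auto simp: Bb_def Int_absorb1)
      then show ?thesis by (rule bounded_subset) auto
    qed
    ultimately have "(\<lambda>x. \<integral>y. ?g y \<partial>P t x) \<in> Cb T"
      using P t by (auto simp: strong_feller_def Bb_def)
    then have *: "continuous_map ?S euclideanreal (\<lambda>x. \<integral>y. ?g y \<partial>P t x)"
        "bounded ((\<lambda>x. \<integral>y. ?g y \<partial>P t x) ` F)"
      using F by (auto simp: Cb_def continuous_map_from_subtopology elim: bounded_subset)
    have eq: "(\<integral>y. f y \<partial>Q t x) = (\<integral>y. ?g y \<partial>P t x)" if "x \<in> F" for x
      using t that g by (intro integral_restrict_semigroup) auto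
    have "continuous_map ?S euclideanreal (\<lambda>x. \<integral>y. f y \<partial>Q t x)"
      using *(1) by (rule continuous_map_eq) (simp add: eq)
    moreover have "(\<lambda>x. \<integral>y. f y \<partial>Q t x) ` topspace ?S = (\<lambda>x. \<integral>y. ?g y \<partial>P t x) ` F"
      using F eq by (intro image_cong) auto
    ultimately show ?thesis using *(2) by (simp add: Cb_def)
  qed
  moreover have "kernel_semigroup (borel_of ?S) Q"
    using kernel_semigroup_restrict kernel_semigroup_cong[OF sets_borel_of_subtopology] by blast
  ultimately show ?thesis by (auto simp: strong_feller_def)
qed

lemma continuous_map_real_iff:
  "continuous_map T euclideanreal f \<longleftrightarrow>
    (\<forall>x\<in>topspace T. \<forall>e>0. \<exists>U. openin T U \<and> x \<in> U \<and> (\<forall>y\<in>U. \<bar>f y - f x\<bar> < e))"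
  using Met_TC.continuous_map_to_metric[of T f]
  by (simp add: dist_real_def abs_minus_commute)

text \<open>
  At points of the complement of \<open>F\<close>, where \<open>\<phi>\<close> vanishes, continuity follows from that of
  \<open>\<phi>\<close>, as \<open>f\<close> is bounded.
\<close>
lemma continuous_map_zero_extension:
  assumes F: "openin T F" and f: "continuous_map (subtopology T F) euclideanreal f"
    and B: "\<And>x. x \<in> F \<Longrightarrow> \<bar>f x\<bar> \<le> B"
    and \<phi>: "continuous_map T euclideanreal \<phi>" "\<And>x. x \<in> topspace T - F \<Longrightarrow> \<phi> x = 0"
  shows "continuous_map T euclideanreal (\<lambda>x. if x \<in> F then \<phi> x * f x else 0)" (is "continuous_map _ _ ?g")
  unfolding continuous_map_real_iff
proof (intro ballI allI impI)
  fix x and e :: real assume x: "x \<in> topspace T" and e: "0 < e"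
  show "\<exists>U. openin T U \<and> x \<in> U \<and> (\<forall>y\<in>U. \<bar>?g y - ?g x\<bar> < e)"
  proof (cases "x \<in> F")
    case True
    have "continuous_map (subtopology T F) euclideanreal (\<lambda>x. \<phi> x * f x)"
      by (intro continuous_map_real_mult f continuous_map_from_subtopology \<phi>)
    moreover have "x \<in> topspace (subtopology T F)" using x True by simp
    ultimately obtain U where "openin (subtopology T F) U" "x \<in> U"
        "\<forall>y\<in>U. \<bar>\<phi> y * f y - \<phi> x * f x\<bar> < e"
      using e unfolding continuous_map_real_iff by blast
    then show ?thesis
      using F True by (intro exI[of _ U]) (auto simp: openin_open_subtopology)
  next
    case False
    define C where "C = max B 0 + 1"
    have C: "0 < C" "B \<le> C" by (auto simp: C_def)
    from C e have "0 < e / C" by simp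
    then obtain U where U: "openin T U" "x \<in> U" "\<forall>y\<in>U. \<bar>\<phi> y - \<phi> x\<bar> < e / C"
      using \<phi>(1) x unfolding continuous_map_real_iff by blast
    have "\<bar>?g y - ?g x\<bar> < e" if y: "y \<in> U" for y
    proof (cases "y \<in> F")
      case True
      have "\<bar>\<phi> y * f y\<bar> \<le> \<bar>\<phi> y\<bar> * C"
        unfolding abs_mult using B[OF True] C by (intro mult_left_mono) auto
      also have "\<dots> < e"
        using U(3) y \<phi>(2)[of x] x False C by (auto simp: field_simps)
      finally show ?thesis using True False by simp
    qed (use False e in auto)
    then show ?thesis using U by blast
  qed
qed

text \<open>
  The extension of \<open>f\<close> by zero is discontinuous on \<open>N\<close>, so it is multiplied by a continuous \<open>\<phi>\<close> that
  vanishes on \<open>N\<close>.  The error is at most a constant times \<open>P\<^sub>t(1 - \<phi>)(x)\<close>.  This is a continuous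
  function of \<open>(t, x)\<close>, so it is small near \<open>(t\<^sub>0, x\<^sub>0)\<close> as soon as it is small there, which can be achieved
  because \<open>P\<^sub>t\<^sub>0(x\<^sub>0, N) = 0\<close>.
\<close>
lemma jointly_continuous_restrict:
  assumes T: "metrizable_space T" and P: "kernel_semigroup (borel_of T) P" "jointly_continuous T P"
    and N: "negligible_set (borel_of T) P N" "closedin T N" and F: "F = topspace T - N"
  shows "jointly_continuous (subtopology T F) (restrict_semigroup P F)"
  unfolding jointly_continuous_def
proof
  interpret negligible_restriction "borel_of T" P N F
    using P N F by unfold_locales auto
  let ?S = "subtopology T F"
  have Fop: "openin T F" using N F by auto
  have FT: "F \<subseteq> topspace T" using F by auto
  fix f assume f: "f \<in> Cb ?S"
  then obtain B where B: "\<And>x. x \<in> F \<Longrightarrow> \<bar>f x\<bar> \<le> B"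
    using FT by (auto simp: Cb_def bounded_real Int_absorb1)
  let ?D = "prod_topology (top_of_set {0::real..}) T"
  let ?Q = "\<lambda>(t, x). \<integral>y. f y \<partial>Q t x"
  have joint: "continuous_map ?D euclideanreal (\<lambda>(t, x). \<integral>y. h y \<partial>P t x)" if "h \<in> Cb T" for h
    using P(2) that by (simp add: jointly_continuous_def)
  show "continuous_map (prod_topology (top_of_set {0..}) ?S) euclideanreal ?Q"
    unfolding continuous_map_real_iff
  proof (intro ballI allI impI)
    fix z :: "real \<times> 'a" and e0 :: real
    assume "z \<in> topspace (prod_topology (top_of_set {0..}) ?S)" and e0: "0 < e0"
    then obtain t0 x0 where z: "z = (t0, x0)" and t0: "0 \<le> t0" and x0: "x0 \<in> F" "x0 \<in> topspace T"
      by auto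
    define C where "C = max B 0 + 1"
    define e where "e = e0 / (4 * C)"
    have C: "0 < C" "B \<le> C" by (auto simp: C_def)
    have e: "0 < e" using C e0 by (simp add: e_def)
    interpret P0: subprob_space "P t0 x0" using subprob_kernel t0 x0 by simp
    \<comment> \<open>\<open>F\<close> is a countable union of closed sets, one of which carries almost all the mass of \<open>F\<close>.\<close>
    have "fsigma_in T F" using T Fop by (rule open_imp_fsigma_in)
    then obtain D where D: "\<And>n::nat. closedin T (D n)" "\<And>n. D n \<subseteq> D (Suc n)" "(\<Union>n. D n) = F"
      unfolding fsigma_in_ascending by metis
    have Dm: "D n \<in> sets (P t0 x0)" for n
      using closedin_sets_borel_of[OF D(1)] sets_kernel[OF t0] x0 by simp
    have "(\<lambda>n. measure (P t0 x0) (D n)) \<longlonglongrightarrow> measure (P t0 x0) (\<Union>n. D n)"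
      using Dm D(2) by (intro P0.finite_Lim_measure_incseq) (auto intro: incseq_SucI)
    then have "\<forall>\<^sub>F n in sequentially. measure (P t0 x0) F - e < measure (P t0 x0) (D n)"
      unfolding D(3) by (rule order_tendstoD) (use e in auto)
    then obtain n where n: "measure (P t0 x0) F - e < measure (P t0 x0) (D n)"
      by (auto dest: eventually_happens)
    have "disjnt N (D n)" using D(3) F by (auto simp: disjnt_def)
    then obtain \<phi> where \<phi>: "continuous_map T (top_of_set {0..1::real}) \<phi>" "\<phi> ` N \<subseteq> {0}" "\<phi> ` D n \<subseteq> {1}"
      using Urysohn_lemma[OF metrizable_imp_normal_space[OF T] N(2) D(1)[of n], of 0 1] by auto
    have \<phi>c: "continuous_map T euclideanreal \<phi>" and \<phi>01: "\<And>x. x \<in> topspace T \<Longrightarrow> 0 \<le> \<phi> x \<and> \<phi> x \<le> 1"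
      using \<phi>(1) by (auto simp: continuous_map_in_subtopology)
    have \<phi>N: "\<And>x. x \<in> topspace T - F \<Longrightarrow> \<phi> x = 0" using \<phi>(2) F by auto
    let ?g = "\<lambda>x. if x \<in> F then \<phi> x * f x else 0"
    have \<phi>f: "\<bar>\<phi> x * f x\<bar> \<le> B" if "x \<in> F" for x
      using mult_mono[of "\<phi> x" 1 "\<bar>f x\<bar>" B] \<phi>01[of x] B[OF that] FT that by (auto simp: abs_mult)
    have g: "?g \<in> Cb T"
    proof -
      have "bounded (?g ` topspace T)"
        unfolding bounded_real using \<phi>f C by (intro exI[of _ C]) force
      then show ?thesis
        using continuous_map_zero_extension[OF Fop _ B \<phi>c \<phi>N] f by (simp add: Cb_def)
    qed
    have \<phi>C: "(\<lambda>x. 1 - \<phi> x) \<in> Cb T"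
      using \<phi>c \<phi>01 by (auto simp: Cb_def bounded_real intro!: continuous_intros exI[of _ 1])
    let ?P\<phi> = "\<lambda>(t, x). \<integral>y. 1 - \<phi> y \<partial>P t x" and ?Pg = "\<lambda>(t, x). \<integral>y. ?g y \<partial>P t x"
    have small: "?P\<phi> (t0, x0) < e"
    proof -
      have "(\<integral>y. 1 - \<phi> y \<partial>P t0 x0) \<le> (\<integral>y. indicator (F - D n) y \<partial>P t0 x0)"
      proof (rule integral_mono_AE')
        show "integrable (P t0 x0) (indicator (F - D n) :: _ \<Rightarrow> real)"
          using Dm F_sets sets_kernel[OF t0] x0 P0.emeasure_finite
          by (intro integrable_real_indicator) (auto simp: less_top[symmetric])
        show "AE y in P t0 x0. 1 - \<phi> y \<le> indicator (F - D n) y"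
          using AE_kernel_F[OF t0 x0(1)] \<phi>01 \<phi>(3) FT by (auto elim!: eventually_mono split: split_indicator)
        show "AE y in P t0 x0. 0 \<le> (indicator (F - D n) y :: real)" by simp
      qed
      also have "\<dots> = measure (P t0 x0) F - measure (P t0 x0) (D n)"
        using Dm F_sets sets_kernel[OF t0] x0 D(3) by (auto intro!: P0.finite_measure_Diff)
      finally show ?thesis using n by simp
    qed
    have approx: "\<bar>?Q (t, x) - ?Pg (t, x)\<bar> \<le> C * ?P\<phi> (t, x)" if t: "0 \<le> t" and x: "x \<in> F" for t x
    proof -
      have x': "x \<in> topspace T" using x FT by auto
      interpret Px: subprob_space "P t x" using subprob_kernel t x' by simp
      let ?f = "\<lambda>y. if y \<in> F then f y else 0"
      have fm: "?f \<in> borel_measurable (borel_of T)"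
        by (intro borel_measurable_zero_extension F_sets Cb_borel_measurable f)
      have ms: "h \<in> borel_measurable (P t x)" if "h \<in> borel_measurable (borel_of T)" for h :: "_ \<Rightarrow> real"
        using t _ that by (rule measurable_kernel) (simp add: x')
      have fi: "integrable (P t x) ?f"
        using B C by (intro Px.integrable_const_bound[of _ C] ms fm) (auto intro!: AE_I2 intro: order_trans)
      have gi: "integrable (P t x) ?g"
        using \<phi>f C by (intro Px.integrable_const_bound[of _ C] ms Cb_borel_measurable g)
          (auto intro!: AE_I2 intro: order_trans)
      have pi: "integrable (P t x) (\<lambda>y. 1 - \<phi> y)"
        using \<phi>01 space_kernel[OF t] x' by (intro Px.integrable_const_bound[of _ 1] ms Cb_borel_measurable \<phi>C)
          (auto intro!: AE_I2)
      have "?Q (t, x) = (\<integral>y. ?f y \<partial>P t x)"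
        using integral_restrict_semigroup[OF t x _ fm, of f] by simp
      then have "?Q (t, x) - ?Pg (t, x) = (\<integral>y. ?f y - ?g y \<partial>P t x)"
        using fi gi by simp
      also have "\<bar>\<dots>\<bar> \<le> (\<integral>y. \<bar>?f y - ?g y\<bar> \<partial>P t x)" by (rule integral_abs_bound)
      also have "\<dots> \<le> (\<integral>y. C * (1 - \<phi> y) \<partial>P t x)"
      proof (rule integral_mono)
        fix y assume "y \<in> space (P t x)"
        then have y: "0 \<le> \<phi> y \<and> \<phi> y \<le> 1" using space_kernel[OF t] x' \<phi>01 by simp
        show "\<bar>?f y - ?g y\<bar> \<le> C * (1 - \<phi> y)"
        proof (cases "y \<in> F")
          case True
          have "f y - \<phi> y * f y = f y * (1 - \<phi> y)" by (simp add: algebra_simps)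
          then have "\<bar>f y - \<phi> y * f y\<bar> = \<bar>f y\<bar> * (1 - \<phi> y)"
            using y by (simp add: abs_mult)
          also have "\<dots> \<le> C * (1 - \<phi> y)" using y B[OF True] C by (intro mult_right_mono) auto
          finally show ?thesis using True by simp
        qed (use y C in auto)
      qed (use fi gi pi in auto)
      finally show ?thesis using pi by simp
    qed
    have z0: "(t0, x0) \<in> topspace ?D" using t0 x0 by simp
    obtain U where U: "openin ?D U" "(t0, x0) \<in> U" "\<forall>y\<in>U. \<bar>?Pg y - ?Pg (t0, x0)\<bar> < C * e"
      using joint[OF g] z0 C e unfolding continuous_map_real_iff by (meson mult_pos_pos)
    obtain V where V: "openin ?D V" "(t0, x0) \<in> V" "\<forall>y\<in>V. \<bar>?P\<phi> y - ?P\<phi> (t0, x0)\<bar> < e - ?P\<phi> (t0, x0)"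
      using joint[OF \<phi>C] z0 small unfolding continuous_map_real_iff by (meson diff_gt_0_iff_gt)
    let ?W = "(U \<inter> V) \<inter> ({0..} \<times> F)"
    have "openin (subtopology ?D ({0..} \<times> F)) ?W" by (intro openin_subtopology_Int openin_Int U V)
    then have W: "openin (prod_topology (top_of_set {0..}) ?S) ?W"
      by (simp add: prod_topology_subtopology subtopology_subtopology flip: subtopology_Times)
    have "\<bar>?Q y - ?Q z\<bar> < e0" if y: "y \<in> ?W" for y
    proof -
      obtain t x where [simp]: "y = (t, x)" by (cases y)
      have t: "0 \<le> t" and x: "x \<in> F" using y by auto
      have "?P\<phi> (t, x) < e" using V(3) y by force
      then have "C * ?P\<phi> (t, x) < C * e" "C * ?P\<phi> (t0, x0) < C * e" using C small by simp_all
      moreover have "\<bar>?Pg (t, x) - ?Pg (t0, x0)\<bar> < C * e" using U(3) y by force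
      moreover note approx[OF t x] approx[OF t0 x0(1)]
      ultimately have "\<bar>?Q (t, x) - ?Q (t0, x0)\<bar> < 3 * (C * e)" by linarith
      also have "\<dots> \<le> e0" using C e0 by (simp add: e_def)
      finally show ?thesis by (simp add: z)
    qed
    then show "\<exists>U. openin (prod_topology (top_of_set {0..}) ?S) U \<and> z \<in> U \<and> (\<forall>y\<in>U. \<bar>?Q y - ?Q z\<bar> < e0)"
      using W U V t0 x0 z by (intro exI[of _ ?W]) auto
  qed
qed

section \<open>Potentials of a right-continuous semigroup\<close>

text \<open>
  Rational times that decrease to \<open>t\<close> up to the error \<open>1 / (k + 1)\<close> and stay strictly above it.  For fixed
  \<open>k\<close> there are countably many of them, so that a function of \<open>approx_right k t\<close> is measurable in \<open>t\<close>
  without further assumptions.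
\<close>
definition approx_right :: "nat \<Rightarrow> real \<Rightarrow> real" where
  "approx_right k t = (real (nat \<lfloor>real (Suc k) * t\<rfloor>) + 1) / real (Suc k)"

lemma approx_right_bounds:
  assumes "0 \<le> t"
  shows "t < approx_right k t" "approx_right k t \<le> t + 1 / real (Suc k)"
proof -
  let ?n = "real (Suc k)"
  have "0 \<le> ?n * t" using assms by simp
  then have n: "real (nat \<lfloor>?n * t\<rfloor>) = of_int \<lfloor>?n * t\<rfloor>" by simp
  have "?n * t < of_int \<lfloor>?n * t\<rfloor> + 1" "of_int \<lfloor>?n * t\<rfloor> \<le> ?n * t" by linarith+
  then have "t < (of_int \<lfloor>?n * t\<rfloor> + 1) / ?n" "(of_int \<lfloor>?n * t\<rfloor> + 1) / ?n \<le> (?n * t + 1) / ?n"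
    by (simp_all add: less_divide_eq mult.commute divide_right_mono del: of_nat_Suc)
  moreover have "(?n * t + 1) / ?n = t + 1 / ?n" by (simp add: add_divide_distrib del: of_nat_Suc)
  ultimately show "t < approx_right k t" "approx_right k t \<le> t + 1 / ?n"
    unfolding approx_right_def n by simp_all
qed

lemma filterlim_approx_right:
  assumes "0 \<le> t"
  shows "filterlim (\<lambda>k. approx_right k t) (at_right t) sequentially"
proof (rule tendsto_imp_filterlim_at_right)
  have "(\<lambda>k. t + 1 / real (Suc k)) \<longlonglongrightarrow> t + 0"
    by (intro tendsto_intros LIMSEQ_Suc lim_1_over_n)
  then have lim: "(\<lambda>k. t + 1 / real (Suc k)) \<longlonglongrightarrow> t" by (simp only: add_0_right)
  show "(\<lambda>k. approx_right k t) \<longlonglongrightarrow> t"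
    by (rule real_tendsto_sandwich[OF always_eventually always_eventually tendsto_const lim])
       (use approx_right_bounds[OF assms] less_imp_le in blast)+
  show "\<forall>\<^sub>F k in sequentially. t < approx_right k t"
    by (rule always_eventually) (use approx_right_bounds[OF assms] in blast)
qed

lemma approx_right_measurable_compose:
  assumes h: "\<And>t. t \<in> \<rat> \<Longrightarrow> 0 \<le> t \<Longrightarrow> (\<lambda>z. h t z) \<in> L \<rightarrow>\<^sub>M N" and g [measurable]: "g \<in> borel_measurable L"
  shows "(\<lambda>z. h (approx_right k (g z)) z) \<in> L \<rightarrow>\<^sub>M N"
  unfolding approx_right_def
proof (rule measurable_compose_countable'[where I = UNIV and g = "\<lambda>z. nat \<lfloor>real (Suc k) * g z\<rfloor>"
      and f = "\<lambda>i z. h ((real i + 1) / real (Suc k)) z"])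
  show "(\<lambda>z. nat \<lfloor>real (Suc k) * g z\<rfloor>) \<in> L \<rightarrow>\<^sub>M count_space UNIV"
    by measurable
  show "(\<lambda>z. h ((real i + 1) / real (Suc k)) z) \<in> L \<rightarrow>\<^sub>M N" for i :: nat
    by (rule h) (simp_all del: of_nat_Suc)
qed simp

lemma nn_integral_exp_Ici:
  assumes "0 < a"
  shows "(\<integral>\<^sup>+t. ennreal (exp (- (a * t))) * indicator {0..} t \<partial>lborel) = ennreal (1 / a)"
proof -
  have "(\<integral>\<^sup>+t. ennreal (exp (- (a * t))) * indicator {0..} t \<partial>lborel) =
      ennreal (0 - (- (exp (- (a * 0)) / a)))"
  proof (rule nn_integral_FTC_atLeast)
    show "((\<lambda>t. - (exp (- (a * t)) / a)) \<longlongrightarrow> 0) at_top" using assms by real_asymp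
  qed (use assms in \<open>auto intro!: derivative_eq_intros simp: field_simps\<close>)
  then show ?thesis by simp
qed

lemma nn_integral_exp_Icc:
  assumes "0 < a" "0 \<le> d"
  shows "(\<integral>\<^sup>+t. ennreal (exp (- (a * t))) * indicator {0..d} t \<partial>lborel) = ennreal ((1 - exp (- (a * d))) / a)"
proof -
  have "(\<integral>\<^sup>+t. ennreal (exp (- (a * t))) * indicator {0..d} t \<partial>lborel) =
      ennreal (- (exp (- (a * d)) / a) - (- (exp (- (a * 0)) / a)))"
    by (rule nn_integral_FTC_Icc) (use assms in \<open>auto intro!: derivative_eq_intros simp: field_simps\<close>)
  also have "- (exp (- (a * d)) / a) - (- (exp (- (a * 0)) / a)) = (1 - exp (- (a * d))) / a"
    by (simp add: diff_divide_distrib)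
  finally show ?thesis .
qed

text \<open>
  The contribution of the times after \<open>\<epsilon>\<close> to the \<open>\<alpha>\<close>-potential of \<open>f\<close>.
\<close>
definition potential_tail :: "(real \<Rightarrow> 'a \<Rightarrow> 'a measure) \<Rightarrow> ('a \<Rightarrow> real) \<Rightarrow> real \<Rightarrow> real \<Rightarrow> 'a \<Rightarrow> ennreal" where
  "potential_tail P f \<alpha> \<epsilon> x =
     (\<integral>\<^sup>+t. ennreal (indicator {\<epsilon>..} t * exp (- (\<alpha> * t)) * (\<integral>y. f y \<partial>P t x)) \<partial>lborel)"

locale kernel_potential = semigroup_of_kernels M P
  for M :: "'a measure" and P :: "real \<Rightarrow> 'a \<Rightarrow> 'a measure" +
  fixes f :: "'a \<Rightarrow> real" and \<alpha> :: real
  assumes f_measurable [measurable]: "f \<in> borel_measurable M"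
    and f_bounds: "\<And>x. x \<in> space M \<Longrightarrow> 0 \<le> f x \<and> f x \<le> 1"
    and right_continuous: "\<And>x t. x \<in> space M \<Longrightarrow> 0 \<le> t \<Longrightarrow>
      ((\<lambda>s. \<integral>y. f y \<partial>P s x) \<longlongrightarrow> (\<integral>y. f y \<partial>P t x)) (at_right t)"
    and \<alpha>: "0 < \<alpha>"
begin

abbreviation "p t x \<equiv> \<integral>y. f y \<partial>P t x"
abbreviation "v \<equiv> potential_tail P f \<alpha>"

lemma integrable_f:
  assumes "0 \<le> t" "x \<in> space M"
  shows "integrable (P t x) f"
proof -
  interpret subprob_space "P t x" using assms by (rule subprob_kernel)
  have "f \<in> borel_measurable (P t x)" using assms f_measurable by (rule measurable_kernel)
  then show ?thesis
    using f_bounds space_kernel[OF assms]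
    by (intro integrable_const_bound[of _ 1]) auto
qed

lemma p_eq_nn:
  assumes "0 \<le> t" "x \<in> space M"
  shows "ennreal (p t x) = (\<integral>\<^sup>+y. ennreal (f y) \<partial>P t x)"
  using f_bounds space_kernel[OF assms]
  by (intro nn_integral_eq_integral[symmetric] integrable_f assms) auto

lemma p_bounds:
  assumes "0 \<le> t" "x \<in> space M"
  shows "0 \<le> p t x" "p t x \<le> 1"
proof -
  interpret subprob_space "P t x" using assms by (rule subprob_kernel)
  have f: "y \<in> space (P t x) \<Longrightarrow> 0 \<le> f y \<and> f y \<le> 1" for y
    using f_bounds space_kernel[OF assms] by simp
  show "0 \<le> p t x" using f by (intro Bochner_Integration.integral_nonneg) auto
  have "p t x \<le> (\<integral>y. 1 \<partial>P t x)"
    using f by (intro integral_mono integrable_f assms) auto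
  also have "\<dots> \<le> 1" using subprob_measure_le_1 by simp
  finally show "p t x \<le> 1" .
qed

lemma p_0: "x \<in> space M \<Longrightarrow> p 0 x = f x"
  using semigroup by (simp add: kernel_semigroup_def integral_return)

lemma p_measurable: "0 \<le> t \<Longrightarrow> p t \<in> borel_measurable M"
  by (rule measurable_compose[OF kernel]) (auto intro: integral_measurable_subprob_algebra)

lemma chapman_kolmogorov:
  assumes s: "0 \<le> s" and t: "0 \<le> t" and x: "x \<in> space M"
  shows "(\<integral>\<^sup>+y. ennreal (p t y) \<partial>P s x) = ennreal (p (s + t) x)"
proof -
  have Pm: "P t \<in> P s x \<rightarrow>\<^sub>M subprob_algebra M"
    using s x kernel[OF t] by (rule measurable_kernel)
  have ne: "space (P s x) \<noteq> {}"
    using x space_kernel[OF s x] by auto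
  have "P (s + t) x = P s x \<bind> P t"
  proof (rule measure_eqI)
    show "sets (P (s + t) x) = sets (P s x \<bind> P t)"
      using s t x sets_bind[OF _ ne, of "P t" M] subprob_measurableD(2)[OF Pm] sets_kernel by simp
    fix A assume "A \<in> sets (P (s + t) x)"
    then have A: "A \<in> sets M" using s t x sets_kernel by simp
    show "emeasure (P (s + t) x) A = emeasure (P s x \<bind> P t) A"
      using emeasure_bind[OF ne Pm A] semigroup s t x A by (simp add: kernel_semigroup_def)
  qed
  then have "(\<integral>\<^sup>+y. ennreal (f y) \<partial>P (s + t) x) = (\<integral>\<^sup>+y. \<integral>\<^sup>+z. ennreal (f z) \<partial>P t y \<partial>P s x)"
    using nn_integral_bind[of "\<lambda>y. ennreal (f y)", OF _ Pm] by simp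
  also have "\<dots> = (\<integral>\<^sup>+y. ennreal (p t y) \<partial>P s x)"
    using t space_kernel[OF s x]
    by (intro nn_integral_cong) (simp add: p_eq_nn)
  finally show ?thesis using s t x by (simp add: p_eq_nn)
qed

text \<open>Right-continuity in time reduces the claim to countably many times.\<close>
lemma p_jointly_measurable:
  obtains q where "q \<in> borel_measurable (borel \<Otimes>\<^sub>M M)" "\<And>t x. 0 \<le> t \<Longrightarrow> x \<in> space M \<Longrightarrow> q (t, x) = p t x"
proof
  let ?q = "\<lambda>z. lim (\<lambda>k. p (approx_right k (fst z)) (snd z))"
  have "(\<lambda>z. p (approx_right k (fst z)) (snd z)) \<in> borel_measurable (borel \<Otimes>\<^sub>M M)" for k
    by (rule approx_right_measurable_compose[where h = "\<lambda>t z. p t (snd z)", OF _ measurable_fst])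
       (rule measurable_compose[OF measurable_snd p_measurable])
  then show "?q \<in> borel_measurable (borel \<Otimes>\<^sub>M M)"
    by (rule borel_measurable_lim_metric)
  show "?q (t, x) = p t x" if "0 \<le> t" "x \<in> space M" for t x
    using filterlim_compose[OF right_continuous[OF that(2,1)] filterlim_approx_right[OF that(1)]]
    by (simp add: limI)
qed

lemma integrand_measurable:
  assumes "0 \<le> \<epsilon>" "0 \<le> s" and [measurable]: "c \<in> borel_measurable borel"
  shows "(\<lambda>(x, t). ennreal (indicator {\<epsilon>..} t * c t * p (s + t) x)) \<in> borel_measurable (M \<Otimes>\<^sub>M borel)"
proof -
  obtain q where q [measurable]: "q \<in> borel_measurable (borel \<Otimes>\<^sub>M M)"
    and eq: "\<And>t x. 0 \<le> t \<Longrightarrow> x \<in> space M \<Longrightarrow> q (t, x) = p t x"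
    using p_jointly_measurable by blast
  have "(\<lambda>(x, t). ennreal (indicator {\<epsilon>..} t * c t * q (s + t, x))) \<in> borel_measurable (M \<Otimes>\<^sub>M borel)"
    by measurable
  also have "?this \<longleftrightarrow> ?thesis"
    using assms by (intro measurable_cong) (auto simp: space_pair_measure eq split: split_indicator)
  finally show ?thesis .
qed

lemma integrand_measurable_time:
  assumes "0 \<le> \<epsilon>" "0 \<le> s" "x \<in> space M" "c \<in> borel_measurable borel"
  shows "(\<lambda>t. ennreal (indicator {\<epsilon>..} t * c t * p (s + t) x)) \<in> borel_measurable borel"
  using measurable_compose_Pair1[OF assms(3) integrand_measurable[OF assms(1,2,4)]] by simp

lemma v_measurable:
  assumes "0 \<le> \<epsilon>"
  shows "v \<epsilon> \<in> borel_measurable M"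
proof -
  have "(\<lambda>(x, t). ennreal (indicator {\<epsilon>..} t * exp (- (\<alpha> * t)) * p (0 + t) x)) \<in> borel_measurable (M \<Otimes>\<^sub>M borel)"
    using assms by (intro integrand_measurable) auto
  then have "(\<lambda>(x, t). ennreal (indicator {\<epsilon>..} t * exp (- (\<alpha> * t)) * p t x)) \<in> borel_measurable (M \<Otimes>\<^sub>M lborel)"
    using measurable_cong_sets[OF sets_pair_measure_cong[OF refl sets_lborel] refl, of M] by simp
  then show ?thesis
    unfolding potential_tail_def by (rule lborel.borel_measurable_nn_integral)
qed

lemma v_le:
  assumes "0 \<le> \<epsilon>" "x \<in> space M"
  shows "v \<epsilon> x \<le> ennreal (1 / \<alpha>)"
proof -
  have "v \<epsilon> x \<le> (\<integral>\<^sup>+t. ennreal (exp (- (\<alpha> * t))) * indicator {0..} t \<partial>lborel)"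
    unfolding potential_tail_def
    using assms p_bounds(2)[of _ x] mult_left_le[of "p t x" "exp (- (\<alpha> * t))" for t]
    by (intro nn_integral_mono) (auto split: split_indicator intro!: ennreal_leI)
  then show ?thesis using nn_integral_exp_Ici[OF \<alpha>] by simp
qed

lemma v_real:
  assumes "0 \<le> \<epsilon>" "x \<in> space M"
  shows "v \<epsilon> x = ennreal (enn2real (v \<epsilon> x))"
  using v_le[OF assms] by (metis ennreal_enn2real ennreal_less_top le_less_trans)

lemma v_antimono: "0 \<le> s \<Longrightarrow> x \<in> space M \<Longrightarrow> 0 \<le> \<epsilon> \<Longrightarrow> v (\<epsilon> + s) x \<le> v \<epsilon> x"
  unfolding potential_tail_def
  by (intro nn_integral_mono) (auto split: split_indicator)

lemma v_split:
  assumes "0 \<le> \<epsilon>" "0 \<le> s" "x \<in> space M"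
  shows "v \<epsilon> x = (\<integral>\<^sup>+t. ennreal (indicator {\<epsilon>..<\<epsilon> + s} t * exp (- (\<alpha> * t)) * p t x) \<partial>lborel) + v (\<epsilon> + s) x"
proof -
  have m: "(\<lambda>t. ennreal (indicator {\<epsilon>'..} t * c t * p t x)) \<in> borel_measurable borel"
    if "0 \<le> \<epsilon>'" "c \<in> borel_measurable borel" for \<epsilon>' and c :: "real \<Rightarrow> real"
    using integrand_measurable_time[OF that(1) order_refl assms(3) that(2)] by simp
  have m1: "(\<lambda>t. ennreal (indicator {\<epsilon>..<\<epsilon> + s} t * exp (- (\<alpha> * t)) * p t x)) \<in> borel_measurable borel"
  proof -
    have "(\<lambda>t. ennreal (indicator {\<epsilon>..} t * (indicator {..<\<epsilon> + s} t * exp (- (\<alpha> * t))) * p t x)) \<in> borel_measurable borel"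
      using assms by (intro m) auto
    also have "(\<lambda>t. ennreal (indicator {\<epsilon>..} t * (indicator {..<\<epsilon> + s} t * exp (- (\<alpha> * t))) * p t x)) =
        (\<lambda>t. ennreal (indicator {\<epsilon>..<\<epsilon> + s} t * exp (- (\<alpha> * t)) * p t x))"
      by (auto split: split_indicator)
    finally show ?thesis .
  qed
  have "v \<epsilon> x = (\<integral>\<^sup>+t. ennreal (indicator {\<epsilon>..<\<epsilon> + s} t * exp (- (\<alpha> * t)) * p t x) +
      ennreal (indicator {\<epsilon> + s..} t * exp (- (\<alpha> * t)) * p t x) \<partial>lborel)"
    unfolding potential_tail_def using assms by (intro nn_integral_cong) (auto split: split_indicator)
  also have "\<dots> = (\<integral>\<^sup>+t. ennreal (indicator {\<epsilon>..<\<epsilon> + s} t * exp (- (\<alpha> * t)) * p t x) \<partial>lborel) + v (\<epsilon> + s) x"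
    unfolding potential_tail_def using assms m1 m[of "\<epsilon> + s"] by (intro nn_integral_add) auto
  finally show ?thesis .
qed

text \<open>
  The semigroup moves the lower limit of the time integral, by Fubini's theorem and the
  Chapman-Kolmogorov equation.
\<close>
lemma v_shift:
  assumes \<epsilon>: "0 \<le> \<epsilon>" and s: "0 \<le> s" and x: "x \<in> space M"
  shows "(\<integral>\<^sup>+y. v \<epsilon> y \<partial>P s x) = ennreal (exp (\<alpha> * s)) * v (\<epsilon> + s) x"
proof -
  interpret P: subprob_space "P s x" using s x by (rule subprob_kernel)
  interpret pair_sigma_finite "P s x" lborel ..
  have sp: "space (P s x) = space M" using space_kernel[OF s x] .
  have "(\<lambda>(x, t). ennreal (indicator {\<epsilon>..} t * exp (- (\<alpha> * t)) * p (0 + t) x)) \<in> borel_measurable (M \<Otimes>\<^sub>M borel)"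
    using \<epsilon> by (intro integrand_measurable) auto
  then have m: "(\<lambda>(x, t). ennreal (indicator {\<epsilon>..} t * exp (- (\<alpha> * t)) * p t x)) \<in> borel_measurable (P s x \<Otimes>\<^sub>M lborel)"
    by (subst measurable_cong_sets[OF sets_pair_measure_cong[OF sets_kernel[OF s x] sets_lborel] refl]) simp
  have "(\<integral>\<^sup>+y. v \<epsilon> y \<partial>P s x) =
      (\<integral>\<^sup>+t. \<integral>\<^sup>+y. ennreal (indicator {\<epsilon>..} t * exp (- (\<alpha> * t)) * p t y) \<partial>P s x \<partial>lborel)"
    unfolding potential_tail_def by (rule Fubini'[OF m, symmetric])
  also have "\<dots> = (\<integral>\<^sup>+t. ennreal (indicator {\<epsilon>..} t * exp (- (\<alpha> * t)) * p (s + t) x) \<partial>lborel)"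
  proof (rule nn_integral_cong)
    fix t :: real
    show "(\<integral>\<^sup>+y. ennreal (indicator {\<epsilon>..} t * exp (- (\<alpha> * t)) * p t y) \<partial>P s x) =
        ennreal (indicator {\<epsilon>..} t * exp (- (\<alpha> * t)) * p (s + t) x)"
    proof (cases "\<epsilon> \<le> t")
      case True
      then have t: "0 \<le> t" using \<epsilon> by simp
      have "p t \<in> borel_measurable (P s x)"
        using s x p_measurable[OF t] by (rule measurable_kernel)
      then have "(\<integral>\<^sup>+y. ennreal (exp (- (\<alpha> * t))) * ennreal (p t y) \<partial>P s x) =
          ennreal (exp (- (\<alpha> * t))) * ennreal (p (s + t) x)"
        by (subst nn_integral_cmult) (auto simp: chapman_kolmogorov[OF s t x])
      then show ?thesis using True by (simp add: ennreal_mult')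
    qed simp
  qed
  also have "\<dots> = (\<integral>\<^sup>+t. ennreal (exp (\<alpha> * s)) *
      ennreal (indicator {\<epsilon> + s..} (s + 1 * t) * exp (- (\<alpha> * (s + 1 * t))) * p (s + 1 * t) x) \<partial>lborel)"
  proof (rule nn_integral_cong)
    fix t :: real
    have "exp (- (\<alpha> * t)) = exp (\<alpha> * s) * exp (- (\<alpha> * (s + 1 * t)))"
      by (simp add: algebra_simps flip: exp_add)
    then have "indicator {\<epsilon>..} t * exp (- (\<alpha> * t)) * p (s + t) x =
        exp (\<alpha> * s) * (indicator {\<epsilon> + s..} (s + 1 * t) * exp (- (\<alpha> * (s + 1 * t))) * p (s + 1 * t) x)"
      by (simp add: indicator_def add.commute)
    then show "ennreal (indicator {\<epsilon>..} t * exp (- (\<alpha> * t)) * p (s + t) x) = ennreal (exp (\<alpha> * s)) *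
        ennreal (indicator {\<epsilon> + s..} (s + 1 * t) * exp (- (\<alpha> * (s + 1 * t))) * p (s + 1 * t) x)"
      by (simp only: ennreal_mult' exp_ge_zero)
  qed
  also have "\<dots> = ennreal (exp (\<alpha> * s)) *
      (\<integral>\<^sup>+t. ennreal (indicator {\<epsilon> + s..} (s + 1 * t) * exp (- (\<alpha> * (s + 1 * t))) * p (s + 1 * t) x) \<partial>lborel)"
  proof (rule nn_integral_cmult)
    have "(\<lambda>t. ennreal (indicator {\<epsilon>..} t * exp (- (\<alpha> * (s + t))) * p (s + t) x)) \<in> borel_measurable borel"
      using \<epsilon> s x by (intro integrand_measurable_time) auto
    then show "(\<lambda>t. ennreal (indicator {\<epsilon> + s..} (s + 1 * t) * exp (- (\<alpha> * (s + 1 * t))) * p (s + 1 * t) x)) \<in> borel_measurable lborel"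
      by (simp add: indicator_def algebra_simps)
  qed
  also have "(\<integral>\<^sup>+t. ennreal (indicator {\<epsilon> + s..} (s + 1 * t) * exp (- (\<alpha> * (s + 1 * t))) * p (s + 1 * t) x) \<partial>lborel) = v (\<epsilon> + s) x"
    unfolding potential_tail_def
    using \<epsilon> s x integrand_measurable_time[of "\<epsilon> + s" 0 x "\<lambda>t. exp (- (\<alpha> * t))"]
    by (subst nn_integral_real_affine[where c = 1 and t = s]) auto
  finally show ?thesis .
qed

lemma v_le_v_plus:
  assumes "0 \<le> \<epsilon>" "0 \<le> s" "x \<in> space M"
  shows "v \<epsilon> x \<le> v (\<epsilon> + s) x + ennreal s"
proof -
  have "(\<integral>\<^sup>+t. ennreal (indicator {\<epsilon>..<\<epsilon> + s} t * exp (- (\<alpha> * t)) * p t x) \<partial>lborel) \<le>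
      (\<integral>\<^sup>+t. indicator {\<epsilon>..<\<epsilon> + s} t \<partial>lborel)"
    using assms p_bounds[of _ x] \<alpha> mult_mono[of "exp (- (\<alpha> * t))" 1 "p t x" 1 for t]
    by (intro nn_integral_mono) (auto split: split_indicator intro!: ennreal_leI simp flip: ennreal_1)
  also have "\<dots> = ennreal s" using assms by simp
  finally show ?thesis unfolding v_split[OF assms] by (simp add: add.commute add_left_mono)
qed

text \<open>
  By \<open>v_shift\<close>, discounted with the rate \<open>\<alpha>\<close>, the semigroup maps \<open>v \<epsilon>\<close> to \<open>v (\<epsilon> + t)\<close>,
  which increases to \<open>v \<epsilon>\<close> as \<open>t\<close> decreases to \<open>0\<close>.  The resolvent averages over an exponential time,
  which concentrates at \<open>0\<close> as \<open>q\<close> grows.  A rate \<open>\<beta>\<close> larger than \<open>\<alpha>\<close> only discounts more.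
\<close>
lemma excessive_potential_tail:
  assumes S: "\<And>t x u. 0 \<le> t \<Longrightarrow> x \<in> space M \<Longrightarrow> u \<in> borel_measurable M \<Longrightarrow> S t u x = (\<integral>\<^sup>+y. u y \<partial>P t x)"
    and \<beta>: "\<alpha> \<le> \<beta>" and \<epsilon>: "0 \<le> \<epsilon>"
  shows "excessive M S \<beta> (v \<epsilon>)"
  unfolding excessive_def
proof (intro conjI ballI allI impI)
  show "v \<epsilon> \<in> borel_measurable M" using \<epsilon> by (rule v_measurable)
  fix x assume x: "x \<in> space M"
  define w where "w = enn2real (v \<epsilon> x)"
  have w: "v \<epsilon> x = ennreal w" "0 \<le> w" using v_real[OF \<epsilon> x] by (auto simp: w_def)
  let ?R = "\<lambda>q. ennreal q * resolvent S (\<beta> + q) (v \<epsilon>) x"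
  have R: "resolvent S (\<beta> + q) (v \<epsilon>) x =
      (\<integral>\<^sup>+t. ennreal (exp (- (q * t))) * (ennreal (exp (- ((\<beta> - \<alpha>) * t))) * v (\<epsilon> + t) x) * indicator {0..} t \<partial>lborel)" for q
    unfolding resolvent_def
  proof (rule nn_integral_cong)
    fix t :: real
    have "exp (- ((\<beta> + q) * t)) * exp (\<alpha> * t) = exp (- (q * t)) * exp (- ((\<beta> - \<alpha>) * t))"
      by (simp add: algebra_simps flip: exp_add)
    then show "ennreal (exp (- ((\<beta> + q) * t))) * S t (v \<epsilon>) x * indicator {0..} t =
        ennreal (exp (- (q * t))) * (ennreal (exp (- ((\<beta> - \<alpha>) * t))) * v (\<epsilon> + t) x) * indicator {0..} t"
      using x \<epsilon> S[of t x "v \<epsilon>"] v_measurable[OF \<epsilon>]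
      by (auto split: split_indicator simp: v_shift ennreal_mult'[symmetric] mult.assoc[symmetric])
  qed
  have upper: "?R q \<le> v \<epsilon> x" if q: "0 < q" for q
  proof -
    have "resolvent S (\<beta> + q) (v \<epsilon>) x \<le>
        (\<integral>\<^sup>+t. (ennreal (exp (- (q * t))) * indicator {0..} t) * v \<epsilon> x \<partial>lborel)"
      unfolding R
    proof (rule nn_integral_mono)
      fix t :: real
      have "ennreal (exp (- ((\<beta> - \<alpha>) * t))) * v (\<epsilon> + t) x \<le> 1 * v \<epsilon> x" if "0 \<le> t"
        using that x \<epsilon> \<beta> by (intro mult_mono v_antimono) (auto simp flip: ennreal_1 intro!: ennreal_leI)
      then show "ennreal (exp (- (q * t))) * (ennreal (exp (- ((\<beta> - \<alpha>) * t))) * v (\<epsilon> + t) x) * indicator {0..} t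
          \<le> (ennreal (exp (- (q * t))) * indicator {0..} t) * v \<epsilon> x"
        by (auto split: split_indicator intro!: mult_left_mono)
    qed
    also have "\<dots> = ennreal (1 / q) * v \<epsilon> x"
      using nn_integral_exp_Ici[OF q] by (subst nn_integral_multc) auto
    finally have "?R q \<le> ennreal q * (ennreal (1 / q) * v \<epsilon> x)" by (rule mult_left_mono) simp
    also have "\<dots> = v \<epsilon> x" using q by (simp add: mult.assoc[symmetric] ennreal_mult'[symmetric])
    finally show ?thesis .
  qed
  then show "\<And>q. 0 < q \<Longrightarrow> ?R q \<le> v \<epsilon> x" .
  \<comment> \<open>Before time \<open>d\<close>, which carries mass \<open>1 - exp (- q d)\<close>, the function has decreased by at most \<open>d\<close>.\<close>
  have lower: "ennreal ((1 - exp (- (q * d))) * (exp (- ((\<beta> - \<alpha>) * d)) * (w - d))) \<le> ?R q"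
    if q: "0 < q" and d: "0 \<le> d" for q d
  proof -
    let ?c = "exp (- ((\<beta> - \<alpha>) * d)) * (w - d)"
    have "(\<integral>\<^sup>+t. (ennreal (exp (- (q * t))) * indicator {0..d} t) * ennreal ?c \<partial>lborel) \<le> resolvent S (\<beta> + q) (v \<epsilon>) x"
      unfolding R
    proof (rule nn_integral_mono)
      fix t :: real
      have "ennreal ?c \<le> ennreal (exp (- ((\<beta> - \<alpha>) * t))) * v (\<epsilon> + t) x" if t: "0 \<le> t" "t \<le> d"
      proof -
        have "ennreal w \<le> v (\<epsilon> + t) x + ennreal t" using v_le_v_plus[OF \<epsilon> t(1) x] w by simp
        also have "\<dots> = ennreal (enn2real (v (\<epsilon> + t) x) + t)"
          using v_real[of "\<epsilon> + t" x] t \<epsilon> x by (metis add_nonneg_nonneg enn2real_nonneg ennreal_plus)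
        finally have "w - d \<le> enn2real (v (\<epsilon> + t) x)"
          using t by (subst (asm) ennreal_le_iff) auto
        then have "?c \<le> exp (- ((\<beta> - \<alpha>) * d)) * enn2real (v (\<epsilon> + t) x)"
          by (intro mult_left_mono) auto
        also have "\<dots> \<le> exp (- ((\<beta> - \<alpha>) * t)) * enn2real (v (\<epsilon> + t) x)"
          using t \<beta> by (intro mult_right_mono) (auto intro: mult_left_mono)
        finally have "ennreal ?c \<le> ennreal (exp (- ((\<beta> - \<alpha>) * t)) * enn2real (v (\<epsilon> + t) x))"
          by (rule ennreal_leI)
        also have "\<dots> = ennreal (exp (- ((\<beta> - \<alpha>) * t))) * v (\<epsilon> + t) x"
          using v_real[of "\<epsilon> + t" x] t \<epsilon> x by (subst ennreal_mult') auto
        finally show ?thesis .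
      qed
      then show "(ennreal (exp (- (q * t))) * indicator {0..d} t) * ennreal ?c \<le>
          ennreal (exp (- (q * t))) * (ennreal (exp (- ((\<beta> - \<alpha>) * t))) * v (\<epsilon> + t) x) * indicator {0..} t"
        by (auto split: split_indicator intro!: mult_left_mono)
    qed
    then have "ennreal q * (ennreal ((1 - exp (- (q * d))) / q) * ennreal ?c) \<le> ?R q"
      by (subst (asm) nn_integral_multc) (auto simp: nn_integral_exp_Icc[OF q d] intro: mult_left_mono)
    also have "ennreal q * (ennreal ((1 - exp (- (q * d))) / q) * ennreal ?c) = ennreal ((1 - exp (- (q * d))) * ?c)"
      using q d by (simp add: mult.assoc[symmetric] ennreal_mult'[symmetric])
    finally show ?thesis .
  qed
  \<comment> \<open>The choice \<open>d = 1 / sqrt q\<close> makes \<open>d\<close> tend to \<open>0\<close> and \<open>q d\<close> to infinity.\<close>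
  let ?l = "\<lambda>q. (1 - exp (- (q * (1 / sqrt q)))) * (exp (- ((\<beta> - \<alpha>) * (1 / sqrt q))) * (w - 1 / sqrt q))"
  have "(?l \<longlongrightarrow> (1 - 0) * (exp (- ((\<beta> - \<alpha>) * 0)) * (w - 0))) at_top"
  proof (intro tendsto_intros)
    show "((\<lambda>q. exp (- (q * (1 / sqrt q)))) \<longlongrightarrow> 0) at_top" by real_asymp
    show "((\<lambda>q. 1 / sqrt q) \<longlongrightarrow> 0) at_top" by real_asymp
    show "((\<lambda>q. 1 / sqrt q) \<longlongrightarrow> 0) at_top" by real_asymp
  qed
  then have lim: "((\<lambda>q. ennreal (?l q)) \<longlongrightarrow> v \<epsilon> x) at_top" using w by (auto intro!: tendsto_ennrealI)
  have ev_lower: "\<forall>\<^sub>F q in at_top. ennreal (?l q) \<le> ?R q"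
    using eventually_gt_at_top[of "0::real"] by eventually_elim (intro lower, auto)
  have ev_upper: "\<forall>\<^sub>F q in at_top. ?R q \<le> v \<epsilon> x"
    using eventually_gt_at_top[of "0::real"] by eventually_elim (rule upper)
  show "(?R \<longlongrightarrow> v \<epsilon> x) at_top"
    by (rule tendsto_sandwich[OF ev_lower ev_upper lim tendsto_const])
qed

text \<open>
  The difference quotient is the mean of \<open>exp (- \<alpha> t) P\<^sub>tf(x)\<close> over a short time interval, and this function
  is right-continuous at \<open>0\<close> with value \<open>f(x)\<close>.
\<close>
lemma potential_tail_derivative:
  assumes x: "x \<in> space M"
  shows "(\<lambda>k. real (Suc k) * (enn2real (v 0 x) - enn2real (v (1 / real (Suc k)) x))) \<longlonglongrightarrow> f x"
proof (rule LIMSEQ_I)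
  fix e0 :: real assume "0 < e0"
  define e where "e = e0 / 2"
  have e: "0 < e" using \<open>0 < e0\<close> by (simp add: e_def)
  let ?\<phi> = "\<lambda>t. exp (- (\<alpha> * t)) * p t x"
  have "(?\<phi> \<longlongrightarrow> exp (- (\<alpha> * 0)) * p 0 x) (at_right 0)"
    by (intro tendsto_intros right_continuous x) auto
  then have "\<forall>\<^sub>F t in at_right 0. dist (?\<phi> t) (f x) < e"
    using e by (simp add: p_0[OF x] tendstoD)
  then obtain d where d: "0 < d" "\<And>t. 0 < t \<Longrightarrow> t < d \<Longrightarrow> \<bar>?\<phi> t - f x\<bar> < e"
    unfolding eventually_at_right_field dist_real_def by blast
  have d': "\<bar>?\<phi> t - f x\<bar> < e" if "0 \<le> t" "t < d" for t
    using d(2)[of t] that e p_0[OF x] by (cases "t = 0") auto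
  obtain n where n: "1 / real (Suc n) < d" using d(1) reals_Archimedean by (auto simp: inverse_eq_divide)
  have "\<bar>real (Suc k) * (enn2real (v 0 x) - enn2real (v (1 / real (Suc k)) x)) - f x\<bar> < e0" if k: "n \<le> k" for k
  proof -
    define h where "h = 1 / real (Suc k)"
    have h: "0 < h" by (simp add: h_def)
    have "h \<le> 1 / real (Suc n)" unfolding h_def using k by (intro divide_left_mono) auto
    then have hd: "h < d" using n by simp
    let ?I = "\<integral>\<^sup>+t. ennreal (indicator {0..<h} t * exp (- (\<alpha> * t)) * p t x) \<partial>lborel"
    have split: "v 0 x = ?I + v h x" using v_split[of 0 h x] h x by simp
    have c: "(\<integral>\<^sup>+t. ennreal b * indicator {0..<h} t \<partial>lborel) = ennreal (b * h)" for b
      using h by (subst nn_integral_cmult_indicator) (auto simp: ennreal_mult'')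
    have Iu: "?I \<le> ennreal ((f x + e) * h)"
      unfolding c[symmetric]
    proof (rule nn_integral_mono)
      fix t show "ennreal (indicator {0..<h} t * exp (- (\<alpha> * t)) * p t x) \<le> ennreal (f x + e) * indicator {0..<h} t"
        using d'[of t] hd by (auto split: split_indicator intro!: ennreal_leI)
    qed
    have Il: "ennreal ((f x - e) * h) \<le> ?I"
      unfolding c[symmetric]
    proof (rule nn_integral_mono)
      fix t show "ennreal (f x - e) * indicator {0..<h} t \<le> ennreal (indicator {0..<h} t * exp (- (\<alpha> * t)) * p t x)"
        using d'[of t] hd by (auto split: split_indicator intro!: ennreal_leI)
    qed
    have If: "?I < top" using Iu by (meson ennreal_less_top le_less_trans)
    have I: "enn2real (v 0 x) - enn2real (v h x) = enn2real ?I"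
      unfolding split using If v_real[of h x] h x by (subst enn2real_plus) (auto simp: less_top[symmetric])
    have "0 \<le> f x" using f_bounds x by auto
    then have nonneg: "0 \<le> (f x + e) * h" using e h by simp
    define r where "r = enn2real ?I"
    have r: "0 \<le> r" by (simp add: r_def)
    have Ir: "?I = ennreal r" unfolding r_def using If by simp
    have "r \<le> (f x + e) * h" using Iu unfolding Ir using nonneg by simp
    moreover have "(f x - e) * h \<le> r" using Il unfolding Ir using r by (simp add: ennreal_le_iff)
    ultimately have "r \<le> (f x + e) * h" "(f x - e) * h \<le> r" by simp_all
    then have "r / h \<le> f x + e" "f x - e \<le> r / h"
      using h by (simp_all add: pos_divide_le_eq pos_le_divide_eq)
    moreover have "real (Suc k) * r = r / h" by (simp add: h_def)
    ultimately have "\<bar>real (Suc k) * r - f x\<bar> \<le> e" by linarith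
    also have "e < e0" using \<open>0 < e0\<close> by (simp add: e_def)
    finally show ?thesis unfolding h_def[symmetric] I r_def .
  qed
  then show "\<exists>n. \<forall>k\<ge>n. norm (real (Suc k) * (enn2real (v 0 x) - enn2real (v (1 / real (Suc k)) x)) - f x) < e0"
    by (auto simp only: real_norm_def)
qed

end

text \<open>
  The truncated distances to the points of a countable dense subset of the compact metric space: small balls around
  these points form a countable base.
\<close>
lemma lusin_topology_generating_sequence:
  assumes T: "lusin_topology T"
  obtains f :: "nat \<Rightarrow> 'a \<Rightarrow> real" where "\<And>m. f m \<in> Cb T" "\<And>m x. x \<in> topspace T \<Longrightarrow> 0 \<le> f m x \<and> f m x \<le> 1"
    "\<And>L. space L = topspace T \<Longrightarrow> (\<And>m. f m \<in> borel_measurable L) \<Longrightarrow> sets (borel_of T) \<subseteq> sets L"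
proof -
  obtain K :: "real set" and d B where K: "Metric_space K d" and comp: "compact_space (Metric_space.mtopology K d)"
      and hom: "T homeomorphic_space subtopology (Metric_space.mtopology K d) B"
    using T unfolding lusin_topology_def by blast
  interpret Metric_space K d by fact
  obtain g where g: "homeomorphic_map T (subtopology mtopology B) g"
    using hom homeomorphic_space by blast
  have gc: "continuous_map T mtopology g"
    using g homeomorphic_imp_continuous_map continuous_map_in_subtopology by blast
  have gK: "x \<in> topspace T \<Longrightarrow> g x \<in> K" for x
    using continuous_map_image_subset_topspace[OF gc] by auto
  have "mtotally_bounded K"
    using comp compactin_imp_mtotally_bounded by (simp add: compact_space_def)
  then have "\<forall>n. \<exists>C. finite C \<and> C \<subseteq> K \<and> K \<subseteq> (\<Union>c\<in>C. mball c (1 / real (Suc n)))"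
    unfolding mtotally_bounded_def by simp
  then obtain C where C: "\<And>n. finite (C n)" "\<And>n. C n \<subseteq> K" "\<And>n. K \<subseteq> (\<Union>c\<in>C n. mball c (1 / real (Suc n)))"
    by metis
  define c where "c = from_nat_into (insert (SOME x. x \<in> K) (\<Union>n. C n))"
  have rc: "range c = insert (SOME x. x \<in> K) (\<Union>n. C n)"
    unfolding c_def by (intro range_from_nat_into) (auto intro: countable_finite C)
  show thesis
  proof (cases "topspace T = {}")
    case True
    have "sets (borel_of T) \<subseteq> {{}}"
      using sets.sets_into_space[of _ "borel_of T"] True
      by (auto simp: borel_of_def space_measure_of_conv)
    then show thesis
      using True by (intro that[of "\<lambda>_ _. 0"]) (auto simp: Cb_def bounded_iff)
  next
    case False
    then have "(SOME x. x \<in> K) \<in> K" using gK by (metis ex_in_conv someI_ex)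
    then have "range c \<subseteq> K" unfolding rc using C(2) by simp blast
    then have cK: "c m \<in> K" for m by blast
    define f where "f m x = min 1 (d (c m) (g x))" for m x
    show thesis
    proof (rule that[of f])
      show f01: "0 \<le> f m x \<and> f m x \<le> 1" for m x by (simp add: f_def)
      have "continuous_map mtopology euclideanreal (d (c m))" for m
        using continuous_on_mdist[of "c m" "metric (K, d)"] cK by (simp add: mtopology_of)
      then have "continuous_map T euclideanreal (\<lambda>x. d (c m) (g x))" for m
        using continuous_map_compose[OF gc, of euclideanreal "d (c m)"] by (simp add: o_def)
      then have "continuous_map T euclideanreal (f m)" for m
        unfolding f_def by (intro continuous_intros)
      then show "f m \<in> Cb T" for m
        using f01 by (auto simp: Cb_def bounded_real intro!: exI[of _ 1])
      fix L assume L: "space L = topspace T" and fL: "\<And>m. f m \<in> borel_measurable L"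
      have "U \<in> sets L" if U: "openin T U" for U
      proof -
        let ?I = "{(m, n). \<forall>x\<in>topspace T. f m x < 1 / real (Suc (Suc n)) \<longrightarrow> x \<in> U}"
        let ?B = "\<lambda>(m, n). {x \<in> space L. f m x < 1 / real (Suc (Suc n))}"
        have "openin (subtopology mtopology B) (g ` U)"
          using g U by (simp add: homeomorphic_map_openness_eq openin_subset)
        then obtain W where W: "openin mtopology W" "g ` U = W \<inter> B" by (auto simp: openin_subtopology)
        have gB: "x \<in> topspace T \<Longrightarrow> g x \<in> B" for x
          using homeomorphic_imp_surjective_map[OF g] by auto
        have inj: "inj_on g (topspace T)" using g homeomorphic_imp_injective_map by blast
        have WU: "x \<in> U" if "x \<in> topspace T" "g x \<in> W" for x
        proof -
          have "g x \<in> g ` U" using that gB W by auto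
          then show ?thesis using inj openin_subset[OF U] that(1) by (metis imageE inj_onD subsetD)
        qed
        have "U = (\<Union>i\<in>?I. ?B i)"
        proof (intro equalityI subsetI)
          fix x assume x: "x \<in> U"
          then have xT: "x \<in> topspace T" and "g x \<in> W" using openin_subset[OF U] W by auto
          then obtain r where r: "0 < r" "mball (g x) r \<subseteq> W" using W openin_mtopology by auto
          obtain n0 where n0: "1 / real (Suc n0) < r" using r(1) reals_Archimedean by (auto simp: inverse_eq_divide)
          define n where "n = 2 * n0 + 1"
          have "2 * (1 / real (Suc (Suc n))) < 1 / real (Suc n0)"
            by (simp add: n_def field_simps)
          then have n: "2 * (1 / real (Suc (Suc n))) < r" using n0 by linarith
          obtain y where y: "y \<in> C (Suc n)" "g x \<in> mball y (1 / real (Suc (Suc n)))"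
            using C(3)[of "Suc n"] gK[OF xT] by auto
          then obtain m where m: "c m = y" using rc by (metis UN_I UNIV_I image_iff insertCI)
          have lt1: "1 / real (Suc (Suc n)) < 1" by simp
          have "x' \<in> U" if x': "x' \<in> topspace T" "f m x' < 1 / real (Suc (Suc n))" for x'
          proof -
            have "d y (g x') < 1 / real (Suc (Suc n))"
              using x'(2) lt1 unfolding f_def m by (auto simp: min_def split: if_splits)
            moreover have "d (g x) (g x') \<le> d (g x) y + d y (g x')"
              using triangle gK xT x' y(2) by auto
            moreover have "d (g x) y < 1 / real (Suc (Suc n))" using y(2) by (simp add: commute)
            ultimately have "d (g x) (g x') < r" using n by linarith
            then have "g x' \<in> W" using r(2) gK xT x' by auto
            then show ?thesis using WU x' by blast
          qed
          moreover have "f m x < 1 / real (Suc (Suc n))" using y(2) by (simp add: f_def m min_less_iff_disj)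
          ultimately show "x \<in> (\<Union>i\<in>?I. ?B i)"
            using xT L by (intro UN_I[of "(m, n)"]) auto
        qed (use L in auto)
        moreover have "?B i \<in> sets L" for i
        proof -
          obtain m n where i: "i = (m, n)" by (cases i)
          show ?thesis
            unfolding i prod.case by (rule borel_measurable_less[OF fL borel_measurable_const])
        qed
        then have "(\<Union>i\<in>?I. ?B i) \<in> sets L" by (intro sets.countable_UN') auto
        ultimately show ?thesis by simp
      qed
      then have "sigma_sets (space L) {U. openin T U} \<subseteq> sets L"
        by (intro sets.sigma_sets_subset) auto
      then show "sets (borel_of T) \<subseteq> sets L" by (simp add: sets_borel_of L)
    qed
  qed
qed

section \<open>Markov processes with a given transition function\<close>

abbreviation extend_zero :: "('a \<Rightarrow> 'b::zero) \<Rightarrow> 'a option \<Rightarrow> 'b" where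
  "extend_zero \<equiv> case_option 0"

lemma Bb_bound:
  assumes "f \<in> Bb M"
  shows "\<exists>B\<ge>0. \<forall>x\<in>space M. \<bar>f x\<bar> \<le> B"
proof -
  obtain B where "\<forall>x\<in>space M. \<bar>f x\<bar> \<le> B" using assms by (auto simp: Bb_def bounded_real)
  then show ?thesis by (intro exI[of _ "max 0 B"]) (auto simp: le_max_iff_disj)
qed

lemma BbI: "f \<in> borel_measurable M \<Longrightarrow> (\<And>x. x \<in> space M \<Longrightarrow> \<bar>f x\<bar> \<le> B) \<Longrightarrow> f \<in> Bb M"
  by (auto simp: Bb_def bounded_real)

lemma Bb_mult:
  assumes "f \<in> Bb M" "g \<in> Bb M"
  shows "(\<lambda>x. f x * g x) \<in> Bb M"
proof -
  obtain B C where "0 \<le> B" "0 \<le> C" "\<And>x. x \<in> space M \<Longrightarrow> \<bar>f x\<bar> \<le> B" "\<And>x. x \<in> space M \<Longrightarrow> \<bar>g x\<bar> \<le> C"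
    using Bb_bound[OF assms(1)] Bb_bound[OF assms(2)] by blast
  then show ?thesis
    using assms by (intro BbI[of _ _ "B * C"]) (auto simp: Bb_def abs_mult intro!: mult_mono)
qed

context markov_process
begin

lemma space_filt: "0 \<le> t \<Longrightarrow> space (filt X t) = space (base X)"
  using subalgebra_filt by (simp add: subalgebra_def)

lemma space_law: "x \<in> space M \<Longrightarrow> space (law X x) = space (base X)"
  by (intro sets_eq_imp_space_eq sets_law)

lemma measurable_law_iff: "x \<in> space M \<Longrightarrow> law X x \<rightarrow>\<^sub>M N = base X \<rightarrow>\<^sub>M N"
  by (intro measurable_cong_sets sets_law refl)

lemma measurable_filt_mono: "0 \<le> s \<Longrightarrow> s \<le> t \<Longrightarrow> f \<in> filt X s \<rightarrow>\<^sub>M N \<Longrightarrow> f \<in> filt X t \<rightarrow>\<^sub>M N"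
  using filt_mono measurable_from_subalg by blast

lemma measurable_filt_base: "0 \<le> t \<Longrightarrow> f \<in> filt X t \<rightarrow>\<^sub>M N \<Longrightarrow> f \<in> base X \<rightarrow>\<^sub>M N"
  using subalgebra_filt measurable_from_subalg by blast

lemma measurable_path:
  assumes t: "0 \<le> t" and f: "f \<in> M \<rightarrow>\<^sub>M N" and c: "c \<in> space N"
  shows "(\<lambda>\<omega>. case_option c f (path X t \<omega>)) \<in> filt X t \<rightarrow>\<^sub>M N"
proof (rule measurableI)
  fix \<omega> assume "\<omega> \<in> space (filt X t)"
  then have "path X t \<omega> \<in> insert None (Some ` space M)" using t path_in by (simp add: space_filt)
  then show "case_option c f (path X t \<omega>) \<in> space N"
    using c measurable_space[OF f] by auto
next
  fix A assume A: "A \<in> sets N"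
  have ad: "{\<omega> \<in> space (filt X t). path X t \<omega> \<in> Some ` B} \<in> sets (filt X t)" if "B \<in> sets M" for B
    using adapted[OF t that] t by (simp add: space_filt)
  let ?B = "f -` A \<inter> space M"
  have "?B \<in> sets M" using f A by (rule measurable_sets)
  note B = ad[OF this] ad[OF sets.top]
  have pin: "\<omega> \<in> space (filt X t) \<Longrightarrow> path X t \<omega> = Some y \<Longrightarrow> y \<in> space M" for \<omega> y
    using path_in[OF t, of \<omega>] t by (auto simp: space_filt)
  have "(\<lambda>\<omega>. case_option c f (path X t \<omega>)) -` A \<inter> space (filt X t) =
      {\<omega> \<in> space (filt X t). path X t \<omega> \<in> Some ` ?B} \<union>
      (if c \<in> A then space (filt X t) - {\<omega> \<in> space (filt X t). path X t \<omega> \<in> Some ` space M} else {})"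
    using pin by (auto split: option.splits if_splits simp: inj_image_mem_iff)
  also have "\<dots> \<in> sets (filt X t)" using B by auto
  finally show "(\<lambda>\<omega>. case_option c f (path X t \<omega>)) -` A \<inter> space (filt X t) \<in> sets (filt X t)" .
qed

lemma measurable_path_base:
  assumes "0 \<le> t" "f \<in> M \<rightarrow>\<^sub>M N" "c \<in> space N"
  shows "(\<lambda>\<omega>. case_option c f (path X t \<omega>)) \<in> base X \<rightarrow>\<^sub>M N"
  by (rule measurable_filt_base[OF assms(1) measurable_path[OF assms]])

lemma path_cases:
  assumes "0 \<le> t" "\<omega> \<in> space (base X)"
  obtains "path X t \<omega> = None" | y where "y \<in> space M" "path X t \<omega> = Some y"
  using path_in[OF assms] by auto

lemma extend_zero_path_bound:
  fixes f :: "'a \<Rightarrow> real"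
  assumes "0 \<le> t" "\<omega> \<in> space (base X)" "0 \<le> B" "\<And>x. x \<in> space M \<Longrightarrow> \<bar>f x\<bar> \<le> B"
  shows "\<bar>extend_zero f (path X t \<omega>)\<bar> \<le> B"
  using path_cases[OF assms(1,2)] assms(3,4) by cases auto

end

locale markov_process_with_kernel = markov_process M X + semigroup_of_kernels M P
  for M :: "'a measure" and X :: "('w, 'a) process" and P :: "real \<Rightarrow> 'a \<Rightarrow> 'a measure" +
  assumes transition: "transition_function M X P"
begin

lemma process_semigroup_eq:
  "0 \<le> t \<Longrightarrow> x \<in> space M \<Longrightarrow> u \<in> borel_measurable M \<Longrightarrow>
    process_semigroup X t u x = (\<integral>\<^sup>+y. u y \<partial>P t x)"
  using transition by (simp add: transition_function_def)

lemma kernel_integral_Bb: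
  assumes t: "0 \<le> t" and f: "f \<in> Bb M"
  shows "(\<lambda>x. \<integral>y. f y \<partial>P t x) \<in> Bb M"
proof -
  obtain B where B: "0 \<le> B" "\<And>x. x \<in> space M \<Longrightarrow> \<bar>f x\<bar> \<le> B" using Bb_bound[OF f] by blast
  have fm: "f \<in> borel_measurable M" using f by (simp add: Bb_def)
  show ?thesis
  proof (rule BbI)
    show "(\<lambda>x. \<integral>y. f y \<partial>P t x) \<in> borel_measurable M"
      by (rule measurable_compose[OF kernel[OF t] integral_measurable_subprob_algebra[OF fm]])
    fix x assume x: "x \<in> space M"
    interpret subprob_space "P t x" using t x by (rule subprob_kernel)
    have fP: "f \<in> borel_measurable (P t x)"
      using t x fm by (rule measurable_kernel)
    then have fi: "integrable (P t x) f"
      using B space_kernel[OF t x] by (intro integrable_const_bound[of _ B]) auto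
    have "\<bar>\<integral>y. f y \<partial>P t x\<bar> \<le> (\<integral>y. \<bar>f y\<bar> \<partial>P t x)" by (rule integral_abs_bound)
    also have "\<dots> \<le> (\<integral>y. B \<partial>P t x)"
      using fi B space_kernel[OF t x] by (intro integral_mono) auto
    also have "\<dots> \<le> B * 1" using B subprob_measure_le_1 by (simp add: mult_left_le mult.commute)
    finally show "\<bar>\<integral>y. f y \<partial>P t x\<bar> \<le> B" by simp
  qed
qed

lemma integrable_path:
  assumes t: "0 \<le> t" and x: "x \<in> space M" and f: "f \<in> Bb M"
  shows "integrable (law X x) (\<lambda>\<omega>. extend_zero f (path X t \<omega>))"
proof -
  interpret prob_space "law X x" using x by (rule prob_space_law)
  obtain B where B: "0 \<le> B" "\<And>x. x \<in> space M \<Longrightarrow> \<bar>f x\<bar> \<le> B" using Bb_bound[OF f] by blast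
  have "(\<lambda>\<omega>. extend_zero f (path X t \<omega>)) \<in> borel_measurable (law X x)"
    using f measurable_path_base[OF t, of f borel 0] by (simp add: measurable_law_iff[OF x] Bb_def)
  then show ?thesis
    using extend_zero_path_bound[OF t _ B] space_law[OF x] by (intro integrable_const_bound[of _ B]) auto
qed

lemma integral_path:
  assumes t: "0 \<le> t" and x: "x \<in> space M" and f: "f \<in> Bb M"
  shows "(\<integral>\<omega>. extend_zero f (path X t \<omega>) \<partial>law X x) = (\<integral>y. f y \<partial>P t x)"
proof -
  interpret prob_space "law X x" using x by (rule prob_space_law)
  interpret P: subprob_space "P t x" using t x by (rule subprob_kernel)
  obtain B where B: "0 \<le> B" "\<And>x. x \<in> space M \<Longrightarrow> \<bar>f x\<bar> \<le> B" using Bb_bound[OF f] by blast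
  have fm [measurable]: "f \<in> borel_measurable M" using f by (simp add: Bb_def)
  have fP: "f \<in> borel_measurable (P t x)"
    using t x fm by (rule measurable_kernel)
  have fi: "integrable (P t x) f"
    using fP B space_kernel[OF t x] by (intro P.integrable_const_bound[of _ B]) auto
  have *: "(\<integral>\<^sup>+\<omega>. ennreal (extend_zero g (path X t \<omega>)) \<partial>law X x) = (\<integral>\<^sup>+y. ennreal (g y) \<partial>P t x)"
    if "g \<in> borel_measurable M" for g :: "'a \<Rightarrow> real"
  proof -
    have "(\<integral>\<^sup>+\<omega>. ennreal (extend_zero g (path X t \<omega>)) \<partial>law X x) =
        process_semigroup X t (\<lambda>y. ennreal (g y)) x"
      unfolding process_semigroup_def by (intro nn_integral_cong) (simp split: option.split)
    then show ?thesis using process_semigroup_eq[OF t x, of "\<lambda>y. ennreal (g y)"] that by simp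
  qed
  have neg: "- extend_zero f z = extend_zero (\<lambda>y. - f y) z" for z by (simp split: option.split)
  show ?thesis
    unfolding real_lebesgue_integral_def[OF fi] real_lebesgue_integral_def[OF integrable_path[OF t x f]]
    by (simp add: neg *)
qed

text \<open>
  The Markov property, which conditions on \<open>\<F>\<^sub>t\<close>, tested against a bounded \<open>\<F>\<^sub>t\<close>-measurable factor.
\<close>
lemma markov_step:
  assumes x: "x \<in> space M" and t: "0 \<le> t" and s: "0 \<le> s" and f: "f \<in> Bb M"
    and Z: "Z \<in> borel_measurable (filt X t)" "\<And>\<omega>. \<omega> \<in> space (base X) \<Longrightarrow> \<bar>Z \<omega>\<bar> \<le> B"
  shows "(\<integral>\<omega>. Z \<omega> * extend_zero f (path X (t + s) \<omega>) \<partial>law X x) =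
    (\<integral>\<omega>. Z \<omega> * extend_zero (\<lambda>y. \<integral>z. f z \<partial>P s y) (path X t \<omega>) \<partial>law X x)"
proof -
  interpret prob_space "law X x" using x by (rule prob_space_law)
  interpret finite_measure_subalgebra "law X x" "filt X t"
    using subalgebra_filt[OF t] sets_law[OF x] space_law[OF x]
    by unfold_locales (auto simp: subalgebra_def)
  let ?f = "\<lambda>\<omega>. extend_zero f (path X (t + s) \<omega>)"
  let ?g = "\<lambda>\<omega>. extend_zero (\<lambda>y. \<integral>z. f z \<partial>P s y) (path X t \<omega>)"
  have Zm: "Z \<in> borel_measurable (law X x)"
    using measurable_filt_base[OF t Z(1)] by (simp add: measurable_law_iff[OF x])
  have fint: "integrable (law X x) ?f" using t s x f by (intro integrable_path) auto
  obtain C where C: "0 \<le> C" "\<And>x. x \<in> space M \<Longrightarrow> \<bar>f x\<bar> \<le> C" using Bb_bound[OF f] by blast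
  have "integrable (law X x) (\<lambda>\<omega>. Z \<omega> * ?f \<omega>)"
  proof (rule integrable_const_bound[of _ "B * C"])
    show "AE \<omega> in law X x. norm (Z \<omega> * ?f \<omega>) \<le> B * C"
      using AE_space
    proof eventually_elim
      case (elim \<omega>)
      then have "\<bar>Z \<omega>\<bar> \<le> B" "\<bar>?f \<omega>\<bar> \<le> C"
        using t s C by (auto intro!: Z(2) extend_zero_path_bound simp: space_law[OF x])
      then show ?case unfolding real_norm_def abs_mult by (intro mult_mono) auto
    qed
  qed (use Zm fint in auto)
  then have "(\<integral>\<omega>. Z \<omega> * real_cond_exp (law X x) (filt X t) ?f \<omega> \<partial>law X x) = (\<integral>\<omega>. Z \<omega> * ?f \<omega> \<partial>law X x)"
    using Z(1) fint by (intro real_cond_exp_intg) auto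
  moreover have "(\<integral>\<omega>. Z \<omega> * real_cond_exp (law X x) (filt X t) ?f \<omega> \<partial>law X x) = (\<integral>\<omega>. Z \<omega> * ?g \<omega> \<partial>law X x)"
  proof (rule integral_cong_AE)
    have "?g \<in> borel_measurable (base X)"
      using kernel_integral_Bb[OF s f] t by (intro measurable_path_base) (auto simp: Bb_def)
    then show "(\<lambda>\<omega>. Z \<omega> * ?g \<omega>) \<in> borel_measurable (law X x)"
      using Zm by (auto simp: measurable_law_iff[OF x])
    show "(\<lambda>\<omega>. Z \<omega> * real_cond_exp (law X x) (filt X t) ?f \<omega>) \<in> borel_measurable (law X x)"
      using Zm by simp
    show "AE \<omega> in law X x. Z \<omega> * real_cond_exp (law X x) (filt X t) ?f \<omega> = Z \<omega> * ?g \<omega>"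
      using markov[OF x s t f] AE_space
    proof eventually_elim
      case (elim \<omega>)
      then have \<omega>: "\<omega> \<in> space (base X)" by (simp add: space_law[OF x])
      have "extend_zero (\<lambda>y. \<integral>\<omega>'. extend_zero f (path X s \<omega>') \<partial>law X y) (path X t \<omega>) = ?g \<omega>"
        using path_cases[OF t \<omega>] by cases (auto simp: integral_path[OF s _ f])
      with elim show ?case by simp
    qed
  qed
  ultimately show ?thesis by simp
qed

text \<open>
  The finite-dimensional distributions are reduced by integrating out the last time \<open>b\<close>: the kernel for the
  remaining time \<open>b - Max J\<close> is absorbed into the function at the preceding time \<open>Max J\<close>.
\<close>
lemma integral_prod_path_step:
  assumes x: "x \<in> space M" and s: "0 \<le> s" and J: "finite J" "J \<noteq> {}" "J \<subseteq> {0..}" "Max J < b"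
    and f: "\<And>j. f j \<in> Bb M"
  defines "m \<equiv> Max J"
  defines "f' \<equiv> f(m := \<lambda>y. f m y * (\<integral>z. f b z \<partial>P (b - m) y))"
  shows "(\<integral>\<omega>. (\<Prod>j\<in>insert b J. extend_zero (f j) (path X (s + j) \<omega>)) \<partial>law X x) =
    (\<integral>\<omega>. (\<Prod>j\<in>J. extend_zero (f' j) (path X (s + j) \<omega>)) \<partial>law X x)" and "\<And>j. f' j \<in> Bb M"
proof -
  have m: "m \<in> J" using J(1,2) by (simp add: m_def)
  have "0 \<le> m" using m J(3) by auto
  moreover have "m < b" using J(4) by (simp add: m_def)
  moreover have "j \<in> J \<Longrightarrow> j \<le> m" for j using J(1) by (simp add: m_def)
  ultimately have m: "m \<in> J" "0 \<le> m" "m < b" "\<And>j. j \<in> J \<Longrightarrow> j \<le> m" using m by auto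
  have b: "b \<notin> J" using m(3) m(4)[of b] by linarith
  show "f' j \<in> Bb M" for j
    using f kernel_integral_Bb[of "b - m" "f b"] m by (auto simp: f'_def intro!: Bb_mult)
  let ?Z = "\<lambda>\<omega>. \<Prod>j\<in>J. extend_zero (f j) (path X (s + j) \<omega>)"
  obtain B where B: "\<And>j. 0 \<le> B j" "\<And>j x. x \<in> space M \<Longrightarrow> \<bar>f j x\<bar> \<le> B j"
    using Bb_bound[OF f] by metis
  have "(\<integral>\<omega>. (\<Prod>j\<in>insert b J. extend_zero (f j) (path X (s + j) \<omega>)) \<partial>law X x) =
      (\<integral>\<omega>. ?Z \<omega> * extend_zero (f b) (path X ((s + m) + (b - m)) \<omega>) \<partial>law X x)"
    using J b by (simp add: mult.commute)
  also have "\<dots> = (\<integral>\<omega>. ?Z \<omega> * extend_zero (\<lambda>y. \<integral>z. f b z \<partial>P (b - m) y) (path X (s + m) \<omega>) \<partial>law X x)"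
  proof (rule markov_step[OF x])
    show "?Z \<in> borel_measurable (filt X (s + m))"
    proof (rule borel_measurable_prod)
      fix j assume j: "j \<in> J"
      show "(\<lambda>\<omega>. extend_zero (f j) (path X (s + j) \<omega>)) \<in> borel_measurable (filt X (s + m))"
        using j s J m f by (intro measurable_filt_mono[OF _ _ measurable_path]) (auto simp: Bb_def)
    qed
    show "\<bar>?Z \<omega>\<bar> \<le> (\<Prod>j\<in>J. B j)" if "\<omega> \<in> space (base X)" for \<omega>
      unfolding abs_prod using that s J B by (intro prod_mono) (auto intro!: extend_zero_path_bound)
  qed (use s m f in auto)
  also have "\<dots> = (\<integral>\<omega>. (\<Prod>j\<in>J. extend_zero (f' j) (path X (s + j) \<omega>)) \<partial>law X x)"
  proof (rule Bochner_Integration.integral_cong[OF refl])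
    fix \<omega>
    have 1: "extend_zero (f' m) z = extend_zero (f m) z * extend_zero (\<lambda>y. \<integral>z. f b z \<partial>P (b - m) y) z" for z
      by (simp add: f'_def m_def split: option.split)
    have 2: "(\<Prod>j\<in>J - {m}. extend_zero (f' j) (path X (s + j) \<omega>)) = (\<Prod>j\<in>J - {m}. extend_zero (f j) (path X (s + j) \<omega>))"
    proof (intro prod.cong refl)
      fix j assume "j \<in> J - {m}"
      then have "f' j = f j" by (simp add: f'_def m_def)
      then show "extend_zero (f' j) (path X (s + j) \<omega>) = extend_zero (f j) (path X (s + j) \<omega>)" by (rule arg_cong)
    qed
    show "?Z \<omega> * extend_zero (\<lambda>y. \<integral>z. f b z \<partial>P (b - m) y) (path X (s + m) \<omega>) =
        (\<Prod>j\<in>J. extend_zero (f' j) (path X (s + j) \<omega>))"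
      using J m by (simp add: prod.remove[of J m] 1 2)
  qed
  finally show "(\<integral>\<omega>. (\<Prod>j\<in>insert b J. extend_zero (f j) (path X (s + j) \<omega>)) \<partial>law X x) =
    (\<integral>\<omega>. (\<Prod>j\<in>J. extend_zero (f' j) (path X (s + j) \<omega>)) \<partial>law X x)" .
qed

text \<open>The cemetery is absorbing, so it is enough to consider integer times.\<close>
lemma AE_alive:
  assumes x: "x \<in> space M" and mass: "\<And>t. 0 \<le> t \<Longrightarrow> emeasure (P t x) (space M) = 1"
  shows "AE \<omega> in law X x. \<forall>t\<ge>0. path X t \<omega> \<noteq> None"
proof -
  interpret prob_space "law X x" using x by (rule prob_space_law)
  have "AE \<omega> in law X x. path X (real n) \<omega> \<noteq> None" for n
  proof -
    let ?A = "{\<omega> \<in> space (law X x). path X (real n) \<omega> \<in> Some ` space M}"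
    have "?A \<in> sets (filt X (real n))" using adapted[of "real n" "space M"] by (simp add: space_law[OF x])
    then have A: "?A \<in> sets (law X x)"
      using subalgebra_filt[of "real n"] sets_law[OF x] by (auto simp: subalgebra_def)
    have "emeasure (law X x) ?A = process_semigroup X (real n) (\<lambda>_. 1) x"
      unfolding process_semigroup_def nn_integral_indicator[OF A, symmetric]
      using path_in[of "real n"] by (intro nn_integral_cong) (auto split: option.splits split_indicator simp: space_law[OF x])
    also have "\<dots> = 1"
      using mass[of "real n"] x by (simp add: process_semigroup_eq space_kernel)
    finally have "prob ?A = 1" by (simp add: measure_def)
    then have "AE \<omega> in law X x. \<omega> \<in> ?A" using A by (simp add: prob_eq_1)
    then show ?thesis by eventually_elim auto
  qed
  then have "AE \<omega> in law X x. \<forall>n. path X (real n) \<omega> \<noteq> None" by (simp add: AE_all_countable)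
  then show ?thesis using AE_space
  proof eventually_elim
    case (elim \<omega>)
    show ?case
    proof (intro allI impI notI)
      fix t :: real assume t: "0 \<le> t"
      assume None: "path X t \<omega> = None"
      obtain n where "t \<le> real n" using real_arch_simple by blast
      with t have "path X (real n) \<omega> = None"
        using elim(2) None unfolding space_law[OF x] by (rule absorbed)
      with elim(1) show False by blast
    qed
  qed
qed

end

lemma continuous_map_extend_zero:
  assumes "continuous_map T euclideanreal f"
  shows "continuous_map (cemetery_topology T) euclideanreal (extend_zero f)"
proof -
  have ts: "topspace (cemetery_topology T) = insert None (Some ` topspace T)"
  proof -
    have "openin (cemetery_topology T) (insert None (Some ` topspace T))"
      by (simp add: openin_cemetery_topology vimage_def inj_image_mem_iff)
    moreover have "U \<subseteq> insert None (Some ` topspace T)" if "openin (cemetery_topology T) U" for U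
    proof
      fix z assume "z \<in> U"
      then show "z \<in> insert None (Some ` topspace T)"
        using openin_subset[of T "Some -` U"] that by (cases z) (auto simp: openin_cemetery_topology)
    qed
    ultimately show ?thesis by (meson openin_subset openin_topspace subset_antisym)
  qed
  show ?thesis
    unfolding continuous_map_def
  proof (intro conjI allI impI)
    fix U :: "real set" assume "openin euclideanreal U"
    then have "openin T {x \<in> topspace T. f x \<in> U}"
      using assms by (simp add: openin_continuous_map_preimage)
    also have "{x \<in> topspace T. f x \<in> U} = Some -` {z \<in> topspace (cemetery_topology T). extend_zero f z \<in> U}"
      by (auto simp: ts)
    finally show "openin (cemetery_topology T) {z \<in> topspace (cemetery_topology T). extend_zero f z \<in> U}"
      by (simp add: openin_cemetery_topology)
  qed simp
qed

text \<open>Dominated convergence along the right-continuous paths.\<close>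
lemma right_continuous_semigroup:
  assumes X: "right_markov_process_wrt T M X" and P: "kernel_semigroup M P" "transition_function M X P"
    and f: "f \<in> Cb T" and x: "x \<in> space M" and t: "0 \<le> t"
  shows "((\<lambda>s. \<integral>y. f y \<partial>P s x) \<longlongrightarrow> (\<integral>y. f y \<partial>P t x)) (at_right t)"
proof -
  interpret right_markov_process_core M X using X by (simp add: right_markov_process_wrt_def)
  interpret markov_process_with_kernel M X P by unfold_locales fact+
  interpret prob_space "law X x" using x by (rule prob_space_law)
  have T: "sets (borel_of T) = sets M" using X by (simp add: right_markov_process_wrt_def lusin_topology_of_def)
  have fB: "f \<in> Bb M" using f Cb_subset_Bb[of T] Bb_cong[OF T] by auto
  obtain B where B: "0 \<le> B" "\<And>x. x \<in> space M \<Longrightarrow> \<bar>f x\<bar> \<le> B" using Bb_bound[OF fB] by blast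
  have fc: "continuous_map (cemetery_topology T) euclideanreal (extend_zero f)"
    using f by (intro continuous_map_extend_zero) (simp add: Cb_def)
  have AE: "AE \<omega> in law X x. right_continuous_path T (\<lambda>t. path X t \<omega>)"
    using X x by (simp add: right_markov_process_wrt_def)
  let ?F = "\<lambda>s \<omega>. extend_zero f (path X s \<omega>)"
  have m: "?F s \<in> borel_measurable (law X x)" if "0 \<le> s" for s
    using fB that measurable_path_base[of s f borel 0] by (simp add: measurable_law_iff[OF x] Bb_def)
  have "((\<lambda>s. \<integral>\<omega>. ?F s \<omega> \<partial>law X x) \<longlongrightarrow> (\<integral>\<omega>. ?F t \<omega> \<partial>law X x)) (at_right t)"
  proof (rule tendsto_at_right_sequentially)
    show "t < t + 1" by simp
    fix S :: "nat \<Rightarrow> real" assume S: "\<And>n. t < S n" "S \<longlonglongrightarrow> t"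
    have S0: "0 \<le> S n" for n using S(1)[of n] t by simp
    have Sr: "filterlim S (at_right t) sequentially"
      using S by (intro tendsto_imp_filterlim_at_right) (auto intro: always_eventually)
    show "(\<lambda>n. \<integral>\<omega>. ?F (S n) \<omega> \<partial>law X x) \<longlonglongrightarrow> (\<integral>\<omega>. ?F t \<omega> \<partial>law X x)"
    proof (rule integral_dominated_convergence[where w = "\<lambda>_. B"])
      show "AE \<omega> in law X x. (\<lambda>n. ?F (S n) \<omega>) \<longlonglongrightarrow> ?F t \<omega>"
        using AE
      proof eventually_elim
        case (elim \<omega>)
        then have "limitin (cemetery_topology T) (\<lambda>s. path X s \<omega>) (path X t \<omega>) (at_right t)"
          using t by (simp add: right_continuous_path_def)
        from continuous_map_limit[OF fc this]
        have "((\<lambda>s. ?F s \<omega>) \<longlongrightarrow> ?F t \<omega>) (at_right t)" by (simp add: comp_def)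
        then show ?case using Sr by (rule filterlim_compose)
      qed
      show "AE \<omega> in law X x. norm (?F (S n) \<omega>) \<le> B" for n
        using AE_space by eventually_elim (use extend_zero_path_bound[OF S0 _ B] space_law[OF x] in auto)
    qed (use m S0 t in auto)
  qed
  moreover have "\<forall>\<^sub>F s in at_right t. (\<integral>\<omega>. ?F s \<omega> \<partial>law X x) = (\<integral>y. f y \<partial>P s x)"
    unfolding eventually_at_right_field using t integral_path[OF _ x fB] by (intro exI[of _ "t + 1"]) auto
  ultimately have "((\<lambda>s. \<integral>y. f y \<partial>P s x) \<longlongrightarrow> (\<integral>\<omega>. ?F t \<omega> \<partial>law X x)) (at_right t)"
    by (rule Lim_transform_eventually)
  then show ?thesis using integral_path[OF t x fB] by simp
qed

text \<open>
  The bound \<open>\<beta>\<close> on the rate depends on the process only.  Hence two processes have common admissible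
  rates \<open>\<alpha>\<close>.
\<close>
lemma AE_right_continuous_potential_tail:
  assumes X: "right_markov_process_core M X" and P: "kernel_semigroup M P" "transition_function M X P"
  obtains \<beta> where "0 < \<beta>" "\<And>f \<alpha> \<epsilon> x. kernel_potential M P f \<alpha> \<Longrightarrow> \<alpha> \<le> \<beta> \<Longrightarrow> 0 \<le> \<epsilon> \<Longrightarrow> x \<in> space M \<Longrightarrow>
    AE \<omega> in law X x. \<forall>t\<ge>0. ((\<lambda>s. extend_zero (potential_tail P f \<alpha> \<epsilon>) (path X s \<omega>)) \<longlongrightarrow>
      extend_zero (potential_tail P f \<alpha> \<epsilon>) (path X t \<omega>)) (at_right t)"
proof -
  interpret right_markov_process_core M X by fact
  interpret markov_process_with_kernel M X P by unfold_locales fact+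
  obtain \<beta> where \<beta>: "0 < \<beta>" "\<And>u x. excessive M (process_semigroup X) \<beta> u \<Longrightarrow> x \<in> space M \<Longrightarrow> AE \<omega> in law X x.
        \<forall>t\<ge>0. ((\<lambda>s. extend_zero u (path X s \<omega>)) \<longlongrightarrow> extend_zero u (path X t \<omega>)) (at_right t)"
    using excessive_right_continuous by blast
  show thesis
  proof (rule that[OF \<beta>(1)])
    fix f :: "'a \<Rightarrow> real" and \<alpha> \<epsilon> :: real and x
    assume kp: "kernel_potential M P f \<alpha>" and "\<alpha> \<le> \<beta>" "0 \<le> \<epsilon>" and x: "x \<in> space M"
    then show "AE \<omega> in law X x. \<forall>t\<ge>0. ((\<lambda>s. extend_zero (potential_tail P f \<alpha> \<epsilon>) (path X s \<omega>)) \<longlongrightarrow>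
      extend_zero (potential_tail P f \<alpha> \<epsilon>) (path X t \<omega>)) (at_right t)"
      by (intro \<beta>(2) kernel_potential.excessive_potential_tail[OF kp] process_semigroup_eq)
  qed
qed

section \<open>Comparison of two processes with the same transition function\<close>

text \<open>
  The point \<open>d\<close> stands in for the cemetery, so that coordinates take values in the state space.
\<close>
definition coord :: "('w, 'a) process \<Rightarrow> 'a \<Rightarrow> real \<Rightarrow> 'w \<Rightarrow> 'a" where
  "coord X d t \<omega> = case_option d (\<lambda>y. y) (path X t \<omega>)"

abbreviation rational_times :: "real set" where
  "rational_times \<equiv> {t \<in> \<rat>. 0 \<le> t}"

text \<open>
  Countably many times make the path a random element of a product space whose law is determined by
  its finite-dimensional distributions.
\<close>
definition path_map :: "('w, 'a) process \<Rightarrow> 'a \<Rightarrow> real \<Rightarrow> 'w \<Rightarrow> real \<Rightarrow> 'a" where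
  "path_map X d s \<omega> = (\<lambda>t\<in>rational_times. coord X d (s + t) \<omega>)"

lemma Bb_indicator: "A \<in> sets M \<Longrightarrow> indicator A \<in> Bb M"
  by (rule BbI[of _ _ 1]) (auto split: split_indicator)

lemma (in markov_process) measurable_coord:
  assumes "0 \<le> t" "d \<in> space N" "(\<lambda>y. y) \<in> M \<rightarrow>\<^sub>M N"
  shows "coord X d t \<in> base X \<rightarrow>\<^sub>M N"
  using measurable_path_base[OF assms(1,3,2)] by (simp add: coord_def[abs_def])

lemma (in markov_process) measurable_path_map:
  assumes "0 \<le> s" "d \<in> space N" "(\<lambda>y. y) \<in> M \<rightarrow>\<^sub>M N"
  shows "path_map X d s \<in> base X \<rightarrow>\<^sub>M Pi\<^sub>M rational_times (\<lambda>_. N)"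
  unfolding path_map_def[abs_def] using assms by (intro measurable_restrict measurable_coord) auto

lemma (in markov_process_with_kernel) emeasure_cylinder:
  assumes x: "x \<in> space M" and alive: "AE \<omega> in law X x. \<forall>t\<ge>0. path X t \<omega> \<noteq> None"
    and s: "0 \<le> s" and J: "finite J" "J \<noteq> {}" "J \<subseteq> {0..}" and A: "\<And>j. A j \<in> sets M"
    and d: "d \<in> space M"
  shows "emeasure (law X x) {\<omega> \<in> space (base X). \<forall>j\<in>J. coord X d (s + j) \<omega> \<in> A j} =
    ennreal (\<integral>\<omega>. (\<Prod>j\<in>J. extend_zero (indicator (A j)) (path X (s + j) \<omega>)) \<partial>law X x)"
proof -
  interpret prob_space "law X x" using x by (rule prob_space_law)
  let ?E = "{\<omega> \<in> space (base X). \<forall>j\<in>J. coord X d (s + j) \<omega> \<in> A j}"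
  have c: "coord X d (s + j) \<in> base X \<rightarrow>\<^sub>M M" if "j \<in> J" for j
    using that s J d by (intro measurable_coord) auto
  have "{\<omega> \<in> space (base X). coord X d (s + j) \<omega> \<in> A j} \<in> sets (base X)" if "j \<in> J" for j
    using measurable_sets[OF c[OF that] A[of j]] by (simp add: vimage_def Int_def conj_commute)
  then have "?E \<in> sets (base X)"
    using J by (intro sets.sets_Collect_finite_All') auto
  then have E: "?E \<in> sets (law X x)" by (simp add: sets_law[OF x])
  let ?p = "\<lambda>\<omega>. \<Prod>j\<in>J. extend_zero (indicator (A j)) (path X (s + j) \<omega>) :: real"
  have pm: "?p \<in> borel_measurable (law X x)"
    unfolding measurable_law_iff[OF x]
  proof (rule borel_measurable_prod)
    fix j assume "j \<in> J"
    then show "(\<lambda>\<omega>. extend_zero (indicator (A j)) (path X (s + j) \<omega>) :: real) \<in> borel_measurable (base X)"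
      using s J A by (intro measurable_path_base) auto
  qed
  have "emeasure (law X x) ?E = ennreal (\<integral>\<omega>. indicator ?E \<omega> \<partial>law X x)"
    using E by (simp add: emeasure_eq_measure)
  also have "(\<integral>\<omega>. indicator ?E \<omega> \<partial>law X x) = (\<integral>\<omega>. ?p \<omega> \<partial>law X x)"
  proof (rule integral_cong_AE)
    show "AE \<omega> in law X x. indicator ?E \<omega> = ?p \<omega>"
      using alive AE_space
    proof eventually_elim
      case (elim \<omega>)
      then have \<omega>: "\<omega> \<in> space (base X)" by (simp add: space_law[OF x])
      have e: "extend_zero (indicator (A j)) (path X (s + j) \<omega>) = (indicator (A j) (coord X d (s + j) \<omega>) :: real)"
        if "j \<in> J" for j
        using elim(1)[rule_format, of "s + j"] that s J by (auto simp: coord_def split: option.split)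
      have "?p \<omega> = (\<Prod>j\<in>J. indicator (A j) (coord X d (s + j) \<omega>))"
        using e by (intro prod.cong) auto
      also have "\<dots> = indicator ?E \<omega>"
      proof (cases "\<forall>j\<in>J. coord X d (s + j) \<omega> \<in> A j")
        case True
        then show ?thesis using \<omega> by (simp add: prod.neutral)
      next
        case False
        then obtain j where "j \<in> J" "coord X d (s + j) \<omega> \<notin> A j" by blast
        then have "(\<Prod>j\<in>J. indicator (A j) (coord X d (s + j) \<omega>)) = (0 :: real)"
          using J by (intro prod_zero) (auto intro!: bexI[of _ j])
        with False show ?thesis by simp
      qed
      finally show ?case by simp
    qed
  qed (use E pm in auto)
  finally show ?thesis .
qed

locale process_comparison =
  negligible_restriction M P N F +
  X: markov_process_with_kernel M X P +
  Y: markov_process_with_kernel "restrict_space M F" Y "restrict_semigroup P F"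
  for M :: "'a measure" and P N F and X :: "('v, 'a) process" and Y :: "('w, 'a) process" +
  assumes mass: "\<And>t x. 0 \<le> t \<Longrightarrow> x \<in> space M \<Longrightarrow> emeasure (P t x) (space M) = 1"
begin

lemma Bb_restrict: "f \<in> Bb M \<Longrightarrow> f \<in> Bb (restrict_space M F)"
  unfolding Bb_def using bounded_subset[OF _ image_mono[OF F_subset], of f]
  by (auto intro!: measurable_restrict_space1)

lemma alive_X: "x \<in> space M \<Longrightarrow> AE \<omega> in law X x. \<forall>t\<ge>0. path X t \<omega> \<noteq> None"
  by (intro X.AE_alive mass)

lemma alive_Y:
  assumes y: "y \<in> F"
  shows "AE \<omega> in law Y y. \<forall>t\<ge>0. path Y t \<omega> \<noteq> None"
proof (rule Y.AE_alive)
  have yM: "y \<in> space M" using y F_subset by auto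
  fix t :: real assume t: "0 \<le> t"
  have "emeasure (Q t y) (space (restrict_space M F)) = emeasure (P t y) F"
    using t y by (simp add: emeasure_restrict_semigroup)
  also have "\<dots> = emeasure (P t y) (space M)"
    using AE_kernel_F[OF t y] F_sets sets_kernel[OF t yM] space_kernel[OF t yM]
    by (intro emeasure_eq_AE) (auto elim: eventually_mono)
  finally show "emeasure (Q t y) (space (restrict_space M F)) = 1" using mass[OF t yM] by simp
qed (use y in simp)

context
  fixes x0 :: 'a and s :: real
  assumes x0: "x0 \<in> space M" and s: "0 < s"
begin

abbreviation "\<mu> \<equiv> completion (Q s x0)"

lemma AE_F: "AE y in P s x0. y \<in> F"
  using s x0 by (rule AE_kernel_F_pos)

lemma prob_\<mu>: "Q s x0 \<in> prob_measures (restrict_space M F)"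
proof -
  have sP: "sets (P s x0) = sets M" "space (P s x0) = space M" using sets_kernel space_kernel s x0 by auto
  then have "emeasure (Q s x0) F = emeasure (P s x0) F"
    unfolding restrict_semigroup_def using F_sets by (intro emeasure_restrict_space) auto
  also have "\<dots> = emeasure (P s x0) (space M)"
    using AE_F F_sets sP by (intro emeasure_eq_AE) (auto elim: eventually_mono)
  finally have "emeasure (Q s x0) F = 1" using mass s x0 by simp
  moreover have "sets (Q s x0) = sets (restrict_space M F)"
    unfolding restrict_semigroup_def using sP by (intro sets_restrict_space_cong)
  ultimately show ?thesis
    unfolding prob_measures_def using sets_eq_imp_space_eq[of "Q s x0" "restrict_space M F"]
    by (auto intro!: prob_spaceI)
qed

lemma space_\<mu>: "space (Q s x0) = F"
  using prob_\<mu> sets_eq_imp_space_eq[of "Q s x0" "restrict_space M F"] by (simp add: prob_measures_def)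

lemma law_Y_measurable: "law Y \<in> \<mu> \<rightarrow>\<^sub>M subprob_algebra (base Y)"
proof (rule measurable_subprob_algebra)
  fix y assume "y \<in> space \<mu>"
  then have y: "y \<in> space (restrict_space M F)" by (simp add: space_\<mu>)
  show "subprob_space (law Y y)" using Y.prob_space_law[OF y] by (rule prob_space_imp_subprob_space)
  show "sets (law Y y) = sets (base Y)" using y by (rule Y.sets_law)
next
  fix A assume "A \<in> sets (base Y)"
  then show "(\<lambda>y. emeasure (law Y y) A) \<in> borel_measurable \<mu>"
    using prob_\<mu> by (rule Y.universally_measurable_law)
qed

text \<open>
  Induction on the largest time: by \<open>integral_prod_path_step\<close> it is integrated out on both sides, and
  this changes the function at the preceding time in the same way for \<open>X\<close> and \<open>Y\<close>, because their kernels
  agree on \<open>F\<close>.  Time \<open>0\<close> is always present, and there both sides are the integral of \<open>f 0\<close> with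
  respect to the distribution of \<open>X\<close> at time \<open>s\<close>.
\<close>
lemma finite_dimensional_distributions:
  assumes "finite J" "J \<subseteq> {0<..}" "\<And>j. f j \<in> Bb M"
  shows "(\<integral>\<omega>. (\<Prod>j\<in>insert 0 J. extend_zero (f j) (path X (s + j) \<omega>)) \<partial>law X x0) =
    (\<integral>y. (\<integral>\<omega>. (\<Prod>j\<in>insert 0 J. extend_zero (f j) (path Y j \<omega>)) \<partial>law Y y) \<partial>\<mu>)"
  using assms
proof (induction J arbitrary: f rule: finite_linorder_max_induct)
  case empty
  have fM: "f 0 \<in> borel_measurable M" using empty by (simp add: Bb_def)
  have "(\<integral>\<omega>. extend_zero (f 0) (path X s \<omega>) \<partial>law X x0) = (\<integral>y. f 0 y \<partial>P s x0)"
    using s x0 empty by (intro X.integral_path) auto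
  also have "\<dots> = (\<integral>y. f 0 y \<partial>Q s x0)"
    using s x0 AE_F fM by (intro integral_restrict_kernel[symmetric]) auto
  also have "\<dots> = (\<integral>y. f 0 y \<partial>\<mu>)"
  proof (rule integral_completion[symmetric])
    have "f 0 \<in> borel_measurable (restrict_space M F)" using fM by (rule measurable_restrict_space1)
    moreover have "sets (Q s x0) = sets (restrict_space M F)" using prob_\<mu> by (simp add: prob_measures_def)
    ultimately show "f 0 \<in> borel_measurable (Q s x0)" using measurable_cong_sets[OF _ refl] by blast
  qed
  also have "\<dots> = (\<integral>y. (\<integral>\<omega>. extend_zero (f 0) (path Y 0 \<omega>) \<partial>law Y y) \<partial>\<mu>)"
  proof (rule Bochner_Integration.integral_cong[OF refl])
    fix y assume "y \<in> space \<mu>"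
    then have y: "y \<in> F" "y \<in> space (restrict_space M F)" by (auto simp: space_\<mu>)
    interpret prob_space "law Y y" using y(2) by (rule Y.prob_space_law)
    have "f 0 \<in> borel_measurable (restrict_space M F)" using fM by (rule measurable_restrict_space1)
    then have "(\<lambda>\<omega>. extend_zero (f 0) (path Y 0 \<omega>)) \<in> borel_measurable (law Y y)"
      unfolding Y.measurable_law_iff[OF y(2)] by (intro Y.measurable_path_base) auto
    then have "(\<integral>\<omega>. extend_zero (f 0) (path Y 0 \<omega>) \<partial>law Y y) = (\<integral>\<omega>. f 0 y \<partial>law Y y)"
      using Y.normal[OF y(2)] by (intro integral_cong_AE) auto
    then show "f 0 y = (\<integral>\<omega>. extend_zero (f 0) (path Y 0 \<omega>) \<partial>law Y y)" by (simp add: prob_space)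
  qed
  finally show ?case by simp
next
  case (insert b J)
  let ?J = "insert 0 J"
  have J: "finite ?J" "?J \<noteq> {}" "?J \<subseteq> {0..}" "Max ?J < b"
    using insert by auto
  define g where "g R = f(Max ?J := \<lambda>y. f (Max ?J) y * (\<integral>z. f b z \<partial>R (b - Max ?J) y))" for R :: "real \<Rightarrow> 'a \<Rightarrow> 'a measure"
  have bJ: "insert 0 (insert b J) = insert b ?J" by auto
  have gP: "g P j \<in> Bb M" for j
    unfolding g_def using X.integral_prod_path_step(2)[OF x0 less_imp_le[OF s] J insert.prems(2)] .
  have "(\<integral>\<omega>. (\<Prod>j\<in>insert 0 (insert b J). extend_zero (f j) (path X (s + j) \<omega>)) \<partial>law X x0) =
      (\<integral>\<omega>. (\<Prod>j\<in>?J. extend_zero (g P j) (path X (s + j) \<omega>)) \<partial>law X x0)"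
    unfolding bJ g_def using X.integral_prod_path_step(1)[OF x0 less_imp_le[OF s] J insert.prems(2)] .
  also have "\<dots> = (\<integral>y. (\<integral>\<omega>. (\<Prod>j\<in>?J. extend_zero (g P j) (path Y j \<omega>)) \<partial>law Y y) \<partial>\<mu>)"
    using insert.prems gP by (intro insert.IH) auto
  also have "\<dots> = (\<integral>y. (\<integral>\<omega>. (\<Prod>j\<in>insert 0 (insert b J). extend_zero (f j) (path Y j \<omega>)) \<partial>law Y y) \<partial>\<mu>)"
  proof (rule Bochner_Integration.integral_cong[OF refl])
    fix y assume "y \<in> space \<mu>"
    then have y: "y \<in> space (restrict_space M F)" by (auto simp: space_\<mu>)
    have "(\<integral>\<omega>. (\<Prod>j\<in>insert b ?J. extend_zero (f j) (path Y (0 + j) \<omega>)) \<partial>law Y y) =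
      (\<integral>\<omega>. (\<Prod>j\<in>?J. extend_zero (g Q j) (path Y (0 + j) \<omega>)) \<partial>law Y y)"
      unfolding g_def using Y.integral_prod_path_step(1)[OF y order_refl J Bb_restrict[OF insert.prems(2)]] .
    also have "\<dots> = (\<integral>\<omega>. (\<Prod>j\<in>?J. extend_zero (g P j) (path Y j \<omega>)) \<partial>law Y y)"
    proof (rule Bochner_Integration.integral_cong[OF refl], rule prod.cong[OF refl])
      fix \<omega> j assume \<omega>: "\<omega> \<in> space (law Y y)" and j: "j \<in> ?J"
      have \<omega>: "\<omega> \<in> space (base Y)" using \<omega> by (simp add: Y.space_law[OF y])
      have j0: "0 \<le> j" using j J(3) by auto
      have eq: "g Q j z = g P j z" if "z \<in> F" for z
      proof -
        have "0 \<le> b - Max ?J" using J(4) by simp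
        then have "(\<integral>x. f b x \<partial>Q (b - Max ?J) z) = (\<integral>x. f b x \<partial>P (b - Max ?J) z)"
          using that insert.prems(2)[of b] by (intro integral_restrict_semigroup) (auto simp: Bb_def)
        then show ?thesis by (simp add: g_def)
      qed
      show "extend_zero (g Q j) (path Y (0 + j) \<omega>) = extend_zero (g P j) (path Y j \<omega>)"
        using Y.path_cases[OF j0 \<omega>] by cases (auto simp: eq)
    qed
    finally show "(\<integral>\<omega>. (\<Prod>j\<in>?J. extend_zero (g P j) (path Y j \<omega>)) \<partial>law Y y) =
        (\<integral>\<omega>. (\<Prod>j\<in>insert 0 (insert b J). extend_zero (f j) (path Y j \<omega>)) \<partial>law Y y)"
      unfolding bJ by simp
  qed
  finally show ?case .
qed

text \<open>
  After the time \<open>s > 0\<close> the process \<open>X\<close> looks like \<open>Y\<close> started from the distribution of \<open>X\<close> at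
  time \<open>s\<close>, whether or not \<open>x0\<close> belongs to \<open>F\<close>.  The mixture is taken over the completed distribution because
  the laws of \<open>Y\<close> are only universally measurable in the starting point.
\<close>
lemma path_law_eq:
  assumes d: "d \<in> F"
  shows "distr (law X x0) (Pi\<^sub>M rational_times (\<lambda>_. M)) (path_map X d s) =
    distr (\<mu> \<bind> law Y) (Pi\<^sub>M rational_times (\<lambda>_. M)) (path_map Y d 0)" (is "?\<nu> = ?\<nu>'")
proof (rule measure_eqI_PiM_infinite)
  let ?PI = "Pi\<^sub>M rational_times (\<lambda>_. M)"
  have dM: "d \<in> space M" using d F_subset by auto
  have mX: "path_map X d s \<in> base X \<rightarrow>\<^sub>M ?PI"
    using s dM by (intro X.measurable_path_map) auto
  then have mX': "path_map X d s \<in> law X x0 \<rightarrow>\<^sub>M ?PI" by (simp add: X.measurable_law_iff[OF x0])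
  have mY: "path_map Y d 0 \<in> base Y \<rightarrow>\<^sub>M ?PI"
    using dM by (intro Y.measurable_path_map) (auto intro: measurable_restrict_space1)
  have ne: "space \<mu> \<noteq> {}" using d by (auto simp: space_\<mu>)
  have sB: "sets (\<mu> \<bind> law Y) = sets (base Y)"
    using law_Y_measurable ne by (intro sets_bind) (auto simp: Y.sets_law space_\<mu>)
  then have mY': "path_map Y d 0 \<in> (\<mu> \<bind> law Y) \<rightarrow>\<^sub>M ?PI"
    using mY measurable_cong_sets[OF sB refl] by blast
  interpret X0: prob_space "law X x0" using x0 by (rule X.prob_space_law)
  show "finite_measure ?\<nu>" using X0.prob_space_distr[OF mX'] by (simp add: prob_space.finite_measure)
  fix A J assume J: "finite J" "J \<subseteq> rational_times" and A: "\<And>j. j \<in> J \<Longrightarrow> A j \<in> sets M"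
  let ?C = "prod_emb rational_times (\<lambda>_. M) J (Pi\<^sub>E J A)"
  have C: "?C \<in> sets ?PI" using J A by (intro sets_PiM_I) auto
  define J0 where "J0 = insert 0 J"
  have J0: "finite J0" "J0 \<noteq> {}" "J0 \<subseteq> {0..}" and J_pos: "J0 = insert 0 (J - {0})" "J - {0} \<subseteq> {0<..}" "finite (J - {0})"
    using J by (auto simp: J0_def)
  define A' where "A' j = (if j \<in> J then A j else space M)" for j
  have A': "A' j \<in> sets M" for j using A by (auto simp: A'_def)
  define f where "f j = (indicator (A' j) :: 'a \<Rightarrow> real)" for j
  have f: "f j \<in> Bb M" for j unfolding f_def using A' by (rule Bb_indicator)
  have pre: "path_map Z d r -` ?C \<inter> S = {\<omega> \<in> S. \<forall>j\<in>J0. coord Z d (r + j) \<omega> \<in> A' j}"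
    if that: "\<And>\<omega> t. \<omega> \<in> S \<Longrightarrow> t \<in> rational_times \<Longrightarrow> coord Z d (r + t) \<omega> \<in> space M" for S r and Z :: "('z, 'a) process"
  proof -
    note coord_in = that
    have "path_map Z d r \<omega> \<in> ?C \<longleftrightarrow> (\<forall>j\<in>J0. coord Z d (r + j) \<omega> \<in> A' j)" if \<omega>: "\<omega> \<in> S" for \<omega>
    proof -
      have PiE: "path_map Z d r \<omega> \<in> Pi\<^sub>E rational_times (\<lambda>_. space M)"
        unfolding path_map_def using coord_in[OF \<omega>] by (intro restrict_PiE_iff[THEN iffD2]) blast
      have "path_map Z d r \<omega> \<in> ?C \<longleftrightarrow> (\<forall>j\<in>J. path_map Z d r \<omega> j \<in> A j)"
        using PiE by (simp add: prod_emb_def restrict_PiE_iff Pi_iff)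
      also have "\<dots> \<longleftrightarrow> (\<forall>j\<in>J. coord Z d (r + j) \<omega> \<in> A j)"
        using J(2) by (intro ball_cong) (auto simp: path_map_def)
      also have "\<dots> \<longleftrightarrow> (\<forall>j\<in>J0. coord Z d (r + j) \<omega> \<in> A' j)"
        using coord_in[OF \<omega>, of 0] unfolding J0_def A'_def ball_simps by simp (metis add.right_neutral)
      finally show ?thesis .
    qed
    then show ?thesis by blast
  qed
  have "emeasure ?\<nu> ?C = emeasure (law X x0) (path_map X d s -` ?C \<inter> space (base X))"
    using emeasure_distr[OF mX' C] by (simp add: X.space_law[OF x0])
  also have "path_map X d s -` ?C \<inter> space (base X) = {\<omega> \<in> space (base X). \<forall>j\<in>J0. coord X d (s + j) \<omega> \<in> A' j}"
    using s dM by (intro pre measurable_space[OF X.measurable_coord]) auto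
  also have "emeasure (law X x0) \<dots> = ennreal (\<integral>\<omega>. (\<Prod>j\<in>J0. extend_zero (f j) (path X (s + j) \<omega>)) \<partial>law X x0)"
    unfolding f_def using x0 s J0 A' dM by (intro X.emeasure_cylinder alive_X) auto
  also have "\<dots> = ennreal (\<integral>y. (\<integral>\<omega>. (\<Prod>j\<in>J0. extend_zero (f j) (path Y j \<omega>)) \<partial>law Y y) \<partial>\<mu>)"
    unfolding J_pos(1) using J_pos(2,3) f by (subst finite_dimensional_distributions) auto
  finally have X_eq: "emeasure ?\<nu> ?C = \<dots>" .
  let ?B = "path_map Y d 0 -` ?C \<inter> space (base Y)"
  have B: "?B \<in> sets (base Y)" using measurable_sets[OF mY C] .
  have Y_law: "emeasure (law Y y) ?B = ennreal (\<integral>\<omega>. (\<Prod>j\<in>J0. extend_zero (f j) (path Y j \<omega>)) \<partial>law Y y)"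
    if y: "y \<in> F" for y
  proof -
    have yR: "y \<in> space (restrict_space M F)" using y by simp
    have cF: "coord Y d (0 + t) \<omega> \<in> F" if "\<omega> \<in> space (base Y)" "0 \<le> t" for \<omega> t
      using measurable_space[OF Y.measurable_coord[of t d "restrict_space M F"]] that d by auto
    have "?B = {\<omega> \<in> space (base Y). \<forall>j\<in>J0. coord Y d (0 + j) \<omega> \<in> A' j}"
      using cF F_subset by (intro pre) auto
    also have "\<dots> = {\<omega> \<in> space (base Y). \<forall>j\<in>J0. coord Y d (0 + j) \<omega> \<in> A' j \<inter> F}"
      using cF J0(3) by auto
    also have "emeasure (law Y y) \<dots> =
        ennreal (\<integral>\<omega>. (\<Prod>j\<in>J0. extend_zero (indicator (A' j \<inter> F)) (path Y (0 + j) \<omega>)) \<partial>law Y y)"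
      using yR y J0 A' d alive_Y[OF y] by (intro Y.emeasure_cylinder) (auto simp: sets_restrict_space)
    also have "(\<integral>\<omega>. (\<Prod>j\<in>J0. extend_zero (indicator (A' j \<inter> F)) (path Y (0 + j) \<omega>)) \<partial>law Y y) =
        (\<integral>\<omega>. (\<Prod>j\<in>J0. extend_zero (f j) (path Y j \<omega>)) \<partial>law Y y)"
    proof (rule Bochner_Integration.integral_cong[OF refl], rule prod.cong[OF refl])
      fix \<omega> j assume "\<omega> \<in> space (law Y y)" and j: "j \<in> J0"
      then have \<omega>: "\<omega> \<in> space (base Y)" by (simp add: Y.space_law[OF yR])
      have j0: "0 \<le> j" using j J0(3) by auto
      show "extend_zero (indicator (A' j \<inter> F)) (path Y (0 + j) \<omega>) = extend_zero (f j) (path Y j \<omega>)"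
        using Y.path_cases[OF j0 \<omega>] by cases (auto simp: f_def split: split_indicator)
    qed
    finally show ?thesis .
  qed
  let ?e = "\<lambda>y. \<integral>\<omega>. (\<Prod>j\<in>J0. extend_zero (f j) (path Y j \<omega>)) \<partial>law Y y"
  have e: "0 \<le> ?e y" for y
    by (intro Bochner_Integration.integral_nonneg prod_nonneg) (auto simp: f_def split: option.split)
  have em: "?e \<in> borel_measurable \<mu>"
  proof -
    have "(\<lambda>y. enn2real (emeasure (law Y y) ?B)) \<in> borel_measurable \<mu>"
      using Y.universally_measurable_law[OF B prob_\<mu>] by measurable
    also have "?this \<longleftrightarrow> ?e \<in> borel_measurable \<mu>"
      using Y_law e by (intro measurable_cong) (simp add: space_\<mu>)
    finally show ?thesis .
  qed
  interpret \<mu>: prob_space \<mu>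
    using prob_\<mu> by (auto simp: prob_measures_def intro!: prob_space.prob_space_completion)
  have e1: "?e y \<le> 1" if "y \<in> F" for y
  proof -
    have "emeasure (law Y y) ?B \<le> 1"
      using Y.prob_space_law[of y] that by (auto intro: subprob_space.subprob_emeasure_le_1 prob_space_imp_subprob_space)
    then show ?thesis using Y_law[OF that] by simp
  qed
  have "emeasure ?\<nu>' ?C = emeasure (\<mu> \<bind> law Y) ?B"
    using emeasure_distr[OF mY' C] sets_eq_imp_space_eq[OF sB] by simp
  also have "\<dots> = (\<integral>\<^sup>+y. emeasure (law Y y) ?B \<partial>\<mu>)"
    by (rule emeasure_bind[OF ne law_Y_measurable B])
  also have "\<dots> = (\<integral>\<^sup>+y. ennreal (?e y) \<partial>\<mu>)"
    by (intro nn_integral_cong Y_law) (simp add: space_\<mu>)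
  also have "\<dots> = ennreal (\<integral>y. ?e y \<partial>\<mu>)"
    using e e1 em by (intro nn_integral_eq_integral \<mu>.integrable_const_bound[of _ 1]) (auto simp: space_\<mu>)
  finally show "emeasure ?\<nu> ?C = emeasure ?\<nu>' ?C" using X_eq by simp
qed auto

end

end

text \<open>
  The projection of \<open>C\<close> is measurable up to a null set of the law of \<open>X\<close>, and its measurable
  core, being avoided by \<open>Y\<close> from every starting point, is null for the mixture of the laws of \<open>Y\<close>.
\<close>
lemma (in process_comparison) transfer_avoidance:
  assumes x0: "x0 \<in> space M" and s: "0 < s" and d: "d \<in> F"
    and C: "C \<in> sets (Pi\<^sub>M rational_times (\<lambda>_. M) \<Otimes>\<^sub>M (borel :: real measure))"
    and Y: "\<And>y. y \<in> F \<Longrightarrow> AE \<omega> in law Y y. path_map Y d 0 \<omega> \<notin> fst ` C"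
  shows "AE \<omega> in law X x0. path_map X d s \<omega> \<notin> fst ` C"
proof -
  let ?PI = "Pi\<^sub>M rational_times (\<lambda>_. M)"
  let ?\<nu> = "distr (law X x0) ?PI (path_map X d s)"
  have dM: "d \<in> space M" using d F_subset by auto
  interpret X0: prob_space "law X x0" using x0 by (rule X.prob_space_law)
  have "path_map X d s \<in> base X \<rightarrow>\<^sub>M ?PI"
    using s dM by (intro X.measurable_path_map) auto
  then have mX: "path_map X d s \<in> law X x0 \<rightarrow>\<^sub>M ?PI" by (simp add: X.measurable_law_iff[OF x0])
  have mY: "path_map Y d 0 \<in> base Y \<rightarrow>\<^sub>M ?PI"
    using dM by (intro Y.measurable_path_map) (auto intro: measurable_restrict_space1)
  have ne: "space (completion (Q s x0)) \<noteq> {}" using d by (auto simp: space_\<mu>[OF x0 s])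
  have sB: "sets (completion (Q s x0) \<bind> law Y) = sets (base Y)"
    using law_Y_measurable[OF x0 s] ne by (intro sets_bind) (auto simp: Y.sets_law space_\<mu>[OF x0 s])
  then have mY': "path_map Y d 0 \<in> (completion (Q s x0) \<bind> law Y) \<rightarrow>\<^sub>M ?PI"
    using mY measurable_cong_sets[OF sB refl] by blast
  interpret \<nu>: prob_space ?\<nu> using mX by (rule X0.prob_space_distr)
  have "C \<in> sets (?\<nu> \<Otimes>\<^sub>M borel)"
    using C sets_pair_measure_cong[of ?\<nu> ?PI "borel :: real measure" borel] by simp
  then have "fst ` C \<in> sets (completion ?\<nu>)" by (rule \<nu>.measurable_projection)
  then obtain S N1 N' where S: "fst ` C = S \<union> N1" "N1 \<subseteq> N'" "N' \<in> null_sets ?\<nu>" "S \<in> sets ?\<nu>"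
    by (rule sets_completionE)
  have SP: "S \<in> sets ?PI" using S by simp
  have B: "path_map Y d 0 -` S \<inter> space (base Y) \<in> sets (base Y)"
    using mY SP by (rule measurable_sets)
  have "emeasure ?\<nu> S = emeasure (completion (Q s x0) \<bind> law Y) (path_map Y d 0 -` S \<inter> space (base Y))"
    unfolding path_law_eq[OF x0 s d] using emeasure_distr[OF mY' SP] sets_eq_imp_space_eq[OF sB] by simp
  also have "\<dots> = (\<integral>\<^sup>+y. emeasure (law Y y) (path_map Y d 0 -` S \<inter> space (base Y)) \<partial>completion (Q s x0))"
    by (rule emeasure_bind[OF ne law_Y_measurable[OF x0 s] B])
  also have "\<dots> = (\<integral>\<^sup>+y. 0 \<partial>completion (Q s x0))"
  proof (rule nn_integral_cong)
    fix y assume "y \<in> space (completion (Q s x0))"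
    then have y: "y \<in> F" "y \<in> space (restrict_space M F)" by (auto simp: space_\<mu>[OF x0 s])
    have "AE \<omega> in law Y y. \<omega> \<notin> path_map Y d 0 -` S \<inter> space (base Y)"
      using Y[OF y(1)] by eventually_elim (use S(1) in auto)
    then show "emeasure (law Y y) (path_map Y d 0 -` S \<inter> space (base Y)) = 0"
      using B by (subst (asm) AE_iff_measurable[OF _ refl])
        (auto simp: Y.sets_law[OF y(2)] Y.space_law[OF y(2)] Collect_conj_eq[symmetric] Int_def vimage_def conj_ac)
  qed
  finally have "S \<in> null_sets ?\<nu>" using S(4) by auto
  then have "S \<union> N' \<in> null_sets ?\<nu>" using S(3) by (rule null_sets.Un)
  then have "AE w in ?\<nu>. w \<notin> S \<union> N'" by (rule AE_not_in)
  then have "AE \<omega> in law X x0. path_map X d s \<omega> \<notin> S \<union> N'" by (rule AE_distrD[OF mX])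
  then show ?thesis by eventually_elim (use S in auto)
qed

text \<open>
  The value of \<open>v\<close> at any time can be read off from the path at rational times.
\<close>
lemma (in markov_process) coord_approx_right_lim:
  assumes \<omega>: "\<omega> \<in> space (base X)" and alive: "\<And>t. 0 \<le> t \<Longrightarrow> path X t \<omega> \<noteq> None"
    and v: "\<And>y. y \<in> space M \<Longrightarrow> v y < top"
    and rc: "\<And>t. 0 \<le> t \<Longrightarrow> ((\<lambda>s. extend_zero v (path X s \<omega>)) \<longlongrightarrow> extend_zero v (path X t \<omega>)) (at_right t)"
    and s: "0 \<le> s" and t: "0 \<le> t"
  shows "lim (\<lambda>k. enn2real (v (path_map X d s \<omega> (approx_right k t)))) = enn2real (v (coord X d (s + t) \<omega>))"
proof -
  have c: "extend_zero v (path X r \<omega>) = v (coord X d r \<omega>)" if "0 \<le> r" for r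
    using alive[OF that] by (auto simp: coord_def)
  have r0: "approx_right k t \<in> rational_times" for k
    using approx_right_bounds(1)[OF t, of k] t by (auto simp: approx_right_def simp del: of_nat_Suc)
  have lim: "filterlim (\<lambda>k. s + approx_right k t) (at_right (s + t)) sequentially"
  proof (rule tendsto_imp_filterlim_at_right)
    have "(\<lambda>k. approx_right k t) \<longlonglongrightarrow> t"
      using filterlim_approx_right[OF t] by (rule filterlim_mono) (auto simp: at_within_def)
    then show "(\<lambda>k. s + approx_right k t) \<longlonglongrightarrow> s + t" by (intro tendsto_intros)
    show "\<forall>\<^sub>F k in sequentially. s + t < s + approx_right k t"
      using approx_right_bounds(1)[OF t] by (intro always_eventually allI) simp
  qed
  have st: "0 \<le> s + t" using s t by simp
  have "coord X d (s + t) \<omega> \<in> space M"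
    using path_cases[OF st \<omega>] alive[OF st] by cases (auto simp: coord_def)
  then have fin: "extend_zero v (path X (s + t) \<omega>) = ennreal (enn2real (v (coord X d (s + t) \<omega>)))"
    using v c[OF st] by simp
  have "(\<lambda>k. extend_zero v (path X (s + approx_right k t) \<omega>)) \<longlonglongrightarrow> ennreal (enn2real (v (coord X d (s + t) \<omega>)))"
    using filterlim_compose[OF rc[OF st] lim] unfolding fin .
  then have "(\<lambda>k. enn2real (extend_zero v (path X (s + approx_right k t) \<omega>))) \<longlonglongrightarrow> enn2real (v (coord X d (s + t) \<omega>))"
    by (rule tendsto_enn2real) simp
  moreover have "extend_zero v (path X (s + approx_right k t) \<omega>) = v (path_map X d s \<omega> (approx_right k t))" for k
    using r0[of k] s by (subst c) (auto simp: path_map_def)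
  ultimately show ?thesis by (simp add: limI)
qed

lemma conservative_mass:
  assumes X: "markov_process M X" "transition_function M X P" "conservative M X"
    and x: "x \<in> space M" and t: "0 \<le> t"
  shows "emeasure (P t x) (space M) = 1"
proof -
  interpret markov_process M X by fact
  interpret prob_space "law X x" using x by (rule prob_space_law)
  have sP: "sets (P t x) = sets M" using X(2) x t by (simp add: transition_function_def)
  have "(\<integral>\<^sup>+y. 1 \<partial>P t x) = process_semigroup X t (\<lambda>_. 1) x"
  proof -
    have *: "(\<integral>\<^sup>+y. u y \<partial>P t x) = process_semigroup X t u x" if "u \<in> borel_measurable M" for u
      using X(2) x t that by (simp add: transition_function_def)
    show ?thesis by (rule *) simp
  qed
  also have "\<dots> = (\<integral>\<^sup>+\<omega>. 1 \<partial>law X x)"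
    unfolding process_semigroup_def
  proof (rule nn_integral_cong_AE)
    have "AE \<omega> in law X x. lifetime X \<omega> = \<infinity>" using X(3) x by (simp add: conservative_def)
    then show "AE \<omega> in law X x. extend_zero (\<lambda>_. 1) (path X t \<omega>) = (1 :: ennreal)"
    proof eventually_elim
      case (elim \<omega>)
      have "path X t \<omega> \<noteq> None"
      proof
        assume "path X t \<omega> = None"
        then have "lifetime X \<omega> \<le> ereal t" unfolding lifetime_def using t by (intro Inf_lower) auto
        with elim show False by simp
      qed
      then show ?case by auto
    qed
  qed
  finally show ?thesis using sets_eq_imp_space_eq[OF sP] emeasure_space_1 by simp
qed

text \<open>
  The visits to \<open>N\<close> are expressed by the right limits of countably many potentials \<open>v i\<close>, which are continuous from the
  right along the paths of both processes.  In these terms \<open>Y\<close> avoids the set \<open>C\<close>, and \<open>transfer_avoidance\<close>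
  carries this over to \<open>X\<close> after each of the times \<open>1 / (n + 1)\<close>.
\<close>
theorem polar_of_right_process_on_complement:
  fixes X :: "('v, 'a) process" and Y :: "('w, 'a) process"
  assumes X: "right_markov_process M X" "conservative M X" "transition_function M X P"
    and P: "kernel_semigroup M P" and N: "negligible_set M P N" and F: "F = space M - N"
    and Y: "right_markov_process (restrict_space M F) Y"
      "transition_function (restrict_space M F) Y (restrict_semigroup P F)"
  shows "polar M X N"
  unfolding polar_def
proof
  fix x0 assume x0: "x0 \<in> space M"
  have nr: "negligible_restriction M P N F" using P N F by unfold_locales
  obtain TX where XT: "right_markov_process_wrt TX M X" using X(1) by (auto simp: right_markov_process_def)
  have Xc: "right_markov_process_core M X" using XT by (simp add: right_markov_process_wrt_def)
  have Yc: "right_markov_process_core (restrict_space M F) Y"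
    using Y(1) by (auto simp: right_markov_process_def right_markov_process_wrt_def)
  interpret Xr: right_markov_process_core M X by fact
  interpret Yr: right_markov_process_core "restrict_space M F" Y by fact
  interpret process_comparison M P N F X Y
    by unfold_locales (fact P N F X Y negligible_restriction.kernel_semigroup_restrict[OF nr]
        | rule conservative_mass[OF Xr.markov_process_axioms X(3,2)])+
  have TX: "lusin_topology TX" "topspace TX = space M" "sets (borel_of TX) = sets M"
    using XT by (auto simp: right_markov_process_wrt_def lusin_topology_of_def)
  obtain f :: "nat \<Rightarrow> 'a \<Rightarrow> real" where f: "\<And>m. f m \<in> Cb TX" "\<And>m x. x \<in> space M \<Longrightarrow> 0 \<le> f m x \<and> f m x \<le> 1"
    and gen: "\<And>L. space L = space M \<Longrightarrow> (\<And>m. f m \<in> borel_measurable L) \<Longrightarrow> sets M \<subseteq> sets L"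
    using lusin_topology_generating_sequence[OF TX(1)] unfolding TX(2,3) by blast
  have fB: "f m \<in> Bb M" for m using f(1) Cb_subset_Bb[of TX] Bb_cong[OF TX(3)] by auto
  then have fm: "f m \<in> borel_measurable M" for m by (simp add: Bb_def)
  obtain \<beta>X where \<beta>X: "0 < \<beta>X" "\<And>f \<alpha> \<epsilon> x. kernel_potential M P f \<alpha> \<Longrightarrow> \<alpha> \<le> \<beta>X \<Longrightarrow> 0 \<le> \<epsilon> \<Longrightarrow> x \<in> space M \<Longrightarrow>
    AE \<omega> in law X x. \<forall>t\<ge>0. ((\<lambda>s. extend_zero (potential_tail P f \<alpha> \<epsilon>) (path X s \<omega>)) \<longlongrightarrow>
      extend_zero (potential_tail P f \<alpha> \<epsilon>) (path X t \<omega>)) (at_right t)"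
    using AE_right_continuous_potential_tail[OF Xc P X(3)] by blast
  obtain \<beta>Y where \<beta>Y: "0 < \<beta>Y" "\<And>f \<alpha> \<epsilon> x. kernel_potential (restrict_space M F) Q f \<alpha> \<Longrightarrow> \<alpha> \<le> \<beta>Y \<Longrightarrow> 0 \<le> \<epsilon> \<Longrightarrow>
    x \<in> space (restrict_space M F) \<Longrightarrow>
    AE \<omega> in law Y x. \<forall>t\<ge>0. ((\<lambda>s. extend_zero (potential_tail Q f \<alpha> \<epsilon>) (path Y s \<omega>)) \<longlongrightarrow>
      extend_zero (potential_tail Q f \<alpha> \<epsilon>) (path Y t \<omega>)) (at_right t)"
    using AE_right_continuous_potential_tail[OF Yc kernel_semigroup_restrict Y(2)] by blast
  \<comment> \<open>A rate that is admissible for both processes.\<close>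
  define \<alpha> where "\<alpha> = min \<beta>X \<beta>Y"
  have \<alpha>: "0 < \<alpha>" "\<alpha> \<le> \<beta>X" "\<alpha> \<le> \<beta>Y" using \<beta>X \<beta>Y by (auto simp: \<alpha>_def)
  have kX: "kernel_potential M P (f m) \<alpha>" for m
    using P fm f(2) right_continuous_semigroup[OF XT P X(3) f(1)] \<alpha> by unfold_locales auto
  have FQ: "(\<integral>y. f m y \<partial>Q t x) = (\<integral>y. f m y \<partial>P t x)" if "x \<in> F" "0 \<le> t" for m t x
    using that fm by (intro integral_restrict_semigroup) auto
  have kY: "kernel_potential (restrict_space M F) Q (f m) \<alpha>" for m
  proof unfold_locales
    show "f m \<in> borel_measurable (restrict_space M F)" using fm by (rule measurable_restrict_space1)
    fix x assume "x \<in> space (restrict_space M F)"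
    then have x: "x \<in> F" "x \<in> space M" using F_subset by auto
    then show "0 \<le> f m x \<and> f m x \<le> 1" using f(2) by simp
    fix t :: real assume t: "0 \<le> t"
    have "((\<lambda>s. \<integral>y. f m y \<partial>P s x) \<longlongrightarrow> (\<integral>y. f m y \<partial>P t x)) (at_right t)"
      using right_continuous_semigroup[OF XT P X(3) f(1) x(2) t] .
    moreover have "\<forall>\<^sub>F s in at_right t. (\<integral>y. f m y \<partial>P s x) = (\<integral>y. f m y \<partial>Q s x)"
      unfolding eventually_at_right_field using t x FQ by (intro exI[of _ "t + 1"]) auto
    ultimately show "((\<lambda>s. \<integral>y. f m y \<partial>Q s x) \<longlongrightarrow> (\<integral>y. f m y \<partial>Q t x)) (at_right t)"
      unfolding FQ[OF x(1) t] by (rule Lim_transform_eventually)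
  qed (use \<alpha> in auto)
  \<comment> \<open>\<open>1 / 0 = 0\<close>, so the whole potential of \<open>f m\<close> has the index \<open>(m, 0)\<close>.\<close>
  define v where "v i = potential_tail P (f (fst i)) \<alpha> (1 / real (snd i))" for i :: "nat \<times> nat"
  have vM: "v i \<in> borel_measurable M" for i
    unfolding v_def by (rule kernel_potential.v_measurable[OF kX]) simp
  have v_fin: "v i y < top" if "y \<in> space M" for i y
    unfolding v_def using kernel_potential.v_le[OF kX, of "1 / real (snd i)" y "fst i"] that
    by (auto intro: le_less_trans)
  have vQ: "potential_tail Q (f (fst i)) \<alpha> (1 / real (snd i)) y = v i y" if "y \<in> F" for i y
    unfolding v_def potential_tail_def
  proof (rule nn_integral_cong)
    fix t :: real
    have "0 \<le> 1 / real (snd i)" by simp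
    then have "\<not> 1 / real (snd i) \<le> t \<or> 0 \<le> t" by linarith
    then have "indicator {1 / real (snd i)..} t = (0 :: real) \<or> 0 \<le> t"
      by (simp add: indicator_def)
    then show "ennreal (indicator {1 / real (snd i)..} t * exp (- (\<alpha> * t)) * (\<integral>y. f (fst i) y \<partial>Q t y)) =
        ennreal (indicator {1 / real (snd i)..} t * exp (- (\<alpha> * t)) * (\<integral>y. f (fst i) y \<partial>P t y))"
      using FQ[OF that] by auto
  qed
  define g where "g i y = enn2real (v i y)" for i y
  have gM: "g i \<in> borel_measurable M" for i unfolding g_def using vM by measurable
  let ?PB = "Pi\<^sub>M UNIV (\<lambda>_ :: nat \<times> nat. borel :: real measure)"
  let ?G = "\<lambda>y i. g i y"
  \<comment> \<open>The potentials determine the functions \<open>f m\<close>, hence the \<open>\<sigma>\<close>-algebra of \<open>M\<close>.\<close>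
  obtain D where D: "D \<in> sets ?PB" "N = ?G -` D \<inter> space M"
  proof -
    let ?L = "vimage_algebra (space M) ?G ?PB"
    have G: "?G \<in> space M \<rightarrow> space ?PB" by (simp add: space_PiM)
    have gL: "g i \<in> borel_measurable ?L" for i
      using measurable_compose[OF measurable_vimage_algebra1[OF G] measurable_component_singleton[of i UNIV]] by simp
    have "f m \<in> borel_measurable ?L" for m
    proof (rule borel_measurable_LIMSEQ_real)
      show "(\<lambda>x. real (Suc k) * (g (m, 0) x - g (m, Suc k) x)) \<in> borel_measurable ?L" for k
        using gL by measurable
      show "(\<lambda>k. real (Suc k) * (g (m, 0) x - g (m, Suc k) x)) \<longlonglongrightarrow> f m x" if "x \<in> space ?L" for x
        using kernel_potential.potential_tail_derivative[OF kX, of x m] that by (simp add: g_def v_def)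
    qed
    then have "N \<in> sets ?L" using gen[of ?L] N by (auto simp: negligible_set_def)
    then show thesis using that by (auto simp: sets_vimage_algebra2[OF G])
  qed
  let ?PI = "Pi\<^sub>M rational_times (\<lambda>_. M)"
  let ?L = "\<lambda>z i. lim (\<lambda>k. g i (fst z (approx_right k (snd z))))"
  \<comment> \<open>The paths, with a time at which the right limit of the potentials indicates a visit to \<open>N\<close>.\<close>
  define C where "C = {z \<in> space (?PI \<Otimes>\<^sub>M (borel :: real measure)). 0 < snd z \<and> ?L z \<in> D}"
  have L: "?L \<in> (?PI \<Otimes>\<^sub>M borel) \<rightarrow>\<^sub>M ?PB"
  proof (rule measurable_abs_UNIV, rule borel_measurable_lim_metric)
    fix i k
    show "(\<lambda>z. g i (fst z (approx_right k (snd z)))) \<in> borel_measurable (?PI \<Otimes>\<^sub>M borel)"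
    proof (rule approx_right_measurable_compose[where h = "\<lambda>t z. g i (fst z t)"])
      fix t :: real assume "t \<in> \<rat>" "0 \<le> t"
      then have "(\<lambda>z. fst z t) \<in> (?PI \<Otimes>\<^sub>M (borel :: real measure)) \<rightarrow>\<^sub>M M"
        by (intro measurable_compose[OF measurable_fst measurable_component_singleton]) auto
      then show "(\<lambda>z. g i (fst z t)) \<in> borel_measurable (?PI \<Otimes>\<^sub>M (borel :: real measure))"
        using gM by (rule measurable_compose)
    qed simp
  qed
  have C: "C \<in> sets (?PI \<Otimes>\<^sub>M borel)"
  proof -
    have "C = ?L -` D \<inter> space (?PI \<Otimes>\<^sub>M borel) \<inter> {z \<in> space (?PI \<Otimes>\<^sub>M borel). 0 < snd z}"
      unfolding C_def by auto
    also have "\<dots> \<in> sets (?PI \<Otimes>\<^sub>M borel)"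
      by (rule sets.Int[OF measurable_sets[OF L D(1)]]) measurable
    finally show ?thesis .
  qed
  obtain d where d: "d \<in> F"
  proof -
    have "emeasure (P 1 x0) F = emeasure (P 1 x0) (space M)"
    proof (rule emeasure_eq_AE)
      show "AE y in P 1 x0. y \<in> F \<longleftrightarrow> y \<in> space M"
        using AE_kernel_F_pos[OF zero_less_one x0] by eventually_elim (use F_subset in auto)
    qed (use F_sets sets_kernel[of 1 x0] x0 in auto)
    then have "F \<noteq> {}" using mass[of 1 x0] x0 by auto
    then show thesis using that by blast
  qed
  have dM: "d \<in> space M" using d F_subset by auto
  have avoidY: "AE \<omega> in law Y y. path_map Y d 0 \<omega> \<notin> fst ` C" if y: "y \<in> F" for y
  proof -
    have y': "y \<in> space (restrict_space M F)" using y by simp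
    have "AE \<omega> in law Y y. \<forall>i. \<forall>t\<ge>0. ((\<lambda>s. extend_zero (potential_tail Q (f (fst i)) \<alpha> (1 / real (snd i))) (path Y s \<omega>)) \<longlongrightarrow>
      extend_zero (potential_tail Q (f (fst i)) \<alpha> (1 / real (snd i))) (path Y t \<omega>)) (at_right t)"
      unfolding AE_all_countable using y' \<alpha> kY by (intro allI \<beta>Y(2)) auto
    with alive_Y[OF y] AE_space show ?thesis
    proof eventually_elim
      case (elim \<omega>)
      then have \<omega>: "\<omega> \<in> space (base Y)" by (simp add: Yr.space_law[OF y'])
      show ?case
      proof
        assume "path_map Y d 0 \<omega> \<in> fst ` C"
        then obtain t where t: "0 < t" "?L (path_map Y d 0 \<omega>, t) \<in> D" by (auto simp: C_def)
        have cF: "coord Y d t \<omega> \<in> F"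
          using t measurable_space[OF Yr.measurable_coord[of t d "restrict_space M F"]] d \<omega> by auto
        have vq: "extend_zero (potential_tail Q (f (fst i)) \<alpha> (1 / real (snd i))) (path Y r \<omega>) = extend_zero (v i) (path Y r \<omega>)"
          if "0 \<le> r" for r i
          using Yr.path_cases[OF that \<omega>] by cases (auto simp: vQ)
        have rc: "((\<lambda>s. extend_zero (v i) (path Y s \<omega>)) \<longlongrightarrow> extend_zero (v i) (path Y r \<omega>)) (at_right r)" if r: "0 \<le> r" for r i
        proof -
          have ev: "\<forall>\<^sub>F s in at_right r. extend_zero (potential_tail Q (f (fst i)) \<alpha> (1 / real (snd i))) (path Y s \<omega>) = extend_zero (v i) (path Y s \<omega>)"
            unfolding eventually_at_right_field using r vq by (intro exI[of _ "r + 1"]) auto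
          show ?thesis
            using Lim_transform_eventually[OF elim(3)[rule_format, OF r, of i] ev] by (simp only: vq[OF r])
        qed
        have "lim (\<lambda>k. enn2real (v i (path_map Y d 0 \<omega> (approx_right k t)))) = enn2real (v i (coord Y d (0 + t) \<omega>))" for i
          using elim(1) \<omega> t F_subset rc by (intro Yr.coord_approx_right_lim v_fin) auto
        then have "?L (path_map Y d 0 \<omega>, t) = ?G (coord Y d t \<omega>)" by (simp add: g_def)
        then have "coord Y d t \<omega> \<in> N" unfolding D(2) using t(2) cF F_subset by auto
        with cF show False using F by auto
      qed
    qed
  qed
  have X_rc: "AE \<omega> in law X x0. \<forall>i. \<forall>t\<ge>0. ((\<lambda>s. extend_zero (v i) (path X s \<omega>)) \<longlongrightarrow> extend_zero (v i) (path X t \<omega>)) (at_right t)"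
    unfolding AE_all_countable v_def using x0 \<alpha> kX by (intro allI \<beta>X(2)) auto
  have "AE \<omega> in law X x0. \<forall>n. path_map X d (1 / real (Suc n)) \<omega> \<notin> fst ` C"
    unfolding AE_all_countable using transfer_avoidance[OF x0 _ d C avoidY] by simp
  with X_rc alive_X[OF x0] AE_space show "AE \<omega> in law X x0. hitting_time X N \<omega> = \<infinity>"
  proof eventually_elim
    case (elim \<omega>)
    then have \<omega>: "\<omega> \<in> space (base X)" by (simp add: Xr.space_law[OF x0])
    have "path X t \<omega> \<notin> Some ` N" if t: "0 < t" for t
    proof
      assume hit: "path X t \<omega> \<in> Some ` N"
      obtain n where n: "1 / real (Suc n) < t" using t reals_Archimedean by (auto simp: inverse_eq_divide)
      define s where "s = 1 / real (Suc n)"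
      have s: "0 < s" "s < t" using n by (auto simp: s_def)
      have "lim (\<lambda>k. enn2real (v i (path_map X d s \<omega> (approx_right k (t - s))))) = enn2real (v i (coord X d (s + (t - s)) \<omega>))" for i
        using elim(2) \<omega> s by (intro Xr.coord_approx_right_lim v_fin elim(1)[rule_format]) auto
      then have "?L (path_map X d s \<omega>, t - s) = ?G (coord X d t \<omega>)" by (simp add: g_def)
      moreover have "coord X d t \<omega> \<in> N" using hit by (auto simp: coord_def)
      ultimately have "?L (path_map X d s \<omega>, t - s) \<in> D" unfolding D(2) by auto
      moreover have "path_map X d s \<omega> \<in> space ?PI"
        using s dM \<omega> by (intro measurable_space[OF Xr.measurable_path_map]) auto
      ultimately have "(path_map X d s \<omega>, t - s) \<in> C" using s by (auto simp: C_def space_pair_measure)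
      then have "path_map X d s \<omega> \<in> fst ` C" by force
      with elim(4) show False by (simp add: s_def)
    qed
    then have never: "{ereal t |t. 0 < t \<and> path X t \<omega> \<in> Some ` N} = {}" by auto
    show ?case unfolding hitting_time_def never by (simp add: top_ereal_def)
  qed
qed

section \<open>The Gaussian semigroup\<close>

abbreviation std_normal :: "real measure" where
  "std_normal \<equiv> density lborel (\<lambda>x. ennreal (std_normal_density x))"

lemma prob_space_std_normal: "prob_space std_normal"
  by (rule prob_space_normal_density) simp

lemma sets_gaussian [simp]: "sets (gaussian_semigroup t x) = sets borel"
  by (simp add: gaussian_semigroup_def)

lemma space_gaussian: "space (gaussian_semigroup t x) = UNIV"
  using sets_eq_imp_space_eq[OF sets_gaussian] by simp

text \<open>
  The representation by a standard normal variable includes the degenerate case \<open>t = 0\<close>.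
\<close>
lemma gaussian_eq_distr:
  assumes "0 \<le> t"
  shows "gaussian_semigroup t x = distr std_normal borel (\<lambda>z. x + sqrt t * z)"
proof (cases "t = 0")
  interpret prob_space std_normal by (rule prob_space_std_normal)
  case True
  then show ?thesis
    by (auto intro!: measure_eqI simp: gaussian_semigroup_def emeasure_distr prob_space.emeasure_space_1[OF prob_space_std_normal]
        vimage_def indicator_def emeasure_space_1[simplified])
next
  interpret prob_space std_normal by (rule prob_space_std_normal)
  case False
  have "distributed std_normal lborel (\<lambda>z. z) (\<lambda>x. ennreal (normal_density 0 1 x))"
    by (simp add: distributed_def distr_id2)
  from normal_density_affine[OF this, of "sqrt t" x] False assms
  have "distr std_normal lborel (\<lambda>z. x + sqrt t * z) = density lborel (\<lambda>y. ennreal (normal_density x (sqrt t) y))"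
    by (simp add: distributed_def)
  then show ?thesis
    using False by (simp add: gaussian_semigroup_def cong: distr_cong)
qed

lemma prob_space_gaussian: "0 \<le> t \<Longrightarrow> prob_space (gaussian_semigroup t x)"
  unfolding gaussian_eq_distr by (intro prob_space.prob_space_distr[OF prob_space_std_normal]) simp

lemma nn_integral_gaussian:
  assumes "0 \<le> t" "f \<in> borel_measurable borel"
  shows "(\<integral>\<^sup>+y. f y \<partial>gaussian_semigroup t x) = (\<integral>\<^sup>+z. f (x + sqrt t * z) \<partial>std_normal)"
  unfolding gaussian_eq_distr[OF assms(1)] using assms(2) by (subst nn_integral_distr) auto

lemma integral_gaussian:
  fixes f :: "real \<Rightarrow> real"
  assumes "0 \<le> t" "f \<in> borel_measurable borel"
  shows "(\<integral>y. f y \<partial>gaussian_semigroup t x) = (\<integral>z. f (x + sqrt t * z) \<partial>std_normal)"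
  unfolding gaussian_eq_distr[OF assms(1)] using assms(2) by (subst integral_distr) auto

lemma emeasure_gaussian:
  assumes "0 < t" "A \<in> sets borel"
  shows "emeasure (gaussian_semigroup t x) A = (\<integral>\<^sup>+y. ennreal (normal_density x (sqrt t) y) * indicator A y \<partial>lborel)"
  using assms by (simp add: gaussian_semigroup_def emeasure_density)

lemma gaussian_chapman_kolmogorov:
  assumes s: "0 < s" and t: "0 < t" and A [measurable]: "A \<in> sets borel"
  shows "emeasure (gaussian_semigroup (s + t) x) A = (\<integral>\<^sup>+y. emeasure (gaussian_semigroup t y) A \<partial>gaussian_semigroup s x)"
proof -
  have n: "normal_density y r z = normal_density 0 r (z - y)" for y r z
    by (simp add: normal_density_def)
  have nm [measurable]: "(\<lambda>(y, z). ennreal (normal_density y r z)) \<in> borel_measurable (borel \<Otimes>\<^sub>M borel)" for r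
    unfolding normal_density_def by measurable
  have conv: "(\<integral>\<^sup>+y. ennreal (normal_density x (sqrt s) y) * ennreal (normal_density y (sqrt t) z) \<partial>lborel) =
      ennreal (normal_density x (sqrt (s + t)) z)" for z
  proof -
    have "(\<integral>\<^sup>+y. ennreal (normal_density x (sqrt s) y) * ennreal (normal_density y (sqrt t) z) \<partial>lborel) =
        (\<integral>\<^sup>+y. ennreal (normal_density x (sqrt s) (x + 1 * y)) * ennreal (normal_density (x + 1 * y) (sqrt t) z) \<partial>lborel)"
      by (subst nn_integral_real_affine[where c = 1 and t = x]) simp_all
    also have "\<dots> = (\<integral>\<^sup>+y. ennreal (normal_density 0 (sqrt t) ((z - x) - y) * normal_density 0 (sqrt s) y) \<partial>lborel)"
      by (intro nn_integral_cong) (simp add: n[of "x + _"] n[of x] ennreal_mult'[symmetric] mult.commute diff_diff_eq)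
    also have "\<dots> = ennreal (normal_density 0 (sqrt (t + s)) (z - x))"
      using fun_cong[OF conv_normal_density_zero_mean[of "sqrt t" "sqrt s"], of "z - x"] s t by simp
    finally show ?thesis by (simp add: n[of x] add.commute)
  qed
  have "(\<integral>\<^sup>+y. emeasure (gaussian_semigroup t y) A \<partial>gaussian_semigroup s x) =
      (\<integral>\<^sup>+y. ennreal (normal_density x (sqrt s) y) * (\<integral>\<^sup>+z. ennreal (normal_density y (sqrt t) z) * indicator A z \<partial>lborel) \<partial>lborel)"
    using s t by (simp add: emeasure_gaussian) (simp add: gaussian_semigroup_def nn_integral_density)
  also have "\<dots> = (\<integral>\<^sup>+y. \<integral>\<^sup>+z. ennreal (normal_density x (sqrt s) y) * ennreal (normal_density y (sqrt t) z) * indicator A z \<partial>lborel \<partial>lborel)"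
    by (intro nn_integral_cong) (simp add: nn_integral_cmult[symmetric] mult.assoc)
  also have "\<dots> = (\<integral>\<^sup>+z. \<integral>\<^sup>+y. ennreal (normal_density x (sqrt s) y) * ennreal (normal_density y (sqrt t) z) * indicator A z \<partial>lborel \<partial>lborel)"
    by (rule lborel_pair.Fubini') measurable
  also have "\<dots> = (\<integral>\<^sup>+z. ennreal (normal_density x (sqrt (s + t)) z) * indicator A z \<partial>lborel)"
    by (intro nn_integral_cong) (simp add: nn_integral_multc conv)
  also have "\<dots> = emeasure (gaussian_semigroup (s + t) x) A"
    using s t by (simp add: emeasure_gaussian)
  finally show ?thesis by simp
qed

lemma kernel_semigroup_gaussian: "kernel_semigroup borel gaussian_semigroup"
  unfolding kernel_semigroup_def
proof (intro conjI allI ballI impI)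
  fix t :: real assume t: "0 \<le> t"
  show "gaussian_semigroup t \<in> borel \<rightarrow>\<^sub>M subprob_algebra borel"
  proof (rule measurable_subprob_algebra)
    show "subprob_space (gaussian_semigroup t x)" for x
      using prob_space_gaussian[OF t] by (rule prob_space_imp_subprob_space)
    fix A :: "real set" assume A [measurable]: "A \<in> sets borel"
    have "emeasure (gaussian_semigroup t x) A = (\<integral>\<^sup>+z. indicator A (x + sqrt t * z) \<partial>std_normal)" for x
      using nn_integral_gaussian[OF t, of "indicator A" x] by simp
    then show "(\<lambda>x. emeasure (gaussian_semigroup t x) A) \<in> borel_measurable borel"
      by (simp add: nn_integral_density)
  qed simp
next
  show "gaussian_semigroup 0 x = return borel x" for x by (simp add: gaussian_semigroup_def)
next
  fix s t x :: real and A :: "real set" assume s: "0 \<le> s" and t: "0 \<le> t" and A: "A \<in> sets borel"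
  consider "s = 0" | "t = 0" | "0 < s" "0 < t" using s t by linarith
  then show "emeasure (gaussian_semigroup (s + t) x) A = (\<integral>\<^sup>+y. emeasure (gaussian_semigroup t y) A \<partial>gaussian_semigroup s x)"
  proof cases
    case 1
    have "emeasure (gaussian_semigroup t y) A = (\<integral>\<^sup>+z. indicator A (y + sqrt t * z) \<partial>std_normal)" for y
      using nn_integral_gaussian[OF t, of "indicator A" y] A by simp
    then have "(\<lambda>y. emeasure (gaussian_semigroup t y) A) \<in> borel_measurable borel"
      using A by (simp add: nn_integral_density)
    then have "(\<integral>\<^sup>+y. emeasure (gaussian_semigroup t y) A \<partial>return borel x) = emeasure (gaussian_semigroup t x) A"
      by (subst nn_integral_return) auto
    with 1 show ?thesis by (simp add: gaussian_semigroup_def[of 0])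
  next
    case 2
    have "(\<integral>\<^sup>+y. emeasure (gaussian_semigroup 0 y) A \<partial>gaussian_semigroup s x) = (\<integral>\<^sup>+y. indicator A y \<partial>gaussian_semigroup s x)"
      using A by (intro nn_integral_cong) (simp add: gaussian_semigroup_def[of 0])
    with 2 A show ?thesis by simp
  next
    case 3
    then show ?thesis using A by (rule gaussian_chapman_kolmogorov)
  qed
qed

lemma negligible_singleton_gaussian: "negligible_set borel gaussian_semigroup {a}"
  unfolding negligible_set_def
proof (intro conjI allI ballI impI)
  fix t x :: real assume t: "0 < t"
  have "{a} \<in> null_sets (density lborel (\<lambda>y. ennreal (normal_density x (sqrt t) y))) \<longleftrightarrow>
      {a} \<in> sets lborel \<and> (AE y in lborel. y \<in> {a} \<longrightarrow> ennreal (normal_density x (sqrt t) y) = 0)"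
    by (rule null_sets_density_iff) simp
  moreover have "AE y in lborel. y \<in> {a} \<longrightarrow> ennreal (normal_density x (sqrt t) y) = 0"
    using AE_lborel_singleton[of a] by eventually_elim simp
  ultimately have "{a} \<in> null_sets (density lborel (\<lambda>y. ennreal (normal_density x (sqrt t) y)))"
    by simp
  then show "emeasure (gaussian_semigroup t x) {a} = 0" using t by (auto simp: gaussian_semigroup_def)
qed simp

lemma Bb_borel_bound: "f \<in> Bb (borel :: real measure) \<Longrightarrow> \<exists>B\<ge>0. \<forall>x. \<bar>f x\<bar> \<le> B"
  using Bb_bound[of f borel] by simp

lemma gaussian_integral_bound:
  fixes f :: "real \<Rightarrow> real"
  assumes t: "0 \<le> t" and f: "f \<in> borel_measurable borel" "\<And>x. \<bar>f x\<bar> \<le> B"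
  shows "\<bar>\<integral>y. f y \<partial>gaussian_semigroup t x\<bar> \<le> B"
proof -
  interpret prob_space "gaussian_semigroup t x" using t by (rule prob_space_gaussian)
  have fm: "f \<in> borel_measurable (gaussian_semigroup t x)"
    using f measurable_cong_sets[OF sets_gaussian refl] by blast
  then have "integrable (gaussian_semigroup t x) f" using f by (intro integrable_const_bound[of _ B]) auto
  then have *: "(\<integral>y. \<bar>f y\<bar> \<partial>gaussian_semigroup t x) \<le> (\<integral>y. B \<partial>gaussian_semigroup t x)"
    using f by (intro integral_mono) auto
  have "\<bar>\<integral>y. f y \<partial>gaussian_semigroup t x\<bar> \<le> (\<integral>y. \<bar>f y\<bar> \<partial>gaussian_semigroup t x)"
    by (rule integral_abs_bound)
  also have "\<dots> \<le> B" using * by (simp add: prob_space)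
  finally show ?thesis .
qed

text \<open>
  Dominated convergence: the densities with variance \<open>t\<close> and means in a bounded set are bounded by a multiple of the
  centred density with variance \<open>2 t\<close>.
\<close>
lemma continuous_gaussian:
  assumes t: "0 < t" and f: "f \<in> Bb borel"
  shows "continuous_on UNIV (\<lambda>x. \<integral>y. f y \<partial>gaussian_semigroup t x)"
proof (rule continuous_on_sequentiallyI)
  obtain B where B: "0 \<le> B" "\<And>x. \<bar>f x\<bar> \<le> B" using Bb_borel_bound[OF f] by blast
  have fm [measurable]: "f \<in> borel_measurable borel" using f by (simp add: Bb_def)
  have eq: "(\<integral>y. f y \<partial>gaussian_semigroup t x) = (\<integral>y. normal_density x (sqrt t) y * f y \<partial>lborel)" for x
    using t unfolding gaussian_semigroup_def by (simp add: integral_density)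
  fix u :: "nat \<Rightarrow> real" and x assume u: "u \<longlonglongrightarrow> x"
  then obtain R where R: "\<And>n. \<bar>u n\<bar> \<le> R" using convergent_imp_Bseq[of u] by (auto simp: convergent_def Bseq_def)
  let ?w = "\<lambda>y. B * (sqrt 2 * exp (R\<^sup>2 / (2 * t))) * normal_density 0 (sqrt (2 * t)) y"
  have dom: "\<bar>normal_density (u n) (sqrt t) y * f y\<bar> \<le> ?w y" for n y
  proof -
    have "(u n)\<^sup>2 \<le> R\<^sup>2" using R[of n] by (metis abs_ge_zero power2_abs power_mono)
    moreover have "0 \<le> (y - 2 * u n)\<^sup>2" by simp
    ultimately have "y\<^sup>2 / 2 - R\<^sup>2 \<le> (y - u n)\<^sup>2" by (simp add: power2_eq_square algebra_simps)
    then have "- (y - u n)\<^sup>2 / (2 * t) \<le> (R\<^sup>2 - y\<^sup>2 / 2) / (2 * t)"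
      using t by (intro divide_right_mono) auto
    also have "\<dots> = R\<^sup>2 / (2 * t) + - y\<^sup>2 / (2 * (2 * t))" using t by (simp add: field_simps)
    finally have "exp (- (y - u n)\<^sup>2 / (2 * t)) \<le> exp (R\<^sup>2 / (2 * t)) * exp (- y\<^sup>2 / (2 * (2 * t)))"
      by (simp flip: exp_add)
    then have "1 / sqrt (2 * pi * t) * exp (- (y - u n)\<^sup>2 / (2 * t)) \<le>
        1 / sqrt (2 * pi * t) * (exp (R\<^sup>2 / (2 * t)) * exp (- y\<^sup>2 / (2 * (2 * t))))"
      using t by (intro mult_left_mono) auto
    moreover have "sqrt (2 * pi * (2 * t)) = sqrt 2 * sqrt (2 * pi * t)"
      by (subst real_sqrt_mult[symmetric]) (simp add: mult_ac)
    then have "1 / sqrt (2 * pi * t) = sqrt 2 * (1 / sqrt (2 * pi * (2 * t)))"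
      by simp
    moreover have "normal_density (u n) (sqrt t) y = 1 / sqrt (2 * pi * t) * exp (- (y - u n)\<^sup>2 / (2 * t))"
      "normal_density 0 (sqrt (2 * t)) y = 1 / sqrt (2 * pi * (2 * t)) * exp (- y\<^sup>2 / (2 * (2 * t)))"
      using t by (simp_all add: normal_density_def)
    ultimately have le: "normal_density (u n) (sqrt t) y \<le> sqrt 2 * exp (R\<^sup>2 / (2 * t)) * normal_density 0 (sqrt (2 * t)) y"
      by (simp only: mult_ac)
    have "\<bar>normal_density (u n) (sqrt t) y * f y\<bar> = \<bar>f y\<bar> * normal_density (u n) (sqrt t) y"
      by (simp add: abs_mult)
    also have "\<dots> \<le> B * (sqrt 2 * exp (R\<^sup>2 / (2 * t)) * normal_density 0 (sqrt (2 * t)) y)"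
      using le B by (intro mult_mono) auto
    finally show ?thesis by (simp only: mult.assoc)
  qed
  have "(\<lambda>n. \<integral>y. normal_density (u n) (sqrt t) y * f y \<partial>lborel) \<longlonglongrightarrow> (\<integral>y. normal_density x (sqrt t) y * f y \<partial>lborel)"
  proof (rule integral_dominated_convergence[where w = ?w])
    show "integrable lborel ?w" using t by (intro integrable_mult_right integrable_normal_density) auto
    show "AE y in lborel. (\<lambda>n. normal_density (u n) (sqrt t) y * f y) \<longlonglongrightarrow> normal_density x (sqrt t) y * f y"
      unfolding normal_density_def using t u by (intro AE_I2 tendsto_intros) auto
    show "AE y in lborel. norm (normal_density (u n) (sqrt t) y * f y) \<le> ?w y" for n
      using dom by (intro AE_I2) simp
  qed auto
  then show "(\<lambda>n. \<integral>y. f y \<partial>gaussian_semigroup t (u n)) \<longlonglongrightarrow> (\<integral>y. f y \<partial>gaussian_semigroup t x)"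
    unfolding eq .
qed

lemma strong_feller_gaussian: "strong_feller euclidean gaussian_semigroup"
  unfolding strong_feller_def borel_of_euclidean
proof (intro conjI allI ballI impI kernel_semigroup_gaussian)
  fix t :: real and f :: "real \<Rightarrow> real" assume t: "0 < t" and f: "f \<in> Bb borel"
  obtain B where B: "0 \<le> B" "\<And>x. \<bar>f x\<bar> \<le> B" using Bb_borel_bound[OF f] by blast
  have "\<bar>\<integral>y. f y \<partial>gaussian_semigroup t x\<bar> \<le> B" for x
    using t f B by (intro gaussian_integral_bound) (auto simp: Bb_def)
  then show "(\<lambda>x. \<integral>y. f y \<partial>gaussian_semigroup t x) \<in> Cb euclidean"
    using continuous_gaussian[OF t f] by (auto simp: Cb_def bounded_real)
qed

lemma jointly_continuous_gaussian: "jointly_continuous euclidean gaussian_semigroup"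
  unfolding jointly_continuous_def
proof
  fix f :: "real \<Rightarrow> real" assume f: "f \<in> Cb euclidean"
  then have fc: "continuous_on UNIV f" by (simp add: Cb_def)
  have fB: "f \<in> Bb borel" using f Cb_subset_Bb[of "euclidean :: real topology"] by (auto simp: borel_of_euclidean)
  obtain B where B: "0 \<le> B" "\<And>x. \<bar>f x\<bar> \<le> B" using Bb_borel_bound[OF fB] by blast
  have fm [measurable]: "f \<in> borel_measurable borel" using fB by (simp add: Bb_def)
  interpret prob_space std_normal by (rule prob_space_std_normal)
  have "continuous_on ({0..} \<times> UNIV) (\<lambda>(t, x). \<integral>y. f y \<partial>gaussian_semigroup t x)"
  proof (rule continuous_on_sequentiallyI)
    fix u :: "nat \<Rightarrow> real \<times> real" and z assume u: "\<forall>n. u n \<in> {0..} \<times> UNIV" "z \<in> {0..} \<times> UNIV" "u \<longlonglongrightarrow> z"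
    have eq: "(case w of (t, x) \<Rightarrow> \<integral>y. f y \<partial>gaussian_semigroup t x) = (\<integral>v. f (snd w + sqrt (fst w) * v) \<partial>std_normal)"
      if "w \<in> {0..} \<times> UNIV" for w
      using that by (auto simp: integral_gaussian)
    have "(\<lambda>n. \<integral>v. f (snd (u n) + sqrt (fst (u n)) * v) \<partial>std_normal) \<longlonglongrightarrow> (\<integral>v. f (snd z + sqrt (fst z) * v) \<partial>std_normal)"
    proof (rule integral_dominated_convergence[where w = "\<lambda>_. B"])
      have "(\<lambda>n. f (snd (u n) + sqrt (fst (u n)) * v)) \<longlonglongrightarrow> f (snd z + sqrt (fst z) * v)" for v
        by (rule continuous_on_tendsto_compose[OF fc]) (auto intro!: tendsto_intros u)
      then show "AE v in std_normal. (\<lambda>n. f (snd (u n) + sqrt (fst (u n)) * v)) \<longlonglongrightarrow> f (snd z + sqrt (fst z) * v)"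
        by (intro AE_I2)
    qed (use B in auto)
    then show "(\<lambda>n. case u n of (t, x) \<Rightarrow> \<integral>y. f y \<partial>gaussian_semigroup t x) \<longlonglongrightarrow>
        (case z of (t, x) \<Rightarrow> \<integral>y. f y \<partial>gaussian_semigroup t x)"
      using u by (subst eq, simp)+ simp
  qed
  moreover have "prod_topology (top_of_set {0::real..}) (euclidean :: real topology) = top_of_set ({0..} \<times> UNIV)"
    using subtopology_Times[of "euclidean :: real topology" "euclidean :: real topology" "{0..}" UNIV] by simp
  ultimately show "continuous_map (prod_topology (top_of_set {0..}) euclidean) euclideanreal
      (\<lambda>(t, x). \<integral>y. f y \<partial>gaussian_semigroup t x)" by simp
qed

text \<open>
  The exponentials are eigenfunctions: completing the square turns the integrand into a shifted
  normal density.
\<close>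
lemma nn_integral_exp_gaussian:
  assumes t: "0 \<le> t"
  shows "(\<integral>\<^sup>+y. ennreal (exp (c * y)) \<partial>gaussian_semigroup t x) = ennreal (exp (c\<^sup>2 * t / 2)) * ennreal (exp (c * x))"
proof -
  let ?a = "c * sqrt t"
  have eq: "std_normal_density z * exp (c * (x + sqrt t * z)) = exp (c\<^sup>2 * t / 2) * exp (c * x) * normal_density ?a 1 z" for z
  proof -
    have "?a\<^sup>2 = c\<^sup>2 * t" using t by (simp add: power_mult_distrib)
    then have "- z\<^sup>2 / 2 + c * (x + sqrt t * z) = c\<^sup>2 * t / 2 + c * x + - (z - ?a)\<^sup>2 / 2"
      by (simp add: power2_diff algebra_simps add_divide_distrib diff_divide_distrib)
    then have "exp (- z\<^sup>2 / 2) * exp (c * (x + sqrt t * z)) = exp (c\<^sup>2 * t / 2) * exp (c * x) * exp (- (z - ?a)\<^sup>2 / 2)"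
      by (simp flip: exp_add)
    then show ?thesis by (simp add: normal_density_def)
  qed
  have "(\<integral>\<^sup>+y. ennreal (exp (c * y)) \<partial>gaussian_semigroup t x) = (\<integral>\<^sup>+z. ennreal (std_normal_density z * exp (c * (x + sqrt t * z))) \<partial>lborel)"
    using t by (simp add: nn_integral_gaussian nn_integral_density ennreal_mult')
  also have "\<dots> = (\<integral>\<^sup>+z. ennreal (exp (c\<^sup>2 * t / 2) * exp (c * x)) * ennreal (normal_density ?a 1 z) \<partial>lborel)"
    unfolding eq by (simp add: ennreal_mult')
  also have "\<dots> = ennreal (exp (c\<^sup>2 * t / 2) * exp (c * x)) * 1"
    by (subst nn_integral_cmult) (simp_all add: nn_integral_eq_integral)
  finally show ?thesis by (simp add: ennreal_mult')
qed

text \<open>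
  Markov's inequality for the fourth moment, chosen because it gives a bound of the order \<open>h\<^sup>2\<close>: its sum over
  \<open>1 / h\<close> steps tends to \<open>0\<close>, and is summable along \<open>h = 1 / 2 ^ n\<close>.
\<close>
lemma gaussian_overshoot:
  assumes h: "0 \<le> h" and e: "0 < e" and y: "0 < y"
  shows "(\<integral>z. indicator {..- e} z \<partial>gaussian_semigroup h y) \<le> 3 * h\<^sup>2 / e ^ 4"
proof -
  interpret prob_space std_normal by (rule prob_space_std_normal)
  have m4: "has_bochner_integral lborel (\<lambda>z. std_normal_density z * z ^ 4) 3"
    using std_normal_moment_even[of 2] by (simp add: fact_numeral)
  have i4: "integrable std_normal (\<lambda>z. z ^ 4)" "(\<integral>z. z ^ 4 \<partial>std_normal) = 3"
    using m4 by (auto simp: integrable_density integral_density has_bochner_integral_iff)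
  have "(\<integral>z. indicator {..- e} z \<partial>gaussian_semigroup h y) = (\<integral>z. (indicator {..- e} (y + sqrt h * z) :: real) \<partial>std_normal)"
    using integral_gaussian[OF h, of "indicator {..- e}" y] by simp
  also have "\<dots> \<le> (\<integral>z. h\<^sup>2 / e ^ 4 * z ^ 4 \<partial>std_normal)"
  proof (rule integral_mono)
    show "integrable std_normal (\<lambda>z. indicator {..- e} (y + sqrt h * z) :: real)"
      by (intro integrable_const_bound[of _ 1]) (auto split: split_indicator)
    show "integrable std_normal (\<lambda>z. h\<^sup>2 / e ^ 4 * z ^ 4)" using i4 by simp
    fix z
    show "indicator {..- e} (y + sqrt h * z) \<le> h\<^sup>2 / e ^ 4 * z ^ 4"
    proof (cases "y + sqrt h * z \<le> - e")
      case True
      then have "e \<le> \<bar>sqrt h * z\<bar>" using y by simp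
      then have "e ^ 4 \<le> \<bar>sqrt h * z\<bar> ^ 4" using e by (intro power_mono) auto
      also have "\<dots> = h\<^sup>2 * z ^ 4"
        using h by (simp add: power_even_abs power_mult_distrib) (simp add: power2_eq_square power4_eq_xxxx)
      finally show ?thesis using True e by simp
    qed (use e in auto)
  qed
  also have "\<dots> = 3 * h\<^sup>2 / e ^ 4" using i4 by simp
  finally show ?thesis .
qed

lemma gaussian_negative_pos: "0 < (\<integral>z. (indicator {..<0} z :: real) \<partial>gaussian_semigroup 1 x)"
proof -
  interpret prob_space "gaussian_semigroup 1 x" by (rule prob_space_gaussian) simp
  have "measure (gaussian_semigroup 1 x) {..<0} \<noteq> 0"
  proof
    assume "measure (gaussian_semigroup 1 x) {..<0} = 0"
    then have "emeasure (gaussian_semigroup 1 x) {..<0} = 0" by (simp add: emeasure_eq_measure)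
    then have "{..<0} \<in> null_sets (density lborel (\<lambda>y. ennreal (normal_density x 1 y)))"
      by (auto simp: gaussian_semigroup_def null_sets_def)
    then have "AE y in lborel. y \<in> {..<0} \<longrightarrow> normal_density x 1 y = 0"
      by (subst (asm) null_sets_density_iff) (auto simp: ennreal_eq_0_iff order_antisym_conv)
    then have "AE y in lborel. y \<notin> {-1<..<0::real}"
      by eventually_elim (use normal_density_pos[of 1 x] in \<open>auto simp: less_le\<close>)
    then have "emeasure lborel {-1<..<0::real} = 0"
      using AE_iff_null_sets[of "{-1<..<0::real}" lborel] by auto
    then show False by simp
  qed
  then show ?thesis by (simp add: zero_less_measure_iff)
qed

section \<open>The punctured line\<close>

text \<open>
  Let \<open>s n\<close> be the first time in the dyadic grid of level \<open>n\<close> at which \<open>y\<close> is not positive.  The grids are nested,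
  so \<open>s n\<close> decreases to some \<open>a\<close>, and \<open>y (s n)\<close> tends to \<open>y a\<close> by right-continuity.
  As \<open>y\<close> is positive one step before \<open>s n\<close>, the assumption on the jumps bounds \<open>y (s n)\<close> from below.
\<close>
lemma right_continuous_crossing:
  fixes y :: "real \<Rightarrow> real"
  assumes rc: "\<And>t. 0 \<le> t \<Longrightarrow> (y \<longlongrightarrow> y t) (at_right t)"
    and y0: "0 < y 0" and y1: "y 1 \<le> 0"
    and jumps: "\<And>m. \<forall>\<^sub>F n in sequentially. \<forall>k<2 ^ n.
      \<not> (0 < y (real k / 2 ^ n) \<and> y (real (Suc k) / 2 ^ n) \<le> - (1 / real (Suc m)))"
  shows "\<exists>s\<ge>0. y s = 0"
proof -
  define k where "k n = (LEAST k. y (real k / 2 ^ n) \<le> 0)" for n :: nat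
  define s where "s n = real (k n) / 2 ^ n" for n
  have ex: "y (real (2 ^ n) / 2 ^ n) \<le> 0" for n :: nat using y1 by simp
  have k: "y (s n) \<le> 0" "k n \<le> 2 ^ n" for n
    unfolding s_def k_def by (rule LeastI[of "\<lambda>k. y (real k / 2 ^ n) \<le> 0", OF ex])
      (rule Least_le[of "\<lambda>k. y (real k / 2 ^ n) \<le> 0", OF ex])
  have k_pos: "0 < k n" for n using k(1)[of n] y0 by (cases "k n") (auto simp: s_def)
  have before: "0 < y (real (k n - 1) / 2 ^ n)" for n
    using not_less_Least[of "k n - 1" "\<lambda>k. y (real k / 2 ^ n) \<le> 0"] k_pos[of n] by (simp add: k_def not_le)
  have "s (Suc n) \<le> s n" for n
  proof -
    have "real (2 * k n) / 2 ^ Suc n = s n" by (simp add: s_def)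
    then have "k (Suc n) \<le> 2 * k n"
      unfolding k_def[of "Suc n"] using k(1)[of n] by (intro Least_le) simp
    then have "real (k (Suc n)) / 2 ^ Suc n \<le> real (2 * k n) / 2 ^ Suc n"
      by (intro divide_right_mono) (auto simp del: of_nat_mult)
    then show ?thesis by (simp add: s_def)
  qed
  then have dec: "decseq s" by (rule decseq_SucI)
  moreover have s0: "0 \<le> s n" for n by (simp add: s_def)
  ultimately obtain a where a: "s \<longlonglongrightarrow> a" "\<And>n. a \<le> s n"
    using decseq_convergent[of s 0] by metis
  have "0 \<le> a" using a(1) s0 by (intro LIMSEQ_le_const) auto
  have "continuous (at a within {a..}) y"
    unfolding continuous_within at_within_Ici_at_right using rc \<open>0 \<le> a\<close> by simp
  then have lim: "(\<lambda>n. y (s n)) \<longlonglongrightarrow> y a"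
    by (rule continuous_within_tendsto_compose') (use a in auto)
  have "y a \<le> 0" using lim k(1) by (intro LIMSEQ_le_const2) auto
  moreover have "- (1 / real (Suc m)) \<le> y a" for m
  proof -
    have "\<forall>\<^sub>F n in sequentially. - (1 / real (Suc m)) \<le> y (s n)"
      using jumps[of m]
    proof eventually_elim
      case (elim n)
      have "k n - 1 < 2 ^ n" using k(2)[of n] k_pos[of n] by linarith
      with elim have "\<not> (0 < y (real (k n - 1) / 2 ^ n) \<and> y (real (Suc (k n - 1)) / 2 ^ n) \<le> - (1 / real (Suc m)))"
        by blast
      then have "- (1 / real (Suc m)) < y (real (Suc (k n - 1)) / 2 ^ n)"
        using before[of n] by linarith
      moreover have "Suc (k n - 1) = k n" using k_pos[of n] by simp
      ultimately show ?case by (simp only: s_def less_imp_le)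
    qed
    then show ?thesis using lim by (intro tendsto_lowerbound) auto
  qed
  then have "0 \<le> y a"
  proof -
    have "(\<lambda>m. - (1 / real (Suc m))) \<longlonglongrightarrow> - 0" by (intro tendsto_intros LIMSEQ_Suc lim_1_over_n)
    then show ?thesis using \<open>\<And>m. - (1 / real (Suc m)) \<le> y a\<close> by (intro LIMSEQ_le_const2[of _ 0]) auto
  qed
  ultimately show ?thesis using \<open>0 \<le> a\<close> by (intro exI[of _ a]) auto
qed

text \<open>
  Started at \<open>1\<close>, almost every path would be right-continuous with asymptotically no overshoot below
  \<open>0\<close>, by the Borel-Cantelli lemma.  As it does not take the value \<open>0\<close>, it would be positive at time \<open>1\<close> by
  \<open>right_continuous_crossing\<close>.  But the normal distribution charges the negative half-line.
\<close>
theorem no_right_process_punctured_line: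
  fixes Y :: "('w, real) process"
  defines "F \<equiv> UNIV - {0 :: real}"
  assumes Y: "right_markov_process (restrict_space borel F) Y"
    and transition: "transition_function (restrict_space borel F) Y (restrict_semigroup gaussian_semigroup F)"
  shows False
proof -
  let ?M = "restrict_space borel F"
  interpret negligible_restriction borel gaussian_semigroup "{0}" F
    by unfold_locales (auto simp: F_def intro: kernel_semigroup_gaussian negligible_singleton_gaussian)
  interpret Yr: right_markov_process_core ?M Y
    using Y by (auto simp: right_markov_process_def right_markov_process_wrt_def)
  interpret Yk: markov_process_with_kernel ?M Y Q
    by unfold_locales (fact kernel_semigroup_restrict transition)+
  have one: "(1 :: real) \<in> F" "(1 :: real) \<in> space ?M" by (auto simp: F_def)
  interpret law: prob_space "law Y 1" using one(2) by (rule Yr.prob_space_law)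
  let ?y = "\<lambda>t \<omega>. coord Y 1 t \<omega>"
  have FM: "f \<in> borel_measurable ?M" if "f \<in> borel_measurable borel" for f :: "real \<Rightarrow> real"
    using that by (rule measurable_restrict_space1)
  have ind: "indicator A \<in> Bb ?M" if "A \<in> sets borel" for A :: "real set"
    using that by (intro BbI[of _ _ 1] FM) (auto split: split_indicator)
  have Q_int: "(\<integral>z. indicator A z \<partial>Q t y) = (\<integral>z. indicator A z \<partial>gaussian_semigroup t y :: real)"
    if "0 \<le> t" "y \<in> F" "A \<in> sets borel" for t y and A :: "real set"
    using that by (intro integral_restrict_semigroup) auto
  have alive: "AE \<omega> in law Y 1. \<forall>t\<ge>0. path Y t \<omega> \<noteq> None"
  proof (rule Yk.AE_alive[OF one(2)])
    fix t :: real assume t: "0 \<le> t"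
    interpret G: prob_space "gaussian_semigroup t 1" using t by (rule prob_space_gaussian)
    have "emeasure (Q t 1) F = emeasure (gaussian_semigroup t 1) (space (gaussian_semigroup t 1))"
      unfolding emeasure_restrict_semigroup[OF t one(1) order_refl]
    proof (rule emeasure_eq_AE)
      show "AE y in gaussian_semigroup t 1. y \<in> F \<longleftrightarrow> y \<in> space (gaussian_semigroup t 1)"
        using AE_kernel_F[OF t one(1)] AE_space by eventually_elim simp
    qed (use F_sets in \<open>auto simp: space_gaussian\<close>)
    then show "emeasure (Q t 1) (space ?M) = 1" by (simp add: G.emeasure_space_1)
  qed
  have coord_F: "?y t \<omega> \<in> F" if "0 \<le> t" "\<omega> \<in> space (base Y)" for t \<omega>
    using measurable_space[OF Yr.measurable_coord[of t 1 ?M]] that one by auto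
  have coord_m: "?y t \<in> borel_measurable (law Y 1)" if "0 \<le> t" for t
    unfolding Yr.measurable_law_iff[OF one(2)] using that by (intro Yr.measurable_coord) (auto intro: FM)
  \<comment> \<open>The exponential with \<open>c\<^sup>2 = 2 \<beta>\<close> grows at the rate \<open>\<beta>\<close> and is \<open>\<beta>\<close>-excessive; it is injective.\<close>
  obtain \<beta> where \<beta>: "0 < \<beta>" "\<And>u x. excessive ?M (process_semigroup Y) \<beta> u \<Longrightarrow> x \<in> space ?M \<Longrightarrow> AE \<omega> in law Y x.
        \<forall>t\<ge>0. ((\<lambda>s. extend_zero u (path Y s \<omega>)) \<longlongrightarrow> extend_zero u (path Y t \<omega>)) (at_right t)"
    using Yr.excessive_right_continuous by blast
  define c where "c = sqrt (2 * \<beta>)"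
  have c: "0 < c" "c\<^sup>2 = 2 * \<beta>" using \<beta>(1) by (auto simp: c_def)
  let ?u = "\<lambda>x. ennreal (exp (c * x))"
  have um: "?u \<in> borel_measurable ?M" by (intro measurable_restrict_space1) simp
  have resolvent: "ennreal q * resolvent (process_semigroup Y) (\<beta> + q) ?u x = ?u x" if q: "0 < q" and x: "x \<in> F" for q x
  proof -
    have "resolvent (process_semigroup Y) (\<beta> + q) ?u x =
        (\<integral>\<^sup>+t. (ennreal (exp (- (q * t))) * indicator {0..} t) * ?u x \<partial>lborel)"
      unfolding resolvent_def
    proof (rule nn_integral_cong)
      fix t :: real
      show "ennreal (exp (- ((\<beta> + q) * t))) * process_semigroup Y t ?u x * indicator {0..} t =
          (ennreal (exp (- (q * t))) * indicator {0..} t) * ?u x"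
      proof (cases "0 \<le> t")
        case True
        have "process_semigroup Y t ?u x = (\<integral>\<^sup>+y. ?u y \<partial>gaussian_semigroup t x)"
          using True x um by (simp add: Yk.process_semigroup_eq nn_integral_restrict_semigroup[where g = ?u])
        also have "\<dots> = ennreal (exp (\<beta> * t)) * ?u x"
          using nn_integral_exp_gaussian[OF True, where c = c and x = x] c by simp
        finally have "process_semigroup Y t ?u x = ennreal (exp (\<beta> * t)) * ?u x" .
        moreover have "exp (- ((\<beta> + q) * t)) * exp (\<beta> * t) = exp (- (q * t))"
          by (simp add: algebra_simps flip: exp_add)
        then have "ennreal (exp (- ((\<beta> + q) * t))) * ennreal (exp (\<beta> * t)) = ennreal (exp (- (q * t)))"
          by (simp add: ennreal_mult'[symmetric])
        ultimately show ?thesis using True by (simp add: mult.assoc[symmetric])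
      qed simp
    qed
    also have "\<dots> = ennreal (1 / q) * ?u x"
      using nn_integral_exp_Ici[OF q] by (subst nn_integral_multc) auto
    finally show ?thesis using q by (simp add: mult.assoc[symmetric] ennreal_mult'[symmetric])
  qed
  have "excessive ?M (process_semigroup Y) \<beta> ?u"
    unfolding excessive_def
  proof (intro conjI ballI allI impI um)
    fix x assume "x \<in> space ?M"
    then have x: "x \<in> F" by simp
    show "ennreal q * resolvent (process_semigroup Y) (\<beta> + q) ?u x \<le> ?u x" if "0 < q" for q
      using resolvent[OF that x] by simp
    have "\<forall>\<^sub>F q in at_top. ?u x = ennreal q * resolvent (process_semigroup Y) (\<beta> + q) ?u x"
      using eventually_gt_at_top[of "0::real"] by eventually_elim (simp add: resolvent[OF _ x])
    then show "((\<lambda>q. ennreal q * resolvent (process_semigroup Y) (\<beta> + q) ?u x) \<longlongrightarrow> ?u x) at_top"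
      by (rule Lim_transform_eventually[OF tendsto_const])
  qed
  note exp_rc = \<beta>(2)[OF this one(2)]
  have rc: "AE \<omega> in law Y 1. \<forall>t\<ge>0. ((\<lambda>s. ?y s \<omega>) \<longlongrightarrow> ?y t \<omega>) (at_right t)"
    using exp_rc alive
  proof eventually_elim
    case (elim \<omega>)
    have eq: "extend_zero ?u (path Y s \<omega>) = ?u (?y s \<omega>)" if "0 \<le> s" for s
      using elim(2)[rule_format, OF that] by (auto simp: coord_def)
    show ?case
    proof (intro allI impI)
      fix t :: real assume t: "0 \<le> t"
      have "((\<lambda>s. extend_zero ?u (path Y s \<omega>)) \<longlongrightarrow> ?u (?y t \<omega>)) (at_right t)"
        using elim(1)[rule_format, OF t] unfolding eq[OF t] .
      then have "((\<lambda>s. enn2real (extend_zero ?u (path Y s \<omega>))) \<longlongrightarrow> exp (c * ?y t \<omega>)) (at_right t)"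
        by (rule tendsto_enn2real) simp
      moreover have "\<forall>\<^sub>F s in at_right t. enn2real (extend_zero ?u (path Y s \<omega>)) = exp (c * ?y s \<omega>)"
        unfolding eventually_at_right_field using t by (intro exI[of _ "t + 1"]) (auto simp: eq)
      ultimately have "((\<lambda>s. exp (c * ?y s \<omega>)) \<longlongrightarrow> exp (c * ?y t \<omega>)) (at_right t)"
        by (rule Lim_transform_eventually)
      then have "((\<lambda>s. ln (exp (c * ?y s \<omega>))) \<longlongrightarrow> ln (exp (c * ?y t \<omega>))) (at_right t)"
        by (rule tendsto_ln) simp
      then have "((\<lambda>s. c * ?y s \<omega> / c) \<longlongrightarrow> c * ?y t \<omega> / c) (at_right t)"
        using c(1) by (intro tendsto_divide tendsto_const) auto
      then show "((\<lambda>s. ?y s \<omega>) \<longlongrightarrow> ?y t \<omega>) (at_right t)" using c(1) by simp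
    qed
  qed
  \<comment> \<open>\<open>E e n k\<close>: in the step number \<open>k\<close> of the grid of level \<open>n\<close> the path jumps from above \<open>0\<close> to \<open>- e\<close> or below.\<close>
  define E where "E e n k = {\<omega> \<in> space (law Y 1). 0 < ?y (real k / 2 ^ n) \<omega> \<and> ?y (real (Suc k) / 2 ^ n) \<omega> \<le> - e}"
    for e :: real and n k :: nat
  have E_sets: "E e n k \<in> sets (law Y 1)" for e n k
  proof -
    have [measurable]: "?y (real k / 2 ^ n) \<in> borel_measurable (law Y 1)" "?y (real (Suc k) / 2 ^ n) \<in> borel_measurable (law Y 1)"
      by (intro coord_m; simp)+
    show ?thesis unfolding E_def by measurable
  qed
  have E_prob: "measure (law Y 1) (E e n k) \<le> 3 * (1 / 2 ^ n)\<^sup>2 / e ^ 4" if e: "0 < e" for e n k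
  proof -
    define t where "t = real k / 2 ^ n"
    define h where "h = 1 / (2 :: real) ^ n"
    have th: "0 \<le> t" "0 \<le> h" "real (Suc k) / 2 ^ n = t + h"
      by (auto simp: t_def h_def add_divide_distrib)
    let ?Z = "\<lambda>\<omega>. extend_zero (indicator {0<..}) (path Y t \<omega>) :: real"
    let ?f = "indicator {..- e} :: real \<Rightarrow> real"
    have Zm: "?Z \<in> borel_measurable (filt Y t)"
      using th(1) by (intro Yr.measurable_path FM) auto
    have "measure (law Y 1) (E e n k) = (\<integral>\<omega>. indicator (E e n k) \<omega> \<partial>law Y 1)"
      using E_sets by simp
    also have "\<dots> = (\<integral>\<omega>. ?Z \<omega> * extend_zero ?f (path Y (t + h) \<omega>) \<partial>law Y 1)"
    proof (rule integral_cong_AE)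
      show "AE \<omega> in law Y 1. indicator (E e n k) \<omega> = ?Z \<omega> * extend_zero ?f (path Y (t + h) \<omega>)"
        using alive AE_space
      proof eventually_elim
        case (elim \<omega>)
        have "?Z \<omega> = indicator {0<..} (?y t \<omega>)" "extend_zero ?f (path Y (t + h) \<omega>) = ?f (?y (t + h) \<omega>)"
          using elim(1)[rule_format, of t] elim(1)[rule_format, of "t + h"] th by (auto simp: coord_def)
        then show ?case using elim(2) unfolding E_def th(3) t_def[symmetric] by (auto split: split_indicator)
      qed
      have "?Z \<in> borel_measurable (law Y 1)"
        using Yr.measurable_filt_base[OF th(1) Zm] by (simp add: Yr.measurable_law_iff[OF one(2)])
      moreover have "(\<lambda>\<omega>. extend_zero ?f (path Y (t + h) \<omega>)) \<in> borel_measurable (law Y 1)"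
        unfolding Yr.measurable_law_iff[OF one(2)] using th by (intro Yr.measurable_path_base FM) auto
      ultimately show "(\<lambda>\<omega>. ?Z \<omega> * extend_zero ?f (path Y (t + h) \<omega>)) \<in> borel_measurable (law Y 1)"
        by (rule borel_measurable_times)
    qed (use E_sets in simp)
    also have "\<dots> = (\<integral>\<omega>. ?Z \<omega> * extend_zero (\<lambda>y. \<integral>z. ?f z \<partial>Q h y) (path Y t \<omega>) \<partial>law Y 1)"
      using th Zm by (intro Yk.markov_step[OF one(2), where B = 1] ind) (auto split: option.split split_indicator)
    also have "\<dots> \<le> (\<integral>\<omega>. 3 * h\<^sup>2 / e ^ 4 \<partial>law Y 1)"
    proof (rule integral_mono')
      have C: "0 \<le> 3 * h\<^sup>2 / e ^ 4" using e by simp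
      then show "0 \<le> 3 * h\<^sup>2 / e ^ 4" .
      fix \<omega> assume "\<omega> \<in> space (law Y 1)"
      then have \<omega>: "\<omega> \<in> space (base Y)" by (simp add: Yr.space_law[OF one(2)])
      show "?Z \<omega> * extend_zero (\<lambda>y. \<integral>z. ?f z \<partial>Q h y) (path Y t \<omega>) \<le> 3 * h\<^sup>2 / e ^ 4"
        using Yr.path_cases[OF th(1) \<omega>]
      proof cases
        case 1
        then show ?thesis using C by simp
      next
        case (2 y)
        have "(\<integral>z. ?f z \<partial>Q h y) = (\<integral>z. ?f z \<partial>gaussian_semigroup h y)"
          using 2 th by (intro Q_int) auto
        then show ?thesis
          using 2 gaussian_overshoot[OF th(2) e, of y] C by (cases "0 < y") auto
      qed
    qed simp
    also have "\<dots> = 3 * (1 / 2 ^ n)\<^sup>2 / e ^ 4" by (simp add: law.prob_space h_def)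
    finally show ?thesis .
  qed
  have no_jumps: "AE \<omega> in law Y 1. \<forall>m. \<forall>\<^sub>F n in sequentially. \<omega> \<in> space (law Y 1) - (\<Union>k<2 ^ n. E (1 / real (Suc m)) n k)"
    unfolding AE_all_countable
  proof
    fix m
    let ?e = "1 / real (Suc m)"
    show "AE \<omega> in law Y 1. \<forall>\<^sub>F n in sequentially. \<omega> \<in> space (law Y 1) - (\<Union>k<2 ^ n. E ?e n k)"
    proof (rule borel_cantelli_AE1)
      show "(\<Union>k<2 ^ n. E ?e n k) \<in> sets (law Y 1)" for n using E_sets by auto
      show "emeasure (law Y 1) (\<Union>k<2 ^ n. E ?e n k) < \<infinity>" for n
        by (simp add: law.emeasure_eq_measure)
      have bound: "measure (law Y 1) (\<Union>k<2 ^ n. E ?e n k) \<le> 3 / ?e ^ 4 * (1 / 2) ^ n" for n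
      proof -
        have "measure (law Y 1) (\<Union>k<2 ^ n. E ?e n k) \<le> (\<Sum>k<2 ^ n. measure (law Y 1) (E ?e n k))"
          using E_sets by (intro law.finite_measure_subadditive_finite) auto
        also have "\<dots> \<le> (\<Sum>k<(2::nat) ^ n. 3 * (1 / 2 ^ n)\<^sup>2 / ?e ^ 4)"
          by (intro sum_mono E_prob) simp
        also have "\<dots> = 3 / ?e ^ 4 * (1 / 2) ^ n"
          by (simp add: power2_eq_square power_one_over del: of_nat_Suc)
        finally show ?thesis .
      qed
      show "summable (\<lambda>n. measure (law Y 1) (\<Union>k<2 ^ n. E ?e n k))"
      proof (rule summable_comparison_test'[where N = 0])
        show "summable (\<lambda>n. 3 / ?e ^ 4 * (1 / 2) ^ n)"
          by (intro summable_mult summable_geometric) simp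
        show "norm (measure (law Y 1) (\<Union>k<2 ^ n. E ?e n k)) \<le> 3 / ?e ^ 4 * (1 / 2) ^ n" for n
          using bound[of n] by simp
      qed
    qed
  qed
  have pos: "AE \<omega> in law Y 1. 0 < ?y 1 \<omega>"
    using rc no_jumps Yr.normal[OF one(2)] AE_space
  proof eventually_elim
    case (elim \<omega>)
    then have \<omega>: "\<omega> \<in> space (base Y)" by (simp add: Yr.space_law[OF one(2)])
    show ?case
    proof (rule ccontr)
      assume "\<not> 0 < ?y 1 \<omega>"
      then have "\<exists>s\<ge>0. ?y s \<omega> = 0"
      proof (intro right_continuous_crossing)
        show "((\<lambda>s. ?y s \<omega>) \<longlongrightarrow> ?y t \<omega>) (at_right t)" if "0 \<le> t" for t using elim(1) that by blast
        show "0 < ?y 0 \<omega>" using elim(3) by (simp add: coord_def)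
        show "\<forall>\<^sub>F n in sequentially. \<forall>k<2 ^ n. \<not> (0 < ?y (real k / 2 ^ n) \<omega> \<and>
            ?y (real (Suc k) / 2 ^ n) \<omega> \<le> - (1 / real (Suc m)))" for m
          using elim(2)[rule_format, of m] by eventually_elim (auto simp: E_def)
      qed simp
      then show False using coord_F[OF _ \<omega>] by (auto simp: F_def)
    qed
  qed
  have "(\<integral>z. indicator {..<0} z \<partial>gaussian_semigroup 1 1 :: real) = (\<integral>z. indicator {..<0} z \<partial>Q 1 1)"
    using one by (intro Q_int[symmetric]) auto
  also have "\<dots> = (\<integral>\<omega>. extend_zero (indicator {..<0}) (path Y 1 \<omega>) \<partial>law Y 1)"
    using one by (intro Yk.integral_path[symmetric] ind) auto
  also have "\<dots> = (\<integral>\<omega>. 0 \<partial>law Y 1)"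
  proof (rule integral_cong_AE)
    show "AE \<omega> in law Y 1. extend_zero (indicator {..<0}) (path Y 1 \<omega>) = (0 :: real)"
      using pos by eventually_elim (auto simp: coord_def split: option.splits)
    show "(\<lambda>\<omega>. extend_zero (indicator {..<0}) (path Y 1 \<omega>) :: real) \<in> borel_measurable (law Y 1)"
      unfolding Yr.measurable_law_iff[OF one(2)] by (intro Yr.measurable_path_base FM) auto
  qed simp
  finally show False using gaussian_negative_pos[of 1] by simp
qed

section \<open>Non-existence of the restricted process\<close>

lemma restriction_of_strong_feller_process:
  fixes X :: "('v, 'a) process"
  assumes X: "right_markov_process M X" "conservative M X" "transition_function M X P"
    and T: "lusin_topology_of M T" "strong_feller T P" and N: "negligible_set M P N"
  defines "F \<equiv> space M - N"
  shows "lusin_topology (subtopology T F)" "strong_feller (subtopology T F) (restrict_semigroup P F)"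
    and "polish_topology T \<Longrightarrow> closedin T N \<Longrightarrow> jointly_continuous T P \<Longrightarrow>
      polish_topology (subtopology T F) \<and> jointly_continuous (subtopology T F) (restrict_semigroup P F)"
    and "\<not> polar M X N \<Longrightarrow> \<not> (\<exists>Y :: ('w, 'a) process. right_markov_process (restrict_space M F) Y \<and>
      transition_function (restrict_space M F) Y (restrict_semigroup P F))"
proof -
  have sets: "sets (borel_of T) = sets M" and top: "topspace T = space M" and lusin: "lusin_topology T"
    using T(1) by (auto simp: lusin_topology_of_def)
  have NT: "negligible_set (borel_of T) P N" using N by (simp add: negligible_set_def sets top)
  have FT: "F = topspace T - N" by (simp add: F_def top)
  have PT: "kernel_semigroup (borel_of T) P" using T(2) by (simp add: strong_feller_def)
  then have PM: "kernel_semigroup M P" using kernel_semigroup_cong[OF sets] by simp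
  have "F \<in> sets (borel_of T)" using N by (auto simp: F_def sets negligible_set_def)
  with lusin show "lusin_topology (subtopology T F)" by (rule lusin_topology_subtopology)
  show "strong_feller (subtopology T F) (restrict_semigroup P F)"
    using T(2) NT FT by (rule strong_feller_restrict)
  show "polish_topology (subtopology T F) \<and> jointly_continuous (subtopology T F) (restrict_semigroup P F)"
    if polish: "polish_topology T" and "closedin T N" and joint: "jointly_continuous T P"
  proof
    have "openin T F" using \<open>closedin T N\<close> by (auto simp: FT)
    with polish show "polish_topology (subtopology T F)" by (rule polish_topology_open_subtopology)
    have "metrizable_space T"
      using polish by (simp add: polish_topology_def completely_metrizable_imp_metrizable_space)
    then show "jointly_continuous (subtopology T F) (restrict_semigroup P F)"
      using PT joint NT \<open>closedin T N\<close> FT by (rule jointly_continuous_restrict)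
  qed
  show "\<not> (\<exists>Y :: ('w, 'a) process. right_markov_process (restrict_space M F) Y \<and>
      transition_function (restrict_space M F) Y (restrict_semigroup P F))" if "\<not> polar M X N"
    using polar_of_right_process_on_complement[OF X PM N F_def[THEN meta_eq_to_obj_eq]] that by blast
qed

lemma gaussian_restriction:
  defines "F \<equiv> UNIV - {0 :: real}"
  shows "polish_topology (top_of_set F)" "strong_feller (top_of_set F) (restrict_semigroup gaussian_semigroup F)"
    "jointly_continuous (top_of_set F) (restrict_semigroup gaussian_semigroup F)"
proof -
  have "polish_topology (euclidean :: real topology)"
    unfolding polish_topology_def
  proof
    obtain C :: "real set" where "countable C" "UNIV \<subseteq> closure C"
      using separable[of "UNIV :: real set"] by metis
    then show "separable_space (euclidean :: real topology)"
      unfolding separable_space_def by (intro exI[of _ C]) auto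
  qed (rule completely_metrizable_space_euclidean)
  then show "polish_topology (top_of_set F)"
    by (rule polish_topology_open_subtopology) (simp add: F_def open_delete)
  have N: "negligible_set (borel_of euclidean) gaussian_semigroup {0}"
    by (simp add: borel_of_euclidean negligible_singleton_gaussian)
  show "strong_feller (top_of_set F) (restrict_semigroup gaussian_semigroup F)"
    using strong_feller_gaussian N by (rule strong_feller_restrict) (simp add: F_def)
  show "jointly_continuous (top_of_set F) (restrict_semigroup gaussian_semigroup F)"
    using metrizable_space_euclidean _ jointly_continuous_gaussian N
    by (rule jointly_continuous_restrict) (auto simp: F_def borel_of_euclidean kernel_semigroup_gaussian)
qed

text \<open>
  Both sides are \<open>\<sigma>\<close>-algebras with the zero measure, so that it is enough to compare generators.
\<close>
lemma borel_of_eq_restrict_borel: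
  fixes F :: "real set"
  assumes F: "F \<in> sets borel" and T: "topspace T = F"
    and sets: "sets (borel_of T) = sigma_sets F {{a<..<b} \<inter> F |a b. True}"
  shows "borel_of T = restrict_space borel F"
proof (rule measure_eqI)
  have "sets (restrict_space borel F) = {(\<lambda>x. x) -` A \<inter> F |A. A \<in> sigma_sets UNIV (range (\<lambda>(a, b). {a<..<b :: real}))}"
    unfolding sets_restrict_space borel_eq_box box_real by (auto simp: image_iff)
  also have "\<dots> = sigma_sets F {(\<lambda>x. x) -` A \<inter> F |A. A \<in> range (\<lambda>(a, b). {a<..<b :: real})}"
    by (rule sigma_sets_vimage_commute) auto
  also have "{(\<lambda>x. x) -` A \<inter> F |A. A \<in> range (\<lambda>(a, b). {a<..<b :: real})} = {{a<..<b} \<inter> F |a b. True}"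
    by auto
  finally show eq: "sets (borel_of T) = sets (restrict_space borel F)" by (simp add: sets)
  fix A assume "A \<in> sets (borel_of T)"
  then have "A \<subseteq> F" using sets.sets_into_space[of A "borel_of T"] T by simp
  then have "emeasure (restrict_space borel F) A = emeasure borel A"
    using F by (intro emeasure_restrict_space) auto
  then show "emeasure (borel_of T) A = emeasure (restrict_space borel F) A"
    by (simp add: borel_of_def borel_def emeasure_sigma)
qed

theorem corollary2p8:
  shows
    "(\<forall>(M :: 'a measure) (P :: real \<Rightarrow> 'a \<Rightarrow> 'a measure) (X :: ('v, 'a) process) T N.
        lusin_measurable_space M \<and>
        right_markov_process M X \<and> conservative M X \<and> transition_function M X P \<and>
        (\<forall>t>0. P t \<in> M \<rightarrow>\<^sub>M subprob_algebra M) \<and>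
        lusin_topology_of M T \<and> strong_feller T P \<and>
        negligible_set M P N
      \<longrightarrow>
        (let F = space M - N; Q = restrict_semigroup P F in
          (lusin_topology (subtopology T F) \<and> strong_feller (subtopology T F) Q \<and>
           (\<not> polar M X N \<longrightarrow>
             \<not> (\<exists>Y :: ('w, 'a) process. right_markov_process (restrict_space M F) Y \<and>
                  transition_function (restrict_space M F) Y Q))) \<and>
          (polish_topology T \<and> closedin T N \<and> jointly_continuous T P \<longrightarrow>
             polish_topology (subtopology T F) \<and> strong_feller (subtopology T F) Q \<and>
             jointly_continuous (subtopology T F) Q \<and>
             (\<not> polar M X N \<longrightarrow>
               \<not> (\<exists>Y :: ('w, 'a) process. right_markov_process (restrict_space M F) Y \<and>
                    transition_function (restrict_space M F) Y Q))))) \<and>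
     (let F = UNIV - {0 :: real}; S = top_of_set F;
          Q = restrict_semigroup gaussian_semigroup F in
        polish_topology S \<and> strong_feller S Q \<and> jointly_continuous S Q \<and>
        \<not> (\<exists>Y :: ('w, real) process. right_markov_process (restrict_space borel F) Y \<and>
             transition_function (restrict_space borel F) Y Q) \<and>
        (\<forall>T. lusin_topology T \<and> topspace T = F \<and>
             sets (borel_of T) = sigma_sets F {{a<..<b} \<inter> F | a b. True} \<longrightarrow>
           \<not> (\<exists>Y :: ('w, real) process. right_markov_process_wrt T (borel_of T) Y \<and>
                transition_function (borel_of T) Y Q)))"
proof -
  let ?F = "UNIV - {0 :: real}"
  have punctured: "\<not> (\<exists>Y :: ('w, real) process. right_markov_process (restrict_space borel ?F) Y \<and>
      transition_function (restrict_space borel ?F) Y (restrict_semigroup gaussian_semigroup ?F))"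
    using no_right_process_punctured_line by blast
  have every_topology: "\<not> (\<exists>Y :: ('w, real) process. right_markov_process_wrt T (borel_of T) Y \<and>
      transition_function (borel_of T) Y (restrict_semigroup gaussian_semigroup ?F))"
    if "topspace T = ?F" "sets (borel_of T) = sigma_sets ?F {{a<..<b} \<inter> ?F | a b. True}" for T
    unfolding borel_of_eq_restrict_borel[of ?F T, OF _ that, simplified]
    using punctured by (auto simp: right_markov_process_def)
  show ?thesis
    unfolding Let_def
    by (intro conjI allI impI; (elim conjE)?;
        (rule gaussian_restriction punctured every_topology restriction_of_strong_feller_process(1,2,4)
          restriction_of_strong_feller_process(3)[THEN conjunct1] restriction_of_strong_feller_process(3)[THEN conjunct2];
          assumption)?)
qed

end
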